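(* Let $d\in[0,1]$ and let $\mathcal{U}$ be a family of graphons each of which is fractionally isomorphic to the constant-$d$ graphon $C_d$. Then for every $\varepsilon>0$ there exists $n_0\in\mathbb{N}$ such that for each integer $n\ge n_0$ there exist $D\in\mathbb{N}$ and a family $\{H_U\}_{U\in\mathcal{U}}$ of $D$-regular graphs, each on vertex set $[n]$, such that $\delta_\square(U,H_U)\le\varepsilon$ for every $U\in\mathcal{U}$.
   Context: Graphons: $(\Omega,\mathcal{B})$ is a standard Borel space with a Borel probability measure $\pi$ (atoms allowed). A graphon on $\Omega$ is a symmetric measurable $W\colon\Omega^2\to[0,1]$ (identified up to a.e. equality); $C_d$ is the graphon identically equal to $d$. For a measure-preserving map $\phi\colon\Lambda\to\Omega$, $W^\phi(x,y)=W(\phi(x),\phi(y))$. Graphons $W$ on $\Omega$ and $U$ on $\Lambda$ are isomorphic if there is a measure-preserving bijection $\phi\colon\Lambda\to\Omega$ with $W^\phi=U$. Cut distance: $\|W\|_\square=\sup_{S,T}\left|\int_{S\times T}W\,\mathrm{d}\pi^2\right|$ over measurable $S,T$; $\delta_\square(U,W)=\inf_\phi\|U^\phi-W\|_\square$ over measure-preserving bijections $\phi\colon\Omega\to\Lambda$. For a graph $F$ on vertex set $V$, its graphon representation $W_F$ on an atomless probability space is obtained by partitioning the space into sets $(\Omega_v)_{v\in V}$ of measure $1/|V|$ and setting $W_F=1$ on $\Omega_u\times\Omega_v$ if $uv\in E(F)$, else $0$; $\delta_\square(U,F):=\delta_\square(U,W_F)$. Fractional isomorphism of graphons: a sub-sigma-algebra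 $\mathcal{C}\subseteq\mathcal{B}$ is $\pi$-relatively complete if $\pi(S\triangle T)>0$ for all $S\in\mathcal{B}\setminus\mathcal{C}$, $T\in\mathcal{C}$. $T_W$ is the operator $(T_Wf)(x)=\int W(x,y)f(y)\,\mathrm{d}\pi(y)$ on $L^2(\Omega)$; a relatively complete $\mathcal{C}$ is $W$-invariant if $T_W$ maps $\mathcal{C}$-measurable $L^2$ functions to $\mathcal{C}$-measurable ones; $\mathcal{C}(W)$ is the minimum such sub-sigma-algebra. There is a quotient standard Borel probability space $(\Omega/\mathcal{C},\pi/\mathcal{C})$ with a measurable surjection $q_\mathcal{C}$ pushing $\pi$ forward to $\pi/\mathcal{C}$, through which exactly the $\mathcal{C}$-measurable functions factor, and $W/\mathcal{C}$ is the graphon on $\Omega/\mathcal{C}$ with $W/\mathcal{C}(q_\mathcal{C}(x),q_\mathcal{C}(y))=\mathbb{E}[W\mid\mathcal{C}\times\mathcal{C}](x,y)$ a.e. Graphons $W,U$ are fractionally isomorphic if $W/\mathcal{C}(W)$ and $U/\mathcal{C}(U)$ are isomorphic.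
   Formalization: For a graphon U on a space Ω with atoms no measure-preserving bijection to an atomless space exists, so δ(U,H) as defined is an infimum over the empty set; there U is first replaced by its pullback to the atomless space Ω×[0,1). Atomless U are treated literally. *)

theory Defs
  imports "HOL-Probability.Probability"
begin

section \<open>Standard Borel probability spaces and graphons\<close>

definition standard_borel :: "'a measure \<Rightarrow> bool" where
  "standard_borel M \<longleftrightarrow>
     (\<exists>X. topspace X = space M \<and> completely_metrizable_space X \<and> second_countable X \<and>
          sets M = sigma_sets (space M) {G. openin X G})"

definition standard_prob_space :: "'a measure \<Rightarrow> bool" where
  "standard_prob_space M \<longleftrightarrow> standard_borel M \<and> prob_space M"

definition atomless :: "'a measure \<Rightarrow> bool" where
  "atomless M \<longleftrightarrow>
     \<not> (\<exists>A\<in>sets M. emeasure M A > 0 \<and>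
          (\<forall>B\<in>sets M. B \<subseteq> A \<longrightarrow> emeasure M B = 0 \<or> emeasure M (A - B) = 0))"

text \<open>A graphon is given by a probability space together with a representative of its class modulo
  almost everywhere equality; the representative is chosen symmetric and \<open>[0,1]\<close>-valued everywhere.\<close>

definition graphon :: "'a measure \<Rightarrow> ('a \<Rightarrow> 'a \<Rightarrow> real) \<Rightarrow> bool" where
  "graphon M W \<longleftrightarrow>
     standard_prob_space M \<and>
     case_prod W \<in> borel_measurable (M \<Otimes>\<^sub>M M) \<and>
     (\<forall>x\<in>space M. \<forall>y\<in>space M. W x y = W y x \<and> 0 \<le> W x y \<and> W x y \<le> 1)"

definition const_graphon :: "real \<Rightarrow> 'a \<Rightarrow> 'a \<Rightarrow> real" where
  "const_graphon d = (\<lambda>x y. d)"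

definition measure_preserving :: "'a measure \<Rightarrow> 'b measure \<Rightarrow> ('a \<Rightarrow> 'b) \<Rightarrow> bool" where
  "measure_preserving M N f \<longleftrightarrow> f \<in> measurable M N \<and> distr M N f = N"

definition measure_preserving_bij :: "'a measure \<Rightarrow> 'b measure \<Rightarrow> ('a \<Rightarrow> 'b) \<Rightarrow> bool" where
  "measure_preserving_bij M N f \<longleftrightarrow>
     measure_preserving M N f \<and> bij_betw f (space M) (space N)"

definition pullback :: "('b \<Rightarrow> 'b \<Rightarrow> real) \<Rightarrow> ('a \<Rightarrow> 'b) \<Rightarrow> 'a \<Rightarrow> 'a \<Rightarrow> real" where
  "pullback W f = (\<lambda>x y. W (f x) (f y))"

definition graphon_iso ::
    "'a measure \<Rightarrow> ('a \<Rightarrow> 'a \<Rightarrow> real) \<Rightarrow> 'b measure \<Rightarrow> ('b \<Rightarrow> 'b \<Rightarrow> real) \<Rightarrow> bool" where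
  "graphon_iso M W N U \<longleftrightarrow>
     (\<exists>f. measure_preserving_bij N M f \<and>
          (AE (x, y) in N \<Otimes>\<^sub>M N. pullback W f x y = U x y))"

section \<open>Fractional isomorphism\<close>

definition relatively_complete :: "'a measure \<Rightarrow> 'a set set \<Rightarrow> bool" where
  "relatively_complete M C \<longleftrightarrow>
     sigma_algebra (space M) C \<and> C \<subseteq> sets M \<and>
     (\<forall>S\<in>sets M - C. \<forall>T\<in>C. measure M (sym_diff S T) > 0)"

definition graphon_op :: "'a measure \<Rightarrow> ('a \<Rightarrow> 'a \<Rightarrow> real) \<Rightarrow> ('a \<Rightarrow> real) \<Rightarrow> 'a \<Rightarrow> real" where
  "graphon_op M W f = (\<lambda>x. \<integral>y. W x y * f y \<partial>M)"

text \<open>Invariance is phrased with functions rather than classes in \<open>L\<^sup>2\<close>: a relatively complete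
  \<open>C\<close> contains all measurable null sets, so every measurable representative of a class
  having one \<open>C\<close>-measurable representative is itself \<open>C\<close>-measurable.\<close>

definition invariant_algebra :: "'a measure \<Rightarrow> ('a \<Rightarrow> 'a \<Rightarrow> real) \<Rightarrow> 'a set set \<Rightarrow> bool" where
  "invariant_algebra M W C \<longleftrightarrow>
     relatively_complete M C \<and>
     (\<forall>f\<in>borel_measurable (sigma (space M) C). integrable M (\<lambda>x. (f x)\<^sup>2) \<longrightarrow>
        graphon_op M W f \<in> borel_measurable (sigma (space M) C))"

definition min_invariant_algebra :: "'a measure \<Rightarrow> ('a \<Rightarrow> 'a \<Rightarrow> real) \<Rightarrow> 'a set set" where
  "min_invariant_algebra M W = (LEAST C. invariant_algebra M W C)"

lemma invariant_algebra_sets: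
  assumes "graphon M W"
  shows "invariant_algebra M W (sets M)"
proof -
  interpret prob_space M
    using assms by (simp add: graphon_def standard_prob_space_def)
  have meas [measurable]: "case_prod W \<in> borel_measurable (M \<Otimes>\<^sub>M M)"
    using assms by (simp add: graphon_def)
  have eq: "sets (sigma (space M) (sets M)) = sets M"
    by (simp add: sets.sigma_sets_eq sets.space_closed)
  have "graphon_op M W f \<in> borel_measurable M" if [measurable]: "f \<in> borel_measurable M" for f
    unfolding graphon_op_def by measurable
  moreover have "relatively_complete M (sets M)"
    by (simp add: relatively_complete_def sets.sigma_algebra_axioms)
  ultimately show ?thesis
    unfolding invariant_algebra_def
    using measurable_cong_sets[OF eq refl, where N = "borel :: real measure"] by auto
qed

lemma invariant_algebra_Inter:
  assumes "\<C> \<noteq> {}" and inv: "\<And>C. C \<in> \<C> \<Longrightarrow> invariant_algebra M W C"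
  shows "invariant_algebra M W (\<Inter>\<C>)"
proof -
  have sa: "sigma_algebra (space M) C" and sub: "C \<subseteq> sets M"
    and rc: "\<forall>S\<in>sets M - C. \<forall>T\<in>C. measure M (sym_diff S T) > 0" if "C \<in> \<C>" for C
    using inv[OF that] unfolding invariant_algebra_def relatively_complete_def by auto
  have sI: "sigma_algebra (space M) (\<Inter>\<C>)"
    unfolding sigma_algebra_iff2
  proof (intro conjI ballI allI impI)
    show "\<Inter>\<C> \<subseteq> Pow (space M)"
      using assms(1) sub sets.space_closed by blast
    show "{} \<in> \<Inter>\<C>"
      using sa by (auto simp: sigma_algebra_iff2)
    show "space M - s \<in> \<Inter>\<C>" if "s \<in> \<Inter>\<C>" for s
      using that sa by (auto simp: sigma_algebra_iff2)
    show "(\<Union>i::nat. A i) \<in> \<Inter>\<C>" if "range A \<subseteq> \<Inter>\<C>" for A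
    proof (rule InterI)
      fix C assume C: "C \<in> \<C>"
      then have "range A \<subseteq> C"
        using that by blast
      with sa[OF C] show "(\<Union>i. A i) \<in> C"
        unfolding sigma_algebra_iff2 by blast
    qed
  qed
  have subI: "\<Inter>\<C> \<subseteq> sets M"
    using assms(1) sub by blast
  have pos: "measure M (sym_diff S T) > 0" if "S \<in> sets M - \<Inter>\<C>" "T \<in> \<Inter>\<C>" for S T
  proof -
    obtain C where "C \<in> \<C>" "S \<in> sets M - C" "T \<in> C"
      using \<open>S \<in> sets M - \<Inter>\<C>\<close> \<open>T \<in> \<Inter>\<C>\<close> by blast
    then show ?thesis
      using rc by blast
  qed
  have meas_iff: "f \<in> borel_measurable (sigma (space M) C) \<longleftrightarrow>
      (\<forall>B\<in>sets borel. f -` B \<inter> space M \<in> C)"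
    if "sigma_algebra (space M) C" for f :: "'a \<Rightarrow> real" and C
    using that by (simp add: measurable_def sigma_algebra.sets_measure_of_eq space_measure_of_conv)
  have "graphon_op M W f \<in> borel_measurable (sigma (space M) (\<Inter>\<C>))"
    if f: "f \<in> borel_measurable (sigma (space M) (\<Inter>\<C>))"
      and int: "integrable M (\<lambda>x. (f x)\<^sup>2)" for f
  proof -
    have "graphon_op M W f \<in> borel_measurable (sigma (space M) C)" if C: "C \<in> \<C>" for C
    proof -
      have "f \<in> borel_measurable (sigma (space M) C)"
        using f C meas_iff[OF sI] meas_iff[OF sa[OF C]] by blast
      then show ?thesis
        using inv[OF C] int unfolding invariant_algebra_def by blast
    qed
    then show ?thesis
      using meas_iff[OF sI] meas_iff[OF sa] by blast
  qed
  then show ?thesis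
    unfolding invariant_algebra_def relatively_complete_def using sI subI pos by blast
qed

lemma min_invariant_algebra:
  assumes "graphon M W"
  shows "invariant_algebra M W (min_invariant_algebra M W)"
    and "invariant_algebra M W C \<Longrightarrow> min_invariant_algebra M W \<subseteq> C"
proof -
  have *: "invariant_algebra M W (\<Inter>(Collect (invariant_algebra M W)))"
    using invariant_algebra_sets[OF assms] by (intro invariant_algebra_Inter) auto
  have eq: "min_invariant_algebra M W = \<Inter>(Collect (invariant_algebra M W))"
    unfolding min_invariant_algebra_def by (rule Least_equality) (use * in auto)
  show "invariant_algebra M W (min_invariant_algebra M W)"
    unfolding eq by (rule *)
  show "invariant_algebra M W C \<Longrightarrow> min_invariant_algebra M W \<subseteq> C"
    unfolding eq by auto
qed

text \<open>\<open>(N, q)\<close> realises the quotient of \<open>M\<close> by \<open>C\<close>, which is determined only up to null sets. That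
  exactly the \<open>C\<close>-measurable functions factor through \<open>q\<close> is meant modulo \<open>M\<close>, since a relatively
  complete \<open>C\<close> contains every measurable null set.\<close>

definition quotient_space ::
    "'a measure \<Rightarrow> 'a set set \<Rightarrow> 'b measure \<Rightarrow> ('a \<Rightarrow> 'b) \<Rightarrow> bool" where
  "quotient_space M C N q \<longleftrightarrow>
     standard_prob_space N \<and> measure_preserving M N q \<and> q ` space M = space N \<and>
     (\<forall>f::'a \<Rightarrow> real. f \<in> borel_measurable M \<longrightarrow>
        (f \<in> borel_measurable (sigma (space M) C) \<longleftrightarrow>
         (\<exists>g\<in>borel_measurable N. AE x in M. f x = g (q x))))"

definition quotient_graphon ::
    "'a measure \<Rightarrow> ('a \<Rightarrow> 'a \<Rightarrow> real) \<Rightarrow> 'a set set \<Rightarrow>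
     'b measure \<Rightarrow> ('a \<Rightarrow> 'b) \<Rightarrow> ('b \<Rightarrow> 'b \<Rightarrow> real) \<Rightarrow> bool" where
  "quotient_graphon M W C N q V \<longleftrightarrow>
     quotient_space M C N q \<and> graphon N V \<and>
     (AE (x, y) in M \<Otimes>\<^sub>M M. V (q x) (q y) =
        real_cond_exp (M \<Otimes>\<^sub>M M) (sigma (space M) C \<Otimes>\<^sub>M sigma (space M) C) (case_prod W) (x, y))"

text \<open>Every standard Borel space is Borel isomorphic to a Borel subset of the real line, so it is no
  loss to realise the quotients on the type of reals. Quantifying existentially over
  the realisations absorbs their ambiguity on null sets: a measure-preserving bijection of two
  quotients that is only defined outside null sets becomes an honest one after each null set has
  been collapsed to a point.\<close>

definition fractionally_isomorphic ::
    "'a measure \<Rightarrow> ('a \<Rightarrow> 'a \<Rightarrow> real) \<Rightarrow> 'b measure \<Rightarrow> ('b \<Rightarrow> 'b \<Rightarrow> real) \<Rightarrow> bool" where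
  "fractionally_isomorphic M W N U \<longleftrightarrow>
     (\<exists>(M' :: real measure) p W' (N' :: real measure) q U'.
        quotient_graphon M W (min_invariant_algebra M W) M' p W' \<and>
        quotient_graphon N U (min_invariant_algebra N U) N' q U' \<and>
        graphon_iso M' W' N' U')"

section \<open>Cut distance\<close>

definition cut_norm :: "'a measure \<Rightarrow> ('a \<Rightarrow> 'a \<Rightarrow> real) \<Rightarrow> real" where
  "cut_norm M W =
     (SUP (S, T)\<in>sets M \<times> sets M. \<bar>\<integral>z\<in>S \<times> T. case_prod W z \<partial>(M \<Otimes>\<^sub>M M)\<bar>)"

text \<open>The value is an extended real, so that the infimum is \<open>\<infinity>\<close> if there is no measure-preserving
  bijection.\<close>

definition cut_dist ::
    "'a measure \<Rightarrow> ('a \<Rightarrow> 'a \<Rightarrow> real) \<Rightarrow> 'b measure \<Rightarrow> ('b \<Rightarrow> 'b \<Rightarrow> real) \<Rightarrow> ereal" where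
  "cut_dist M U N W =
     (INF f\<in>{f. measure_preserving_bij N M f}.
        ereal (cut_norm N (\<lambda>x y. pullback U f x y - W x y)))"

definition unit_interval :: "real measure" where
  "unit_interval = restrict_space lborel {0..<1}"

section \<open>Regular graphs and their graphon representations\<close>

definition simple_graph :: "'v set \<Rightarrow> 'v set set \<Rightarrow> bool" where
  "simple_graph V E \<longleftrightarrow> finite V \<and> (\<forall>e\<in>E. e \<subseteq> V \<and> card e = 2)"

definition regular_graph :: "nat \<Rightarrow> 'v set \<Rightarrow> 'v set set \<Rightarrow> bool" where
  "regular_graph D V E \<longleftrightarrow> simple_graph V E \<and> (\<forall>v\<in>V. card {e\<in>E. v \<in> e} = D)"

definition block :: "nat \<Rightarrow> nat \<Rightarrow> real set" where
  "block n v = {(real v - 1) / real n ..< real v / real n}"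

text \<open>Representation on \<open>unit_interval\<close> of the graph with vertex set \<open>{1..n}\<close> and edge set \<open>E\<close>.\<close>

definition graph_graphon :: "nat \<Rightarrow> nat set set \<Rightarrow> real \<Rightarrow> real \<Rightarrow> real" where
  "graph_graphon n E = (\<lambda>x y.
     if \<exists>u\<in>{1..n}. \<exists>v\<in>{1..n}. {u, v} \<in> E \<and> x \<in> block n u \<and> y \<in> block n v then 1 else 0)"

text \<open>No measure-preserving bijection exists between a space with atoms and \<open>unit_interval\<close>. As usual,
  a graphon \<open>W\<close> on a space \<open>M\<close> with atoms is therefore first replaced by the atomless graphon
  \<open>((x, s), (y, t)) \<mapsto> W x y\<close> on \<open>M \<times> [0,1)\<close>, its pullback along the projection to \<open>M\<close>.\<close>

definition graph_cut_dist ::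
    "'a measure \<Rightarrow> ('a \<Rightarrow> 'a \<Rightarrow> real) \<Rightarrow> nat \<Rightarrow> nat set set \<Rightarrow> ereal" where
  "graph_cut_dist M W n E =
     (if atomless M
      then cut_dist M W unit_interval (graph_graphon n E)
      else cut_dist (M \<Otimes>\<^sub>M unit_interval) (pullback W fst) unit_interval (graph_graphon n E))"

end

theory Submission
  imports Defs
begin

text \<open>A graphon fractionally isomorphic to \<open>C\<^sub>d\<close> has almost all degrees equal to \<open>d\<close>, because its
  conditional expectation on \<open>\<C>(W) \<times> \<C>(W)\<close> is \<open>d\<close> and its degree function is \<open>\<C>(W)\<close>-measurable. By the
  weak regularity lemma it is close in cut norm to a step function whose number of steps depends on
  \<open>\<epsilon>\<close> only, and a parametrization of the underlying space by \<open>[0,1)\<close> turns the steps into intervals.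
  Cutting \<open>[0,1)\<close> into \<open>n\<close> blocks gives a symmetric matrix with almost constant row sums in the
  \<open>l\<^sub>1\<close> sense. Rounding its entries to 0 and 1 keeps all cuts, and a few edge switches make the
  resulting graph regular; switching needs a degree below \<open>n/2\<close>, which is arranged by passing to the
  complement and by mixing the matrix with a small constant.\<close>

section \<open>Regular graphs by rounding and switching\<close>

text \<open>One degree has to serve all graphons of the family, and the threshold for n may depend
  on d and \<epsilon> only. The degree is therefore fixed from n, d and \<eta> before any matrix is
  seen, and in the sparse case it is even, so that n D is even for every n. The degree errors are
  small only in l_1, and single vertices may be far off; this is why switching is governed by the
  total defect, which has to stay below D (n - 2 D). The steps are turned into intervals because all
  but k of n equal blocks then lie inside one step, so that the matrix can be read off the averages
  on the steps. \<open>cut_dist\<close> ranges over maps that are bijective everywhere, not almost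
  everywhere, so a parametrization by quantiles has to be repaired on null sets; a Borel
  Schroeder-Bernstein argument does this. Spaces are handled through a Borel map to the line with a
  Borel left inverse, so that images of sets can be written as preimages.\<close>

definition vertex_degree :: "('v \<times> 'v) set \<Rightarrow> 'v \<Rightarrow> nat" where
  "vertex_degree R v = card (R `` {v})"

definition ins_edge where "ins_edge a b R = insert (a, b) (insert (b, a) R)"
definition del_edge where "del_edge a b R = R - {(a, b), (b, a)}"

lemma degree_ins_edge:
  assumes "finite R" "(a, b) \<notin> R" "sym R" "a \<noteq> b"
  shows "vertex_degree (ins_edge a b R) x = vertex_degree R x + of_bool (x = a) + of_bool (x = b)"
proof -
  have fin: "finite (R `` {y})" for y using assms(1) by (rule finite_Image)
  have nb: "(b, a) \<notin> R" using assms(2,3) by (meson symD)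
  consider "x = a" | "x = b" | "x \<noteq> a" "x \<noteq> b" by blast
  then show ?thesis
  proof cases
    case 1
    have "ins_edge a b R `` {x} = insert b (R `` {a})" using 1 assms(4) by (auto simp: ins_edge_def)
    then show ?thesis using 1 assms fin by (simp add: vertex_degree_def)
  next
    case 2
    have "ins_edge a b R `` {x} = insert a (R `` {b})" using 2 assms(4) by (auto simp: ins_edge_def)
    then show ?thesis using 2 assms fin nb by (simp add: vertex_degree_def)
  next
    case 3
    have "ins_edge a b R `` {x} = R `` {x}" using 3 by (auto simp: ins_edge_def)
    then show ?thesis using 3 by (simp add: vertex_degree_def)
  qed
qed

lemma sym_ins_edge: "sym R \<Longrightarrow> sym (ins_edge a b R)"
  by (auto simp: sym_def ins_edge_def)

lemma sym_del_edge: "sym R \<Longrightarrow> sym (del_edge a b R)"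
  by (auto simp: sym_def del_edge_def)

lemma degree_del_edge:
  assumes "finite R" "(a, b) \<in> R" "sym R" "a \<noteq> b"
  shows "vertex_degree R x = vertex_degree (del_edge a b R) x + of_bool (x = a) + of_bool (x = b)"
proof -
  have "ins_edge a b (del_edge a b R) = R"
    using assms(2,3) by (auto simp: ins_edge_def del_edge_def dest: symD)
  moreover have "vertex_degree (ins_edge a b (del_edge a b R)) x =
      vertex_degree (del_edge a b R) x + of_bool (x = a) + of_bool (x = b)"
    by (intro degree_ins_edge sym_del_edge assms) (use assms in \<open>auto simp: del_edge_def\<close>)
  ultimately show ?thesis by simp
qed

lemma sum_degree:
  assumes "finite V" "R \<subseteq> V \<times> V"
  shows "(\<Sum>v\<in>V. vertex_degree R v) = card R"
proof -
  have "R = (SIGMA v:V. R `` {v})" using assms(2) by auto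
  moreover have "card (SIGMA v:V. R `` {v}) = (\<Sum>v\<in>V. vertex_degree R v)"
    unfolding vertex_degree_def using assms finite_subset[of "R `` {_}" V]
    by (intro card_SigmaI) auto
  ultimately show ?thesis by simp
qed

lemma even_card_sym:
  assumes "finite R" "sym R" "irrefl R"
  shows "even (card R)"
  using assms
proof (induction "card R" arbitrary: R rule: less_induct)
  case less
  show ?case
  proof (cases "R = {}")
    case False
    then obtain a b where ab: "(a, b) \<in> R" by auto
    then have ne: "a \<noteq> b" using less.prems by (auto simp: irrefl_def)
    have ba: "(b, a) \<in> R" using ab less.prems by (meson symD)
    have "card (del_edge a b R) = card R - 2"
      unfolding del_edge_def using ab ba ne less.prems by (subst card_Diff_subset) auto
    moreover have "card {(a,b),(b,a)} \<le> card R"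
      using ab ba less.prems by (intro card_mono) auto
    then have "card R \<ge> 2" using ne by simp
    moreover have "even (card (del_edge a b R))" 
      using less.prems calculation
      by (intro less.hyps sym_del_edge) (auto simp: del_edge_def irrefl_def)
    ultimately show ?thesis by simp
  qed auto
qed

text \<open>The factor 2 makes the deletion of an edge at a vertex of excessive degree decrease the
  potential even if the vertex_degree of its other end is already too small.\<close>

definition defect :: "'v set \<Rightarrow> nat \<Rightarrow> ('v \<times> 'v) set \<Rightarrow> nat" where
  "defect V D R = (\<Sum>v\<in>V. 2 * (vertex_degree R v - D) + (D - vertex_degree R v))"

lemma card_incident_le:
  assumes "finite X" "finite R" "\<And>x. x \<in> X \<Longrightarrow> vertex_degree R x \<le> D"
  shows "card {e \<in> R. fst e \<in> X} \<le> card X * D"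
proof -
  have "{e \<in> R. fst e \<in> X} = (SIGMA x:X. R `` {x})" by auto
  moreover have "card (SIGMA x:X. R `` {x}) = (\<Sum>x\<in>X. vertex_degree R x)"
    unfolding vertex_degree_def using assms by (intro card_SigmaI) (auto intro: finite_Image)
  moreover have "\<dots> \<le> card X * D" using sum_bounded_above[of X "vertex_degree R" D] assms by simp
  ultimately show ?thesis by simp
qed

lemma card_sym_diff_trans:
  assumes "finite A" "finite B" "finite C"
  shows "card (sym_diff A C) \<le> card (sym_diff A B) + card (sym_diff B C)"
proof -
  have "card (sym_diff A C) \<le> card (sym_diff A B \<union> sym_diff B C)"
    using assms by (intro card_mono) auto
  also have "\<dots> \<le> card (sym_diff A B) + card (sym_diff B C)" by (rule card_Un_le)
  finally show ?thesis .
qed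

text \<open>An ordered pair of \<open>R\<close> is unusable if its first entry lies in the closed
  neighbourhood of \<open>u\<close> or its second entry in that of \<open>v\<close>. Both
  neighbourhoods have at most D vertices because \<open>u\<close> and \<open>v\<close> have degree
  below D, and every vertex has degree at most D, so at most 2 D^2 pairs are unusable. The case u =
  v is included.\<close>

lemma exists_switch:
  assumes "finite V" "R \<subseteq> V \<times> V" "sym R"
    and le: "\<And>v. v \<in> V \<Longrightarrow> vertex_degree R v \<le> D"
    and uv: "u \<in> V" "v \<in> V" "vertex_degree R u < D" "vertex_degree R v < D"
    and big: "2 * D * D < card R"
  shows "\<exists>x y. (x, y) \<in> R \<and> x \<notin> insert u (R `` {u}) \<and> y \<notin> insert v (R `` {v})"
proof (rule ccontr)
  assume no: "\<not> ?thesis"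
  have finR: "finite R" using assms(1,2) finite_subset by blast
  have cl: "card (insert w (R `` {w})) \<le> D" if "vertex_degree R w < D" for w
    using that card_insert_le_m1[of D "R `` {w}" w] unfolding vertex_degree_def by simp
  let ?A = "{e \<in> R. fst e \<in> insert u (R `` {u})}"
  let ?B = "{e \<in> R. fst e \<in> insert v (R `` {v})}"
  have "R \<subseteq> ?A \<union> prod.swap ` ?B"
  proof
    fix e assume e: "e \<in> R"
    obtain x y where xy: "e = (x, y)" by force
    have "(y, x) \<in> R" using e xy assms(3) by (auto dest: symD)
    then show "e \<in> ?A \<union> prod.swap ` ?B" using no e xy by (force simp: image_iff)
  qed
  then have "card R \<le> card (?A \<union> prod.swap ` ?B)"
    using finR by (intro card_mono) auto
  also have "\<dots> \<le> card ?A + card (prod.swap ` ?B)" by (rule card_Un_le)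
  also have "\<dots> \<le> card ?A + card ?B" using finR by (intro add_left_mono card_image_le) auto
  also have "card ?A \<le> card (insert u (R `` {u})) * D"
    using finR assms(2) uv le by (intro card_incident_le) (auto intro: finite_Image)
  also have "\<dots> \<le> D * D" using cl[OF uv(3)] by (rule mult_right_mono) simp
  also have "card ?B \<le> card (insert v (R `` {v})) * D"
    using finR assms(2) uv le by (intro card_incident_le) (auto intro: finite_Image)
  also have "\<dots> \<le> D * D" using cl[OF uv(4)] by (rule mult_right_mono) simp
  finally show False using big by simp
qed

text \<open>Every move lowers the defect and changes at most six ordered pairs, whence the factor 6.
  Once no degree exceeds D, \<open>card R\<close> plus the defect is |V| D, so the strict inequality
  says that \<open>card R\<close> exceeds 2 D^2, as \<open>exists_switch\<close> demands; it is
  inherited by relations of smaller defect.\<close>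

lemma regularize:
  assumes V: "finite V" and ev: "even (card V * D)"
  assumes "R \<subseteq> V \<times> V" "sym R" "irrefl R" "defect V D R + 2 * D * D < card V * D"
  shows "\<exists>H. H \<subseteq> V \<times> V \<and> sym H \<and> irrefl H \<and> (\<forall>v\<in>V. vertex_degree H v = D) \<and>
           card (sym_diff R H) \<le> 6 * defect V D R"
  using assms(3-6)
proof (induction "defect V D R" arbitrary: R rule: less_induct)
  case less
  note R = less.prems
  have finR: "finite R" using R(1) V finite_subset by blast
  have step: ?case
    if R': "R' \<subseteq> V \<times> V" "sym R'" "irrefl R'" "defect V D R' < defect V D R"
      "card (sym_diff R R') \<le> 6" for R'
  proof -
    obtain H where H: "H \<subseteq> V \<times> V" "sym H" "irrefl H" "\<forall>v\<in>V. vertex_degree H v = D"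
      "card (sym_diff R' H) \<le> 6 * defect V D R'"
      using less.hyps[OF R'(4) R'(1-3)] R'(4) R(4) by auto
    have "finite H" "finite R'" using H(1) R'(1) V finite_subset by blast+
    then have "card (sym_diff R H) \<le> card (sym_diff R R') + card (sym_diff R' H)"
      using finR by (intro card_sym_diff_trans)
    also have "\<dots> \<le> 6 * defect V D R" using R'(4,5) H(5) by linarith
    finally show ?thesis using H by blast
  qed
  show ?case
  proof (cases "\<exists>v\<in>V. vertex_degree R v > D")
    case True
    then obtain v where v: "v \<in> V" "vertex_degree R v > D" by blast
    then have "R `` {v} \<noteq> {}" by (auto simp: vertex_degree_def)
    then obtain w where w: "(v, w) \<in> R" by blast
    then have vw: "v \<noteq> w" "w \<in> V" using R by (auto simp: irrefl_def)
    let ?R = "del_edge v w R"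
    have dg: "vertex_degree R x = vertex_degree ?R x + of_bool (x = v) + of_bool (x = w)" for x
      by (rule degree_del_edge) (use finR w R vw in auto)
    have "defect V D ?R + (\<Sum>x\<in>V. 2 * of_bool (x = v)) \<le> defect V D R + (\<Sum>x\<in>V. of_bool (x = w))"
      unfolding defect_def sum.distrib[symmetric]
      using v vw by (intro sum_mono) (auto simp: dg of_bool_def)
    moreover have "(\<Sum>x\<in>V. 2 * of_bool (x = v)) = (2::nat)" "(\<Sum>x\<in>V. of_bool (x = w)) = (1::nat)"
      using v vw V by (simp_all add: of_bool_def sum.delta if_distrib[of "\<lambda>t. 2 * t"] cong: if_cong)
    ultimately have "defect V D ?R < defect V D R" by simp
    moreover have "sym_diff R ?R \<subseteq> {(v, w), (w, v)}" by (auto simp: del_edge_def)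
    then have "card (sym_diff R ?R) \<le> card {(v, w), (w, v)}" by (intro card_mono) auto
    then have "card (sym_diff R ?R) \<le> 6" by (auto simp: card_insert_if split: if_splits)
    ultimately show ?thesis
      using R by (intro step[of ?R] sym_del_edge) (auto simp: del_edge_def irrefl_def)
  next
    case False
    then have le: "\<And>x. x \<in> V \<Longrightarrow> vertex_degree R x \<le> D" by force
    show ?thesis
    proof (cases "\<forall>v\<in>V. vertex_degree R v = D")
      case True
      then show ?thesis using R by (intro exI[of _ R]) auto
    next
      case False
      then obtain u where u: "u \<in> V" "vertex_degree R u < D" using le by force
      have def_eq: "defect V D R = (\<Sum>v\<in>V. D - vertex_degree R v)"
        unfolding defect_def using le by (intro sum.cong) auto
      have "(\<Sum>v\<in>V. D - vertex_degree R v) + (\<Sum>v\<in>V. vertex_degree R v) = (\<Sum>v\<in>V. D)"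
        unfolding sum.distrib[symmetric] using le by (intro sum.cong) auto
      then have tot: "defect V D R + card R = card V * D"
        using sum_degree[OF V R(1)] def_eq by simp
      \<comment> \<open>Both |V| D and \<open>card R\<close> are even, hence so is the defect: a
        vertex that lacks just one edge cannot be the only deficient one.\<close>
      have evd: "even (defect V D R)"
        using even_card_sym[OF finR R(2,3)] ev tot by (metis even_add)
      \<comment> \<open>\<open>v\<close> may coincide with \<open>u\<close>, which must then lack
        two edges, since it will gain two.\<close>
      obtain v where v: "v \<in> V" "vertex_degree R v < D" "v = u \<longrightarrow> vertex_degree R u + 2 \<le> D"
      proof (cases "vertex_degree R u + 2 \<le> D")
        case True
        then show ?thesis using that u by blast
      next
        case False
        then have 1: "D - vertex_degree R u = 1" using u by simp
        have "defect V D R = 1 + (\<Sum>v\<in>V - {u}. D - vertex_degree R v)"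
          unfolding def_eq using V u 1 by (simp add: sum.remove)
        then have "(\<Sum>v\<in>V - {u}. D - vertex_degree R v) \<noteq> 0" using evd by (intro notI) simp
        then obtain w where "w \<in> V - {u}" "D - vertex_degree R w \<noteq> 0"
          by (meson sum.not_neutral_contains_not_neutral)
        then show ?thesis using that by auto
      qed
      have "2 * D * D < card R" using R(4) tot by simp
      then obtain x y where xy: "(x, y) \<in> R" "x \<notin> insert u (R `` {u})" "y \<notin> insert v (R `` {v})"
        using exists_switch[OF V R(1,2) le u(1) v(1) u(2) v(2)] by blast
      have yx: "(y, x) \<in> R" using xy R(2) by (meson symD)
      have ne: "x \<noteq> y" "x \<noteq> u" "x \<noteq> v" "y \<noteq> v" "y \<noteq> u" "x \<in> V" "y \<in> V"
        using xy yx R by (auto simp: irrefl_def)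
      have nu: "(u, x) \<notin> R" "(v, y) \<notin> R" "(x, u) \<notin> R" "(y, v) \<notin> R"
        using xy R(2) by (auto dest: symD)
      \<comment> \<open>The edge xy is replaced by ux and vy: x and y keep their degrees, while u
        and v gain one each, or two together if they coincide.\<close>
      let ?R1 = "del_edge x y R"
      let ?R2 = "ins_edge u x ?R1"
      let ?R3 = "ins_edge v y ?R2"
      have s: "sym ?R1" "sym ?R2" "sym ?R3" using R(2) by (intro sym_ins_edge sym_del_edge; simp)+
      have "finite ?R1" "finite ?R2" using finR by (auto simp: del_edge_def ins_edge_def)
      have d1: "vertex_degree R z = vertex_degree ?R1 z + of_bool (z = x) + of_bool (z = y)" for z
        by (rule degree_del_edge) (use finR xy R ne in auto)
      have d2: "vertex_degree ?R2 z = vertex_degree ?R1 z + of_bool (z = u) + of_bool (z = x)" for z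
        by (rule degree_ins_edge) (use \<open>finite ?R1\<close> s ne nu in \<open>auto simp: del_edge_def\<close>)
      have d3: "vertex_degree ?R3 z = vertex_degree ?R2 z + of_bool (z = v) + of_bool (z = y)" for z
        by (rule degree_ins_edge) (use \<open>finite ?R2\<close> s ne nu in \<open>auto simp: del_edge_def ins_edge_def\<close>)
      have dg: "vertex_degree ?R3 z = vertex_degree R z + of_bool (z = u) + of_bool (z = v)" for z
        using d1[of z] d2[of z] d3[of z] by linarith
      have "(\<Sum>z\<in>V. 2 * (vertex_degree ?R3 z - D) + (D - vertex_degree ?R3 z)) + (\<Sum>z\<in>V. of_bool (z = u) + of_bool (z = v))
              = (\<Sum>z\<in>V. D - vertex_degree R z)"
        unfolding sum.distrib[symmetric] dg
        by (intro sum.cong refl) (use le u v in \<open>auto simp: of_bool_def\<close>)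
      moreover have "(\<Sum>z\<in>V. of_bool (z = u) + of_bool (z = v)) = (2::nat)"
        using u v V by (simp add: sum.distrib of_bool_def sum.delta)
      ultimately have "defect V D ?R3 < defect V D R" using def_eq by (simp add: defect_def)
      moreover have "sym_diff R ?R3 \<subseteq> {(x,y),(y,x),(u,x),(x,u),(v,y),(y,v)}"
        by (auto simp: del_edge_def ins_edge_def)
      then have "card (sym_diff R ?R3) \<le> card {(x,y),(y,x),(u,x),(x,u),(v,y),(y,v)}"
        by (intro card_mono) auto
      then have "card (sym_diff R ?R3) \<le> 6"
        using card_length[of "[(x,y),(y,x),(u,x),(x,u),(v,y),(y,v)]"] by simp
      ultimately show ?thesis
        using R s(3) ne u v by (intro step[of ?R3]) (auto simp: del_edge_def ins_edge_def irrefl_def)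
    qed
  qed
qed

section \<open>Derandomized rounding of a symmetric matrix\<close>

lemma exp_le_quadratic:
  fixes y :: real
  assumes "\<bar>y\<bar> \<le> 1"
  shows "exp y \<le> 1 + y + y\<^sup>2"
proof (cases "0 \<le> y")
  case True
  then show ?thesis using assms exp_bound[of y] by simp
next
  case False
  define z where "z = - y"
  have z: "0 \<le> z" using False by (simp add: z_def)
  \<comment> \<open>For negative arguments the claim reads exp (-z) \<le> 1 - z + z^2. The product
    of the right side with the Taylor polynomial 1 + z + z^2/2 \<le> exp z is 1 + (z^2 + z^3 +
    z^4)/2, which is at least 1.\<close>
  have "1 \<le> 1 + z\<^sup>2 / 2 + z ^ 3 / 2 + z ^ 4 / 2" using z by simp
  also have "\<dots> = (1 - z + z\<^sup>2) * (1 + z + z\<^sup>2 / 2)"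
    by (simp add: field_simps power2_eq_square power3_eq_cube power4_eq_xxxx)
  also have "\<dots> \<le> (1 - z + z\<^sup>2) * exp z"
    using z exp_lower_Taylor_quadratic[of z] assms
    by (intro mult_left_mono) (auto simp: z_def)
  finally have "exp (- z) \<le> 1 - z + z\<^sup>2"
    by (simp add: exp_minus field_simps)
  then show ?thesis by (simp add: z_def)
qed

text \<open>Choosing the values one at a time so as not to increase the exponential potential derandomises
  the Chernoff bound.\<close>

lemma rounding_potential:
  fixes c :: "'j \<Rightarrow> 'e \<Rightarrow> real" and p :: "'e \<Rightarrow> real" and l :: real
  assumes "finite E"
    and "\<And>j e. j \<in> J \<Longrightarrow> \<bar>c j e\<bar> \<le> 1" "\<And>e. e \<in> E \<Longrightarrow> 0 \<le> p e \<and> p e \<le> 1" "0 \<le> l" "l \<le> 1"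
  shows "\<exists>X. (\<Sum>j\<in>J. exp (l * (\<Sum>e\<in>E. c j e * (of_bool (e \<in> X) - p e))))
             \<le> card J * exp (l\<^sup>2 * card E)"
  using assms(1,3)
proof (induction E rule: finite_induct)
  case empty
  then show ?case by simp
next
  case (insert a E)
  then obtain X where X: "(\<Sum>j\<in>J. exp (l * (\<Sum>e\<in>E. c j e * (of_bool (e \<in> X) - p e))))
             \<le> card J * exp (l\<^sup>2 * card E)" by auto
  define P where "P j = exp (l * (\<Sum>e\<in>E. c j e * (of_bool (e \<in> X) - p e)))" for j
  have p: "0 \<le> p a" "p a \<le> 1" using insert by auto
  have quad: "exp (l * (c j a * t)) \<le> 1 + l * (c j a * t) + l\<^sup>2" if "\<bar>t\<bar> \<le> 1" "j \<in> J" for j t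
  proof -
    have ct: "\<bar>c j a * t\<bar> \<le> 1" using that assms(2)[of j a] by (simp add: abs_mult mult_le_one)
    then have 1: "\<bar>l * (c j a * t)\<bar> \<le> l * 1"
      using assms by (subst abs_mult) (intro mult_mono, auto)
    then have "(l * (c j a * t))\<^sup>2 \<le> l\<^sup>2"
      using assms(4) by (metis abs_le_square_iff abs_of_nonneg mult.right_neutral)
    moreover have "\<bar>l * (c j a * t)\<bar> \<le> 1" using 1 assms by simp
    ultimately show ?thesis using exp_le_quadratic by fastforce
  qed
  \<comment> \<open>\<open>Q t j\<close> is the contribution of \<open>j\<close> once the value
    \<open>t\<close> is chosen at \<open>a\<close>. In the average with weights p a and 1 - p a the
    linear terms cancel, so one of the two values respects the bound enlarged by the factor exp
    (l^2).\<close>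
  define Q where "Q t j = P j * exp (l * (c j a * (t - p a)))" for t j
  have avg: "p a * Q 1 j + (1 - p a) * Q 0 j \<le> P j * exp (l\<^sup>2)" if "j \<in> J" for j
  proof -
    have "p a * exp (l * (c j a * (1 - p a))) + (1 - p a) * exp (l * (c j a * (0 - p a)))
        \<le> p a * (1 + l * (c j a * (1 - p a)) + l\<^sup>2) + (1 - p a) * (1 + l * (c j a * (0 - p a)) + l\<^sup>2)"
      using p that by (intro add_mono mult_left_mono quad) auto
    also have "\<dots> = 1 + l\<^sup>2" by (simp add: algebra_simps)
    also have "\<dots> \<le> exp (l\<^sup>2)" by simp
    finally have "P j * (p a * exp (l * (c j a * (1 - p a))) + (1 - p a) * exp (l * (c j a * (0 - p a))))
       \<le> P j * exp (l\<^sup>2)" by (intro mult_left_mono) (auto simp: P_def)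
    then show ?thesis by (simp add: Q_def algebra_simps)
  qed
  have "p a * (\<Sum>j\<in>J. Q 1 j) + (1 - p a) * (\<Sum>j\<in>J. Q 0 j) = (\<Sum>j\<in>J. p a * Q 1 j + (1 - p a) * Q 0 j)"
    by (simp add: sum_distrib_left sum.distrib)
  also have "\<dots> \<le> (\<Sum>j\<in>J. P j * exp (l\<^sup>2))" by (intro sum_mono avg)
  also have "\<dots> = (\<Sum>j\<in>J. P j) * exp (l\<^sup>2)" by (simp add: sum_distrib_right)
  also have "\<dots> \<le> (card J * exp (l\<^sup>2 * card E)) * exp (l\<^sup>2)"
    using X by (intro mult_right_mono) (auto simp: P_def)
  also have "\<dots> = card J * exp (l\<^sup>2 * card (insert a E))"
    using insert by (simp add: exp_add[symmetric] algebra_simps)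
  finally have le: "p a * (\<Sum>j\<in>J. Q 1 j) + (1 - p a) * (\<Sum>j\<in>J. Q 0 j) \<le> card J * exp (l\<^sup>2 * card (insert a E))" .
  have "\<exists>b. (\<Sum>j\<in>J. Q (of_bool b) j) \<le> card J * exp (l\<^sup>2 * card (insert a E))"
  proof (rule ccontr)
    let ?K = "card J * exp (l\<^sup>2 * card (insert a E))"
    assume "\<not> ?thesis"
    then have gt: "(\<Sum>j\<in>J. Q (of_bool b) j) > ?K" for b by (meson not_le)
    have 1: "(\<Sum>j\<in>J. Q 1 j) > ?K" "(\<Sum>j\<in>J. Q 0 j) > ?K"
      using gt[of True] gt[of False] by simp_all
    have "p a * ?K + (1 - p a) * ?K < p a * (\<Sum>j\<in>J. Q 1 j) + (1 - p a) * (\<Sum>j\<in>J. Q 0 j)"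
    proof (cases "p a = 0")
      case True
      then show ?thesis using 1 by simp
    next
      case False
      then show ?thesis using p 1 by (intro add_less_le_mono mult_strict_left_mono mult_left_mono) auto
    qed
    then show False using le by (simp add: algebra_simps)
  qed
  then obtain b where b: "(\<Sum>j\<in>J. Q (of_bool b) j) \<le> card J * exp (l\<^sup>2 * card (insert a E))" by blast
  \<comment> \<open>\<open>X\<close> is unconstrained outside \<open>E\<close>, so \<open>a\<close>
    has to be removed when the value 0 is chosen.\<close>
  define Y where "Y = (if b then insert a X else X - {a})"
  have "exp (l * (\<Sum>e\<in>insert a E. c j e * (of_bool (e \<in> Y) - p e))) = Q (of_bool b) j" for j
  proof -
    have "(\<Sum>e\<in>E. c j e * (of_bool (e \<in> Y) - p e)) = (\<Sum>e\<in>E. c j e * (of_bool (e \<in> X) - p e))"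
      using insert by (intro sum.cong) (auto simp: Y_def)
    then show ?thesis
      using insert by (simp add: Q_def P_def Y_def exp_add[symmetric] algebra_simps)
  qed
  then show ?case using b by (intro exI[of _ Y]) simp
qed

text \<open>The tests of the potential are the 2^(2n+1) \<le> exp (3 n) triples of S, T and a sign.
  The potential bounds half of the off-diagonal deviation by 3 n/l + l n^2; the diagonal, which
  \<open>R\<close> avoids, costs another n.\<close>

lemma graph_rounding:
  fixes B :: "nat \<Rightarrow> nat \<Rightarrow> real" and V :: "nat set"
  assumes V: "finite V" and \<delta>: "0 < \<delta>" "\<delta> \<le> 1" and n: "50 / \<delta>\<^sup>2 \<le> real (card V)"
    and B: "\<And>u v. u \<in> V \<Longrightarrow> v \<in> V \<Longrightarrow> B u v = B v u \<and> 0 \<le> B u v \<and> B u v \<le> 1"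
  shows "\<exists>R. R \<subseteq> V \<times> V \<and> sym R \<and> irrefl R \<and>
    (\<forall>S T. S \<subseteq> V \<longrightarrow> T \<subseteq> V \<longrightarrow>
      \<bar>\<Sum>u\<in>S. \<Sum>v\<in>T. of_bool ((u, v) \<in> R) - B u v\<bar> \<le> \<delta> * (real (card V))\<^sup>2)"
proof -
  define n where "n = real (card V)"
  have "50 \<le> 50 / \<delta>\<^sup>2" using \<delta> by (simp add: field_simps power_le_one)
  then have n50: "50 \<le> n" using n by (simp add: n_def)
  define E where "E = {(u, v). u \<in> V \<and> v \<in> V \<and> u < v}"
  have EV: "E \<subseteq> V \<times> V" by (auto simp: E_def)
  have finE: "finite E" by (rule finite_subset[OF EV]) (use V in simp)
  have cardE: "real (card E) \<le> n\<^sup>2"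
    using card_mono[OF _ EV] V by (simp add: card_cartesian_product n_def power2_eq_square flip: of_nat_mult)
  define J where "J = Pow V \<times> Pow V \<times> {-1, 1::real}"
  \<comment> \<open>An unordered pair accounts for up to two entries of S \<times> T; halving keeps
    the weights within [-1, 1].\<close>
  define c where "c = (\<lambda>(S, T, s::real) (u::nat, v::nat). s * (of_bool (u \<in> S \<and> v \<in> T) + of_bool (v \<in> S \<and> u \<in> T)) / 2)"
  \<comment> \<open>With l = \<delta>/4 the term l n^2, counted twice, takes half of \<delta> n^2.
    The rest, 24 n/\<delta> + n, fits into the other half as soon as n \<ge> 50/\<delta>^2.\<close>
  define l where "l = \<delta> / 4"
  have l: "0 < l" "l \<le> 1" using \<delta> by (auto simp: l_def)
  have "\<exists>X. (\<Sum>j\<in>J. exp (l * (\<Sum>e\<in>E. c j e * (of_bool (e \<in> X) - case_prod B e)))) \<le> card J * exp (l\<^sup>2 * card E)"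
    using finE l B EV by (intro rounding_potential) (auto simp: c_def J_def)
  then obtain X where X: "(\<Sum>j\<in>J. exp (l * (\<Sum>e\<in>E. c j e * (of_bool (e \<in> X) - case_prod B e)))) \<le> card J * exp (l\<^sup>2 * card E)"
    by blast
  define R where "R = {(u, v). u \<in> V \<and> v \<in> V \<and> u \<noteq> v \<and> (min u v, max u v) \<in> X}"
  have cardJ: "real (card J) \<le> exp (3 * n)"
  proof -
    have "card J = 2 ^ (2 * card V + 1)"
      using V by (simp add: J_def card_cartesian_product card_Pow power_add mult_2 distrib_left)
    also have "real \<dots> \<le> exp 1 ^ (2 * card V + 1)"
      using exp_ge_add_one_self[of 1] power_mono[of 2 "exp 1 :: real" "2 * card V + 1"] by simp
    also have "\<dots> = exp (2 * n + 1)"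
      unfolding exp_of_nat_mult[symmetric] by (simp add: n_def)
    also have "\<dots> \<le> exp (3 * n)" using n50 by simp
    finally show ?thesis by simp
  qed
  have bound: "(\<Sum>e\<in>E. c j e * (of_bool (e \<in> X) - case_prod B e)) \<le> 3 * n / l + l * n\<^sup>2" if j: "j \<in> J" for j
  proof -
    have "exp (l * (\<Sum>e\<in>E. c j e * (of_bool (e \<in> X) - case_prod B e)))
        \<le> (\<Sum>j\<in>J. exp (l * (\<Sum>e\<in>E. c j e * (of_bool (e \<in> X) - case_prod B e))))"
      using j V by (intro member_le_sum) (auto simp: J_def)
    also have "\<dots> \<le> card J * exp (l\<^sup>2 * card E)" by (rule X)
    also have "\<dots> \<le> exp (3 * n) * exp (l\<^sup>2 * n\<^sup>2)"
      using cardJ cardE by (intro mult_mono) (auto intro: mult_left_mono)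
    also have "\<dots> = exp (3 * n + l\<^sup>2 * n\<^sup>2)" by (simp add: exp_add)
    finally have "l * (\<Sum>e\<in>E. c j e * (of_bool (e \<in> X) - case_prod B e)) \<le> l * (3 * n / l + l * n\<^sup>2)"
      using l by (simp add: algebra_simps power2_eq_square)
    then show ?thesis using l by (simp only: mult_le_cancel_left_pos)
  qed
  have fin_bound: "2 * (3 * n / l + l * n\<^sup>2) + n \<le> \<delta> * n\<^sup>2"
  proof -
    have "24 * n / \<delta> + n \<le> 25 * n / \<delta>" using \<delta> n50 by (simp add: field_simps)
    also have "\<dots> = 25 / \<delta>\<^sup>2 * (\<delta> * n)" using \<delta> by (simp add: field_simps power2_eq_square)
    also have "\<dots> \<le> n / 2 * (\<delta> * n)" using n \<delta> n50 by (intro mult_right_mono) (auto simp: n_def)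
    finally show ?thesis using \<delta> by (simp add: l_def field_simps power2_eq_square)
  qed
  have main: "\<bar>\<Sum>u\<in>S. \<Sum>v\<in>T. of_bool ((u, v) \<in> R) - B u v\<bar> \<le> \<delta> * n\<^sup>2"
    if ST: "S \<subseteq> V" "T \<subseteq> V" for S T
  proof -
    define g where "g = (\<lambda>(u, v). of_bool (u \<in> S \<and> v \<in> T) * (of_bool ((u, v) \<in> R) - B u v))"
    define sm where "sm = (\<Sum>e\<in>E. c (S, T, 1) e * (of_bool (e \<in> X) - case_prod B e))"
    have sw: "prod.swap ` E \<subseteq> V \<times> V" using EV by auto
    have "(\<Sum>u\<in>S. \<Sum>v\<in>T. of_bool ((u, v) \<in> R) - B u v) = (\<Sum>e\<in>S\<times>T. g e)"
      by (auto simp: sum.cartesian_product g_def intro!: sum.cong)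
    also have "\<dots> = (\<Sum>e\<in>V\<times>V. g e)"
      using ST V by (intro sum.mono_neutral_left) (auto simp: g_def)
    also have "V \<times> V = (E \<union> prod.swap ` E) \<union> (\<lambda>u. (u, u)) ` V"
      by (auto simp: E_def image_iff)
    also have "(\<Sum>e\<in>\<dots>. g e) = (\<Sum>e\<in>E \<union> prod.swap ` E. g e) + (\<Sum>e\<in>(\<lambda>u. (u, u)) ` V. g e)"
      using finE V by (intro sum.union_disjoint) (auto simp: E_def)
    also have "(\<Sum>e\<in>E \<union> prod.swap ` E. g e) = (\<Sum>e\<in>E. g e) + (\<Sum>e\<in>prod.swap ` E. g e)"
      using finE by (intro sum.union_disjoint) (auto simp: E_def)
    also have "(\<Sum>e\<in>prod.swap ` E. g e) = (\<Sum>e\<in>E. g (prod.swap e))"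
      by (subst sum.reindex) (auto intro: inj_onI)
    also have "(\<Sum>e\<in>E. g e) + (\<Sum>e\<in>E. g (prod.swap e)) = 2 * sm"
      unfolding sum.distrib[symmetric] sm_def sum_distrib_left
    proof (intro sum.cong refl)
      fix e assume "e \<in> E"
      then obtain u v where e: "e = (u, v)" "u \<in> V" "v \<in> V" "u < v" by (auto simp: E_def)
      then have "B v u = B u v" "(u, v) \<in> R \<longleftrightarrow> (u, v) \<in> X" "(v, u) \<in> R \<longleftrightarrow> (u, v) \<in> X"
        using B by (auto simp: R_def min_def max_def)
      then show "g e + g (prod.swap e) = 2 * (c (S, T, 1) e * (of_bool (e \<in> X) - case_prod B e))"
        by (simp add: e(1) g_def c_def algebra_simps)
    qed
    also have "(\<Sum>e\<in>(\<lambda>u. (u, u)) ` V. g e) = (\<Sum>u\<in>V. g (u, u))"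
      by (subst sum.reindex) (auto intro: inj_onI)
    finally have eq: "(\<Sum>u\<in>S. \<Sum>v\<in>T. of_bool ((u, v) \<in> R) - B u v) = 2 * sm + (\<Sum>u\<in>V. g (u, u))" .
    have "\<bar>\<Sum>u\<in>V. g (u, u)\<bar> \<le> (\<Sum>u\<in>V. 1)"
      by (rule order_trans[OF sum_abs sum_mono]) (use B in \<open>auto simp: g_def R_def of_bool_def\<close>)
    then have 1: "\<bar>\<Sum>u\<in>V. g (u, u)\<bar> \<le> n" by (simp add: n_def)
    have "sm \<le> 3 * n / l + l * n\<^sup>2"
      unfolding sm_def using ST by (intro bound) (auto simp: J_def)
    moreover have "- sm = (\<Sum>e\<in>E. c (S, T, -1) e * (of_bool (e \<in> X) - case_prod B e))"
      unfolding sm_def sum_negf[symmetric] by (intro sum.cong) (auto simp: c_def)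
    then have "- sm \<le> 3 * n / l + l * n\<^sup>2"
      using bound[of "(S, T, -1)"] ST by (simp add: J_def)
    ultimately have "2 * \<bar>sm\<bar> + n \<le> 2 * (3 * n / l + l * n\<^sup>2) + n" by (simp add: abs_le_iff)
    also note fin_bound
    finally show ?thesis unfolding eq using 1 by linarith
  qed
  show ?thesis
    using main by (intro exI[of _ R]) (auto simp: R_def n_def sym_def irrefl_def min.commute max.commute)
qed

section \<open>Rounding a matrix to a regular graph\<close>

lemma sum_abs_le_twice:
  fixes f :: "'v \<Rightarrow> real"
  assumes "finite V" and le: "\<And>S. S \<subseteq> V \<Longrightarrow> \<bar>\<Sum>v\<in>S. f v\<bar> \<le> e"
  shows "(\<Sum>v\<in>V. \<bar>f v\<bar>) \<le> 2 * e"
proof -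
  \<comment> \<open>Splitting by sign turns a bound for all subsets, as cuts provide it, into an l_1
    bound for degrees and row sums.\<close>
  let ?P = "{v \<in> V. f v \<ge> 0}" and ?N = "{v \<in> V. f v < 0}"
  have "V = ?P \<union> ?N" by auto
  then have "(\<Sum>v\<in>V. \<bar>f v\<bar>) = (\<Sum>v\<in>?P \<union> ?N. \<bar>f v\<bar>)" by simp
  also have "\<dots> = (\<Sum>v\<in>?P. \<bar>f v\<bar>) + (\<Sum>v\<in>?N. \<bar>f v\<bar>)"
    using assms(1) by (intro sum.union_disjoint) auto
  also have "(\<Sum>v\<in>?P. \<bar>f v\<bar>) = (\<Sum>v\<in>?P. f v)" by (intro sum.cong) auto
  also have "(\<Sum>v\<in>?N. \<bar>f v\<bar>) = - (\<Sum>v\<in>?N. f v)"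
    unfolding sum_negf[symmetric] by (intro sum.cong) auto
  also have "(\<Sum>v\<in>?P. f v) + - (\<Sum>v\<in>?N. f v) \<le> 2 * e"
    using le[of ?P] le[of ?N] by force
  finally show ?thesis .
qed

lemma degree_eq_sum:
  assumes "finite V" "R \<subseteq> V \<times> V"
  shows "real (vertex_degree R v) = (\<Sum>u\<in>V. of_bool ((v, u) \<in> R))"
proof -
  have "R `` {v} = V \<inter> {u. (v, u) \<in> R}" using assms(2) by auto
  then show ?thesis using assms(1) by (simp add: vertex_degree_def of_bool_def sum.If_cases)
qed

lemma sum_sum_abs_le:
  fixes f :: "'v \<Rightarrow> 'v \<Rightarrow> real"
  assumes "finite V" "S \<subseteq> V" "T \<subseteq> V" "\<And>u v. u \<in> V \<Longrightarrow> v \<in> V \<Longrightarrow> \<bar>f u v\<bar> \<le> g u v"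
  shows "\<bar>\<Sum>u\<in>S. \<Sum>v\<in>T. f u v\<bar> \<le> (\<Sum>u\<in>V. \<Sum>v\<in>V. g u v)"
proof -
  have g0: "0 \<le> g u v" if "u \<in> V" "v \<in> V" for u v using assms(4)[OF that] by linarith
  have "\<bar>\<Sum>u\<in>S. \<Sum>v\<in>T. f u v\<bar> \<le> (\<Sum>u\<in>S. \<bar>\<Sum>v\<in>T. f u v\<bar>)" by (rule sum_abs)
  also have "\<dots> \<le> (\<Sum>u\<in>S. \<Sum>v\<in>T. \<bar>f u v\<bar>)" by (intro sum_mono sum_abs)
  also have "\<dots> \<le> (\<Sum>u\<in>S. \<Sum>v\<in>T. g u v)" using assms by (intro sum_mono) auto
  also have "\<dots> \<le> (\<Sum>u\<in>S. \<Sum>v\<in>V. g u v)" using assms g0 by (intro sum_mono sum_mono2) auto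
  also have "\<dots> \<le> (\<Sum>u\<in>V. \<Sum>v\<in>V. g u v)"
    using assms g0 by (intro sum_mono2 sum_nonneg) auto
  finally show ?thesis .
qed

text \<open>\<open>regularize\<close> needs a defect below D (n - 2 D), so D has to keep away from 0
  and from n/2. Replacing B by (1 - 4 \<eta>) B + \<eta> changes every entry by at most 3 \<eta> and
  moves a density d \<le> 1/2 into [\<eta>, 1/2 - \<eta>]. The degree is the new density times n,
  rounded down to an even number, and so does not depend on B.\<close>

lemma regular_rounding_sparse:
  fixes B :: "nat \<Rightarrow> nat \<Rightarrow> real" and V :: "nat set" and \<eta> d :: real
  defines "n \<equiv> real (card V)"
  defines "D \<equiv> 2 * nat \<lfloor>((1 - 4 * \<eta>) * d + \<eta>) * n / 2\<rfloor>"
  assumes V: "finite V" and \<eta>: "0 < \<eta>" "\<eta> \<le> 1 / 8" and n: "3200 / \<eta> ^ 4 \<le> n"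
    and d: "0 \<le> d" "d \<le> 1 / 2"
    and B: "\<And>u v. u \<in> V \<Longrightarrow> v \<in> V \<Longrightarrow> B u v = B v u \<and> 0 \<le> B u v \<and> B u v \<le> 1"
    and rows: "(\<Sum>v\<in>V. \<bar>(\<Sum>u\<in>V. B v u) - d * n\<bar>) \<le> \<eta>\<^sup>2 / 8 * n\<^sup>2"
  shows "\<exists>H. H \<subseteq> V \<times> V \<and> sym H \<and> irrefl H \<and> (\<forall>v\<in>V. vertex_degree H v = D) \<and>
    (\<forall>S T. S \<subseteq> V \<longrightarrow> T \<subseteq> V \<longrightarrow> \<bar>\<Sum>u\<in>S. \<Sum>v\<in>T. of_bool ((u, v) \<in> H) - B u v\<bar> \<le> 4 * \<eta> * n\<^sup>2)"
proof -
  have n24: "24 \<le> \<eta>\<^sup>2 * n"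
  proof -
    have "\<eta>\<^sup>2 \<le> 1" using \<eta> by (intro power_le_one) auto
    then have "24 \<le> 3200 / \<eta>\<^sup>2" using \<eta> by (simp add: field_simps)
    also have "\<dots> = \<eta>\<^sup>2 * (3200 / \<eta> ^ 4)"
      using \<eta> by (simp add: field_simps power2_eq_square power4_eq_xxxx)
    also have "\<dots> \<le> \<eta>\<^sup>2 * n" using n by (intro mult_left_mono) auto
    finally show ?thesis .
  qed
  have npos: "0 < n" using n24 \<eta> by (cases "n = 0") (auto simp: n_def)
  have nn: "24 * n \<le> \<eta>\<^sup>2 * n\<^sup>2"
    using mult_right_mono[OF n24, of n] npos by (simp add: power2_eq_square algebra_simps)
  \<comment> \<open>The degrees will deviate from \<open>D\<close> by at most 3 \<delta> n^2 + 2 n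
    in l_1, and the defect is at most twice as large; \<delta> = \<eta>^2/8 keeps it below \<eta>^2
    n^2. The hypothesis 3200/\<eta>^4 is 50/\<delta>^2.\<close>
  define \<delta> where "\<delta> = \<eta>\<^sup>2 / 8"
  have \<eta>2: "\<eta>\<^sup>2 \<le> \<eta> / 8" using \<eta> by (simp add: power2_eq_square field_simps)
  have \<delta>: "0 < \<delta>" "\<delta> \<le> 1" using \<eta> \<eta>2 by (auto simp: \<delta>_def)
  have n50: "50 / \<delta>\<^sup>2 \<le> real (card V)"
    using n \<eta> by (simp add: \<delta>_def n_def field_simps power2_eq_square power4_eq_xxxx)
  define B' where "B' = (\<lambda>u v. (1 - 4 * \<eta>) * B u v + \<eta>)"
  have B': "B' u v = B' v u \<and> 0 \<le> B' u v \<and> B' u v \<le> 1" if "u \<in> V" "v \<in> V" for u v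
  proof -
    have "(1 - 4 * \<eta>) * B u v \<le> 1 - 4 * \<eta>" using B[OF that] \<eta> by (intro mult_left_le) auto
    moreover have "0 \<le> (1 - 4 * \<eta>) * B u v" "B u v = B v u" using B[OF that] \<eta> by auto
    ultimately show ?thesis using \<eta>(1) unfolding B'_def by (intro conjI) (simp, linarith+)
  qed
  have "\<exists>R. R \<subseteq> V \<times> V \<and> sym R \<and> irrefl R \<and> (\<forall>S T. S \<subseteq> V \<longrightarrow> T \<subseteq> V \<longrightarrow>
      \<bar>\<Sum>u\<in>S. \<Sum>v\<in>T. of_bool ((u, v) \<in> R) - B' u v\<bar> \<le> \<delta> * n\<^sup>2)"
    unfolding n_def by (rule graph_rounding[OF V \<delta> n50 B'])
  then obtain R where R: "R \<subseteq> V \<times> V" "sym R" "irrefl R"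
    and disc: "\<forall>S T. S \<subseteq> V \<longrightarrow> T \<subseteq> V \<longrightarrow> \<bar>\<Sum>u\<in>S. \<Sum>v\<in>T. of_bool ((u, v) \<in> R) - B' u v\<bar> \<le> \<delta> * n\<^sup>2"
    by (elim exE conjE)
  define d' where "d' = (1 - 4 * \<eta>) * d + \<eta>"
  have d': "\<eta> \<le> d'" "d' \<le> 1 / 2 - \<eta>"
  proof -
    have "(1 - 4 * \<eta>) * d \<le> (1 - 4 * \<eta>) * (1 / 2)" using d \<eta> by (intro mult_left_mono) auto
    also have "\<dots> = 1 / 2 - 2 * \<eta>" by (simp add: algebra_simps)
    finally show "d' \<le> 1 / 2 - \<eta>" by (simp add: d'_def)
    show "\<eta> \<le> d'" using d \<eta> by (simp add: d'_def)
  qed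
  have D: "d' * n - 2 \<le> D" "D \<le> d' * n"
  proof -
    have "0 \<le> \<lfloor>d' * n / 2\<rfloor>" using d' \<eta> npos by simp
    then have "real D = 2 * of_int \<lfloor>d' * n / 2\<rfloor>" by (simp add: D_def d'_def)
    then show "d' * n - 2 \<le> D" "D \<le> d' * n" by linarith+
  qed
  have e1: "(\<Sum>v\<in>V. \<bar>real (vertex_degree R v) - (\<Sum>u\<in>V. B' v u)\<bar>) \<le> 2 * (\<delta> * n\<^sup>2)"
    unfolding degree_eq_sum[OF V R(1)] sum_subtractf[symmetric]
    by (rule sum_abs_le_twice[OF V]) (use disc in auto)
  have "(\<Sum>u\<in>V. B' v u) = (1 - 4 * \<eta>) * (\<Sum>u\<in>V. B v u) + n * \<eta>" for v
    by (simp add: B'_def sum.distrib n_def flip: sum_distrib_left)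
  then have "(\<Sum>u\<in>V. B' v u) - d' * n = (1 - 4 * \<eta>) * ((\<Sum>u\<in>V. B v u) - d * n)" for v
    by (simp add: d'_def algebra_simps)
  then have "(\<Sum>v\<in>V. \<bar>(\<Sum>u\<in>V. B' v u) - d' * n\<bar>) = (1 - 4 * \<eta>) * (\<Sum>v\<in>V. \<bar>(\<Sum>u\<in>V. B v u) - d * n\<bar>)"
    using \<eta> by (simp add: abs_mult sum_distrib_left)
  also have "\<dots> \<le> 1 * (\<delta> * n\<^sup>2)"
    using rows \<eta> by (intro mult_mono) (auto simp: \<delta>_def)
  finally have e2: "(\<Sum>v\<in>V. \<bar>(\<Sum>u\<in>V. B' v u) - d' * n\<bar>) \<le> \<delta> * n\<^sup>2" by simp
  have "(\<Sum>v\<in>V. \<bar>real (vertex_degree R v) - D\<bar>) \<le>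
      (\<Sum>v\<in>V. \<bar>real (vertex_degree R v) - (\<Sum>u\<in>V. B' v u)\<bar> + \<bar>(\<Sum>u\<in>V. B' v u) - d' * n\<bar> + 2)"
    using D by (intro sum_mono) linarith
  also have "\<dots> \<le> 3 * \<delta> * n\<^sup>2 + 2 * n"
    using e1 e2 by (simp add: sum.distrib n_def)
  finally have dev: "(\<Sum>v\<in>V. \<bar>real (vertex_degree R v) - D\<bar>) \<le> 3 * \<delta> * n\<^sup>2 + 2 * n" .
  have "real (defect V D R) \<le> (\<Sum>v\<in>V. 2 * \<bar>real (vertex_degree R v) - D\<bar>)"
    unfolding defect_def of_nat_sum by (intro sum_mono) (auto simp: of_nat_diff abs_if split: nat_diff_split)
  also have "\<dots> \<le> 2 * (3 * \<delta> * n\<^sup>2 + 2 * n)"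
    using dev by (simp add: sum_distrib_left[symmetric])
  also have "\<dots> \<le> \<eta>\<^sup>2 * n\<^sup>2" using nn npos by (simp add: \<delta>_def field_simps)
  finally have def_le: "real (defect V D R) \<le> \<eta>\<^sup>2 * n\<^sup>2" .
  \<comment> \<open>D is at least \<eta> n - 2 and n - 2 D at least 2 \<eta> n, so their product is
    about twice the bound \<eta>^2 n^2 for the defect.\<close>
  have "real (defect V D R) < real D * (n - 2 * D)"
  proof -
    have 1: "2 * \<eta> * n \<le> n - 2 * D" using D mult_right_mono[OF d'(2), of n] npos by (simp add: algebra_simps)
    have 2: "\<eta> * n - 2 \<le> D" using D mult_right_mono[OF d'(1), of n] npos by linarith
    have "\<eta>\<^sup>2 * n \<le> \<eta> * n" using \<eta>2 \<eta> npos by (intro mult_right_mono) auto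
    then have 3: "24 \<le> \<eta> * n" using n24 by linarith
    have "\<eta>\<^sup>2 * n\<^sup>2 < (\<eta> * n - 2) * (2 * \<eta> * n)"
      using mult_strict_left_mono[of "4" "\<eta> * n" "\<eta> * n"] 3 by (simp add: power2_eq_square algebra_simps)
    also have "\<dots> \<le> D * (n - 2 * D)" using 1 2 3 by (intro mult_mono) auto
    finally show ?thesis using def_le by linarith
  qed
  then have "real (defect V D R + 2 * D * D) < real (card V * D)"
    by (simp add: n_def algebra_simps)
  then have cond: "defect V D R + 2 * D * D < card V * D" by linarith
  have ev: "even (card V * D)" by (simp add: D_def)
  obtain H where H: "H \<subseteq> V \<times> V" "sym H" "irrefl H" "\<forall>v\<in>V. vertex_degree H v = D"
    and card_le: "card (sym_diff R H) \<le> 6 * defect V D R"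
    using regularize[OF V ev R cond] by (elim exE conjE)
  have "\<bar>\<Sum>u\<in>S. \<Sum>v\<in>T. of_bool ((u, v) \<in> H) - B u v\<bar> \<le> 4 * \<eta> * n\<^sup>2" if ST: "S \<subseteq> V" "T \<subseteq> V" for S T
  proof -
    have "(\<Sum>u\<in>S. \<Sum>v\<in>T. of_bool ((u, v) \<in> H) - B u v) =
       (\<Sum>u\<in>S. \<Sum>v\<in>T. of_bool ((u, v) \<in> H) - of_bool ((u, v) \<in> R)) +
       (\<Sum>u\<in>S. \<Sum>v\<in>T. of_bool ((u, v) \<in> R) - B' u v) + (\<Sum>u\<in>S. \<Sum>v\<in>T. B' u v - B u v)"
      by (simp add: sum.distrib[symmetric])
    moreover have "\<bar>\<Sum>u\<in>S. \<Sum>v\<in>T. of_bool ((u, v) \<in> H) - of_bool ((u, v) \<in> R)\<bar>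
        \<le> (\<Sum>u\<in>V. \<Sum>v\<in>V. of_bool ((u, v) \<in> sym_diff R H) :: real)"
      using V ST by (intro sum_sum_abs_le) auto
    moreover have "(\<Sum>u\<in>V. \<Sum>v\<in>V. of_bool ((u, v) \<in> sym_diff R H) :: real) = card (sym_diff R H)"
    proof -
      have "V \<times> V \<inter> sym_diff R H = sym_diff R H" using R(1) H(1) by auto
      then have "(\<Sum>e\<in>V \<times> V. of_bool (e \<in> sym_diff R H) :: real) = card (sym_diff R H)"
        using V by (subst of_bool_def) (simp add: sum.If_cases Collect_mem_eq del: Un_iff Diff_iff)
      then show ?thesis by (subst sum.cartesian_product) (simp only: split_def prod.collapse)
    qed
    moreover have "real (card (sym_diff R H)) \<le> 6 * (\<eta>\<^sup>2 * n\<^sup>2)" using card_le def_le by linarith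
    moreover have "\<bar>\<Sum>u\<in>S. \<Sum>v\<in>T. of_bool ((u, v) \<in> R) - B' u v\<bar> \<le> \<delta> * n\<^sup>2" using disc ST by blast
    moreover have "\<bar>\<Sum>u\<in>S. \<Sum>v\<in>T. B' u v - B u v\<bar> \<le> (\<Sum>u\<in>V. \<Sum>v\<in>V. 3 * \<eta>)"
    proof (intro sum_sum_abs_le V ST)
      fix u v assume uv: "u \<in> V" "v \<in> V"
      have "\<eta> * B u v \<le> \<eta> * 1" "0 \<le> \<eta> * B u v" using B[OF uv] \<eta> by (auto intro: mult_left_le)
      then show "\<bar>B' u v - B u v\<bar> \<le> 3 * \<eta>" by (auto simp: B'_def algebra_simps abs_le_iff)
    qed
    moreover have "(\<Sum>u\<in>V. \<Sum>v\<in>V. 3 * \<eta>) = 3 * \<eta> * n\<^sup>2" by (simp add: n_def power2_eq_square)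
    ultimately have cmp: "\<bar>\<Sum>u\<in>S. \<Sum>v\<in>T. of_bool ((u, v) \<in> H) - B u v\<bar>
        \<le> 6 * (\<eta>\<^sup>2 * n\<^sup>2) + \<delta> * n\<^sup>2 + 3 * \<eta> * n\<^sup>2"
      by linarith
    have "\<eta>\<^sup>2 * n\<^sup>2 \<le> \<eta> / 8 * n\<^sup>2" using \<eta>2 by (intro mult_right_mono) auto
    moreover have "0 \<le> \<eta> * n\<^sup>2" using \<eta> by simp
    ultimately have "6 * (\<eta>\<^sup>2 * n\<^sup>2) + \<delta> * n\<^sup>2 + 3 * \<eta> * n\<^sup>2 \<le> 4 * \<eta> * n\<^sup>2"
      by (simp add: \<delta>_def field_simps)
    with cmp show ?thesis by linarith
  qed
  then show ?thesis using H by (intro exI[of _ H] conjI) auto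
qed

text \<open>\<open>D\<close> is quantified before \<open>B\<close>, which gives the whole family one
  degree. For d > 1/2 the sparse case is applied to 1 - B and the graph is complemented; the
  complement also has to drop the diagonal, and its cost n \<le> \<eta> n^2 raises 4 \<eta> to 5
  \<eta>.\<close>

lemma regular_rounding:
  fixes V :: "nat set" and \<eta> d :: real
  defines "n \<equiv> real (card V)"
  assumes V: "finite V" and \<eta>: "0 < \<eta>" "\<eta> \<le> 1 / 8" and n: "3200 / \<eta> ^ 4 \<le> n"
    and d: "0 \<le> d" "d \<le> 1"
  shows "\<exists>D. \<forall>B. (\<forall>u\<in>V. \<forall>v\<in>V. B u v = B v u \<and> 0 \<le> B u v \<and> B u v \<le> 1) \<longrightarrow>
    (\<Sum>v\<in>V. \<bar>(\<Sum>u\<in>V. B v u) - d * n\<bar>) \<le> \<eta>\<^sup>2 / 8 * n\<^sup>2 \<longrightarrow>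
    (\<exists>H. H \<subseteq> V \<times> V \<and> sym H \<and> irrefl H \<and> (\<forall>v\<in>V. vertex_degree H v = D) \<and>
    (\<forall>S T. S \<subseteq> V \<longrightarrow> T \<subseteq> V \<longrightarrow> \<bar>\<Sum>u\<in>S. \<Sum>v\<in>T. of_bool ((u, v) \<in> H) - B u v\<bar> \<le> 5 * \<eta> * n\<^sup>2))"
proof (cases "d \<le> 1 / 2")
  case True
  show ?thesis
  proof (intro exI[of _ "2 * nat \<lfloor>((1 - 4 * \<eta>) * d + \<eta>) * n / 2\<rfloor>"] allI impI)
    fix B :: "nat \<Rightarrow> nat \<Rightarrow> real"
    assume *: "\<forall>u\<in>V. \<forall>v\<in>V. B u v = B v u \<and> 0 \<le> B u v \<and> B u v \<le> 1"
      "(\<Sum>v\<in>V. \<bar>(\<Sum>u\<in>V. B v u) - d * n\<bar>) \<le> \<eta>\<^sup>2 / 8 * n\<^sup>2"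
    have le5: "4 * \<eta> * n\<^sup>2 \<le> 5 * \<eta> * n\<^sup>2" using \<eta> by (intro mult_right_mono) auto
    obtain H where H: "H \<subseteq> V \<times> V" "sym H" "irrefl H"
        "\<forall>v\<in>V. vertex_degree H v = 2 * nat \<lfloor>((1 - 4 * \<eta>) * d + \<eta>) * n / 2\<rfloor>"
      and disc: "\<forall>S T. S \<subseteq> V \<longrightarrow> T \<subseteq> V \<longrightarrow>
          \<bar>\<Sum>u\<in>S. \<Sum>v\<in>T. of_bool ((u, v) \<in> H) - B u v\<bar> \<le> 4 * \<eta> * n\<^sup>2"
      using regular_rounding_sparse[OF V \<eta> n[unfolded n_def] d(1) True, of B] *
      unfolding n_def by auto
    have "\<forall>S T. S \<subseteq> V \<longrightarrow> T \<subseteq> V \<longrightarrow>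
        \<bar>\<Sum>u\<in>S. \<Sum>v\<in>T. of_bool ((u, v) \<in> H) - B u v\<bar> \<le> 5 * \<eta> * n\<^sup>2"
      by (intro allI impI order_trans[OF _ le5]) (use disc in simp)
    with H show "\<exists>H. H \<subseteq> V \<times> V \<and> sym H \<and> irrefl H \<and>
         (\<forall>v\<in>V. vertex_degree H v = 2 * nat \<lfloor>((1 - 4 * \<eta>) * d + \<eta>) * n / 2\<rfloor>) \<and>
         (\<forall>S T. S \<subseteq> V \<longrightarrow> T \<subseteq> V \<longrightarrow> \<bar>\<Sum>u\<in>S. \<Sum>v\<in>T. of_bool ((u, v) \<in> H) - B u v\<bar> \<le> 5 * \<eta> * n\<^sup>2)"
      by (intro exI[of _ H] conjI)
  qed
next
  case False
  define D where "D = 2 * nat \<lfloor>((1 - 4 * \<eta>) * (1 - d) + \<eta>) * n / 2\<rfloor>"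
  have nbig: "n \<le> \<eta> * n\<^sup>2"
  proof -
    have "\<eta> ^ 3 \<le> 1" using \<eta> by (intro power_le_one) auto
    then have "1 \<le> 3200 / \<eta> ^ 3" using \<eta> by (simp add: field_simps)
    also have "\<dots> = \<eta> * (3200 / \<eta> ^ 4)" using \<eta> by (simp add: field_simps power3_eq_cube power4_eq_xxxx)
    also have "\<dots> \<le> \<eta> * n" using n \<eta> by (intro mult_left_mono) auto
    finally have "1 * n \<le> \<eta> * n * n" by (intro mult_right_mono) (auto simp: n_def)
    then show ?thesis by (simp add: power2_eq_square algebra_simps)
  qed
  show ?thesis
  proof (intro exI[of _ "card V - 1 - D"] allI impI)
    fix B :: "nat \<Rightarrow> nat \<Rightarrow> real"
    assume B: "\<forall>u\<in>V. \<forall>v\<in>V. B u v = B v u \<and> 0 \<le> B u v \<and> B u v \<le> 1"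
      and rows: "(\<Sum>v\<in>V. \<bar>(\<Sum>u\<in>V. B v u) - d * n\<bar>) \<le> \<eta>\<^sup>2 / 8 * n\<^sup>2"
    have "(\<Sum>v\<in>V. \<bar>(\<Sum>u\<in>V. 1 - B v u) - (1 - d) * n\<bar>) = (\<Sum>v\<in>V. \<bar>(\<Sum>u\<in>V. B v u) - d * n\<bar>)"
      by (intro sum.cong refl) (simp add: sum_subtractf n_def algebra_simps abs_minus_commute)
    then obtain H where H: "H \<subseteq> V \<times> V" "sym H" "irrefl H" "\<forall>v\<in>V. vertex_degree H v = D"
      and disc: "\<forall>S T. S \<subseteq> V \<longrightarrow> T \<subseteq> V \<longrightarrow>
          \<bar>\<Sum>u\<in>S. \<Sum>v\<in>T. of_bool ((u, v) \<in> H) - (1 - B u v)\<bar> \<le> 4 * \<eta> * n\<^sup>2"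
      using regular_rounding_sparse[OF V \<eta> n[unfolded n_def], of "1 - d" "\<lambda>u v. 1 - B u v"] d False rows B
      unfolding n_def D_def by auto
    define K where "K = V \<times> V - Id - H"
    have "vertex_degree K v = card V - 1 - D" if "v \<in> V" for v
    proof -
      have "K `` {v} = V - {v} - H `` {v}" using that by (auto simp: K_def)
      moreover have "H `` {v} \<subseteq> V - {v}" using H by (auto simp: irrefl_def)
      moreover from this have "finite (H `` {v})" by (rule finite_subset) (use V in simp)
      ultimately show ?thesis
        using V that H(4) by (simp add: vertex_degree_def card_Diff_subset)
    qed
    moreover have "\<bar>\<Sum>u\<in>S. \<Sum>v\<in>T. of_bool ((u, v) \<in> K) - B u v\<bar> \<le> 5 * \<eta> * n\<^sup>2"
      if ST: "S \<subseteq> V" "T \<subseteq> V" for S T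
    proof -
      have "(\<Sum>u\<in>S. \<Sum>v\<in>T. of_bool ((u, v) \<in> K) - B u v) =
        - (\<Sum>u\<in>S. \<Sum>v\<in>T. of_bool ((u, v) \<in> H) - (1 - B u v)) - (\<Sum>u\<in>S. \<Sum>v\<in>T. of_bool (u = v))"
        unfolding sum_negf[symmetric] sum_subtractf[symmetric]
        using ST H(3) by (intro sum.cong refl) (auto simp: K_def irrefl_def)
      moreover have "\<bar>\<Sum>u\<in>S. \<Sum>v\<in>T. of_bool (u = v) :: real\<bar> \<le> (\<Sum>u\<in>V. \<Sum>v\<in>V. of_bool (u = v))"
        using V ST by (intro sum_sum_abs_le) auto
      moreover have "(\<Sum>u\<in>V. \<Sum>v\<in>V. of_bool (u = v) :: real) = n"
        using V by (simp add: of_bool_def n_def)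
      moreover have "\<bar>\<Sum>u\<in>S. \<Sum>v\<in>T. of_bool ((u, v) \<in> H) - (1 - B u v)\<bar> \<le> 4 * \<eta> * n\<^sup>2"
        using disc ST by blast
      ultimately show ?thesis using nbig by linarith
    qed
    moreover have "K \<subseteq> V \<times> V" "sym K" "irrefl K"
      using H(2) by (auto simp: K_def sym_def irrefl_def)
    ultimately show "\<exists>H. H \<subseteq> V \<times> V \<and> sym H \<and> irrefl H \<and> (\<forall>v\<in>V. vertex_degree H v = card V - 1 - D) \<and>
       (\<forall>S T. S \<subseteq> V \<longrightarrow> T \<subseteq> V \<longrightarrow> \<bar>\<Sum>u\<in>S. \<Sum>v\<in>T. of_bool ((u, v) \<in> H) - B u v\<bar> \<le> 5 * \<eta> * n\<^sup>2)"
      by (intro exI[of _ K] conjI) auto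
  qed
qed

section \<open>Parametrizing standard Borel probability spaces by the unit interval\<close>

text \<open>A Borel copy of the space in [0,1) with a Borel left inverse on the whole line, by which
  images of sets can be written as preimages. The range [0,1) leaves the integer part free to carry
  a step index.\<close>

definition real_retract :: "'a measure \<Rightarrow> bool" where
  "real_retract M \<longleftrightarrow> (\<exists>h r. h \<in> borel_measurable M \<and> r \<in> measurable (borel :: real measure) M \<and>
     (\<forall>x\<in>space M. 0 \<le> h x \<and> h x < 1 \<and> r (h x) = x))"

text \<open>The digits 2 and 3 are not used, so that every sequence is recovered by \<open>code_bit\<close>.\<close>

definition code :: "(nat \<Rightarrow> bool) \<Rightarrow> real" where
  "code s = (\<Sum>i. of_bool (s i) * (1 / 4) ^ Suc i)"

definition code_bit :: "nat \<Rightarrow> real \<Rightarrow> bool" where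
  "code_bit i y \<longleftrightarrow> \<lfloor>4 ^ Suc i * y\<rfloor> mod 4 = 1"

lemma summable_code: "summable (\<lambda>i. of_bool (s i) * (1 / 4 :: real) ^ Suc i)"
  by (rule summable_comparison_test[of _ "\<lambda>i. (1 / 4) ^ i"]) (auto intro!: exI[of _ 0] summable_geometric)

lemma code_nonneg: "0 \<le> code s"
  unfolding code_def by (intro suminf_nonneg summable_code) auto

lemma code_less_1: "code s < 1"
proof -
  have s: "(\<lambda>i. (1 / 4 :: real) * (1 / 4) ^ i) sums (1 / 4 * (1 / (1 - 1 / 4)))"
    by (intro sums_mult geometric_sums) auto
  have "code s \<le> (\<Sum>i. (1 / 4) * (1 / 4) ^ i)"
    unfolding code_def using s by (intro suminf_le summable_code) (auto simp: sums_iff)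
  also have "\<dots> < 1" using s by (simp add: sums_iff)
  finally show ?thesis .
qed

lemma code_shift: "4 * code s = of_bool (s 0) + code (\<lambda>i. s (Suc i))"
proof -
  have "code s - of_bool (s 0) / 4 = (\<Sum>i. of_bool (s (Suc i)) * (1 / 4) ^ Suc (Suc i))"
    unfolding code_def using suminf_split_head[OF summable_code[of s]] by simp
  also have "\<dots> = (\<Sum>i. (1 / 4) * (of_bool (s (Suc i)) * (1 / 4) ^ Suc i))"
    by (intro suminf_cong) simp
  also have "\<dots> = (1 / 4) * code (\<lambda>i. s (Suc i))"
    unfolding code_def by (intro suminf_mult summable_code)
  finally show ?thesis by simp
qed

text \<open>Multiplication by 4 moves the first bit in front of a code that lies in [0,1), so the
  floor reads this bit. At later positions the bits already passed contribute a multiple of 4, which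
  disappears modulo 4.\<close>

lemma code_bit_code: "code_bit i (code s) = s i"
proof (induction i arbitrary: s)
  case 0
  have "\<lfloor>4 * code s\<rfloor> = of_bool (s 0)"
    unfolding code_shift using code_nonneg[of "\<lambda>i. s (Suc i)"] code_less_1[of "\<lambda>i. s (Suc i)"]
    by (simp add: floor_eq_iff)
  then show ?case by (simp add: code_bit_def)
next
  case (Suc i)
  have "4 ^ Suc (Suc i) * code s = of_int (4 ^ Suc i * of_bool (s 0)) + 4 ^ Suc i * code (\<lambda>i. s (Suc i))"
  proof -
    have "4 ^ Suc (Suc i) * code s = 4 ^ Suc i * (4 * code s)" by simp
    then show ?thesis unfolding code_shift by (simp add: distrib_left del: power_Suc)
  qed
  then have "\<lfloor>4 ^ Suc (Suc i) * code s\<rfloor> = 4 ^ Suc i * of_bool (s 0) + \<lfloor>4 ^ Suc i * code (\<lambda>i. s (Suc i))\<rfloor>"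
    by (simp only: int_add_floor)
  then have "code_bit (Suc i) (code s) = code_bit i (code (\<lambda>i. s (Suc i)))"
    by (simp add: code_bit_def mod_mult_self3 mult.assoc)
  then show ?case using Suc by simp
qed

lemma measurable_code [measurable (raw)]:
  assumes [measurable]: "\<And>i. Measurable.pred M (\<lambda>x. s x i)"
  shows "(\<lambda>x. code (s x)) \<in> borel_measurable M"
  unfolding code_def by measurable

lemma pred_code_bit [measurable]: "Measurable.pred borel (code_bit i)"
  unfolding code_bit_def by measurable

section \<open>Standard Borel spaces as Borel retracts of the line\<close>

lemma (in Metric_space) dense_sequence:
  assumes "second_countable mtopology" "M \<noteq> {}"
  shows "\<exists>x :: nat \<Rightarrow> 'a. range x \<subseteq> M \<and> (\<forall>y\<in>M. \<forall>e>0. \<exists>k. d y (x k) < e)"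
proof -
  obtain \<B> where \<B>: "countable \<B>" "\<And>V. V \<in> \<B> \<Longrightarrow> openin mtopology V"
    "\<And>U x. openin mtopology U \<Longrightarrow> x \<in> U \<Longrightarrow> \<exists>V\<in>\<B>. x \<in> V \<and> V \<subseteq> U"
    using assms(1) unfolding second_countable_def by metis
  define C where "C = (\<lambda>V. SOME y. y \<in> V) ` (\<B> - {{}})"
  have some: "(SOME y. y \<in> V) \<in> V" if "V \<in> \<B> - {{}}" for V
    using that by (simp add: some_in_eq)
  have dense: "\<exists>z\<in>C. d y z < e" if "y \<in> M" "0 < e" for y e
  proof -
    obtain V where V: "V \<in> \<B>" "y \<in> V" "V \<subseteq> mball y e"
      using \<B>(3)[OF openin_mball[of y e], of y] \<open>y \<in> M\<close> \<open>0 < e\<close> by auto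
    then have C: "(SOME y. y \<in> V) \<in> C" "(SOME y. y \<in> V) \<in> V" using some[of V] by (auto simp: C_def)
    then have "(SOME y. y \<in> V) \<in> mball y e" using V by blast
    then show ?thesis using C(1) by auto
  qed
  have "C \<noteq> {}" using dense[of _ 1] assms(2) by force
  moreover have "countable C" using \<B>(1) by (auto simp: C_def)
  ultimately have rng: "range (from_nat_into C) = C" by (simp add: range_from_nat_into)
  have "C \<subseteq> M" using some \<B>(2) openin_subset by (fastforce simp: C_def)
  show ?thesis
  proof (intro exI[of _ "from_nat_into C"] conjI ballI allI impI)
    show "range (from_nat_into C) \<subseteq> M" using rng \<open>C \<subseteq> M\<close> by simp
    show "\<exists>k. d y (from_nat_into C k) < e" if "y \<in> M" "0 < e" for y e
      using dense[OF that] rng by (metis rangeE)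
  qed
qed

text \<open>A point is encoded by the indices of the first points of a dense sequence at distance less than
  \<open>2\<^sup>-\<^sup>n\<close> from it; conversely a sequence of indices is decoded to the limit of the corresponding points
  if these satisfy the Cauchy condition with the rate that comes from \<open>2\<^sup>-\<^sup>n\<close>.\<close>

lemma standard_borel_imp_real_retract:
  assumes "standard_borel N" "space N \<noteq> {}"
  shows "real_retract N"
proof -
  obtain X where X: "topspace X = space N" "completely_metrizable_space X" "second_countable X"
    and sets_N: "sets N = sigma_sets (space N) {G. openin X G}"
    using assms(1) unfolding standard_borel_def by blast
  obtain M d where Md: "Metric_space M d" "Metric_space.mcomplete M d" and XM: "X = Metric_space.mtopology M d"
    using X(2) unfolding completely_metrizable_space_def by blast
  interpret Metric_space M d by (rule Md)
  have sp: "space N = M" using X(1) XM by simp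
  have open_sets: "G \<in> sets N" if "openin mtopology G" for G
    using that sets_N XM by (simp add: sigma_sets.Basic)
  have "second_countable mtopology" "M \<noteq> {}" using X(3) XM assms(2) sp by simp_all
  from dense_sequence[OF this]
  obtain x :: "nat \<Rightarrow> 'a" where x: "range x \<subseteq> M" "\<forall>y\<in>M. \<forall>e>0. \<exists>k. d y (x k) < e"
    by (elim exE conjE)
  have xM [simp]: "x k \<in> M" for k using x(1) by auto
  define idx where "idx n y = (LEAST k. d y (x k) < (1 / 2) ^ n)" for n y
  have idx: "d y (x (idx n y)) < (1 / 2) ^ n" if "y \<in> M" for n y
    unfolding idx_def by (rule LeastI_ex) (use x(2) that in simp)
  have pred_ball: "Measurable.pred N (\<lambda>y. d y (x k) < e)" for k e
  proof -
    have "{y \<in> space N. d y (x k) < e} = mball (x k) e" unfolding sp by (auto simp: commute)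
    then show ?thesis using open_sets[OF openin_mball] by (simp add: pred_def)
  qed
  have [measurable]: "idx n \<in> measurable N (count_space UNIV)" for n
    unfolding idx_def using pred_ball by measurable
  \<comment> \<open>One bit for every pair (n, k), set exactly when k is the n-th index, so that
    \<open>LEAST\<close> recovers the index.\<close>
  define h where "h y = code (\<lambda>i. case prod_decode i of (n, k) \<Rightarrow> idx n y = k)" for y
  have h_meas: "h \<in> borel_measurable N"
    unfolding h_def by (intro measurable_code) (auto split: prod.split)
  define s where "s n t = (LEAST k. code_bit (prod_encode (n, k)) t)" for n and t :: real
  have [measurable]: "s n \<in> measurable borel (count_space UNIV)" for n
    unfolding s_def by measurable
  have s_h: "s n (h y) = idx n y" for n y
    unfolding s_def h_def code_bit_code by (auto intro: Least_equality)
  define fast where "fast t \<longleftrightarrow> (\<forall>n m. d (x (s n t)) (x (s m t)) \<le> (1 / 2) ^ n + (1 / 2) ^ m)" for t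
  have [measurable]: "Measurable.pred borel fast" unfolding fast_def by measurable
  \<comment> \<open>\<open>x 0\<close> is a default for reals whose decoded points violate the
    Cauchy condition.\<close>
  define r where "r t = (if fast t then SOME l. l \<in> M \<and> (\<forall>n. d l (x (s n t)) \<le> (1 / 2) ^ n) else x 0)" for t
  have small: "\<exists>n. C * (1 / 2) ^ n < e" if "0 < e" "0 < C" for e C :: real
    using real_arch_pow_inv[of "e / C" "1 / 2"] that by (auto simp: field_simps)
  have r: "r t \<in> M" "d (r t) (x (s n t)) \<le> (1 / 2) ^ n" if "fast t" for t n
  proof -
    have "MCauchy (\<lambda>n. x (s n t))"
      unfolding MCauchy_def
    proof (intro conjI allI impI)
      fix e :: real assume "0 < e"
      then obtain N where N: "2 * (1 / 2) ^ N < e" using small[of e 2] by auto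
      have "d (x (s n t)) (x (s m t)) < e" if "N \<le> n" "N \<le> m" for n m
      proof -
        have "(1 / 2 :: real) ^ n \<le> (1 / 2) ^ N" "(1 / 2 :: real) ^ m \<le> (1 / 2) ^ N"
          using that by (auto intro: power_decreasing)
        moreover have "d (x (s n t)) (x (s m t)) \<le> (1 / 2) ^ n + (1 / 2) ^ m"
          using \<open>fast t\<close> by (simp add: fast_def)
        ultimately show ?thesis using N by linarith
      qed
      then show "\<exists>N. \<forall>n n'. N \<le> n \<longrightarrow> N \<le> n' \<longrightarrow> d (x (s n t)) (x (s n' t)) < e" by blast
    qed auto
    then obtain l where "limitin mtopology (\<lambda>n. x (s n t)) l sequentially"
      using Md(2) unfolding mcomplete_def by blast
    then have l: "l \<in> M" "\<And>e. e > 0 \<Longrightarrow> \<forall>\<^sub>F n in sequentially. d (x (s n t)) l < e"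
      by (auto simp: limitin_metric elim: eventually_mono)
    have "d l (x (s n t)) \<le> (1 / 2) ^ n" for n
    proof (rule field_le_epsilon)
      fix e :: real assume e: "0 < e"
      obtain K where K: "(1 / 2) ^ K < e / 2" using small[of "e / 2" 1] e by auto
      have "\<forall>\<^sub>F m in sequentially. d (x (s m t)) l < e / 2 \<and> m \<ge> K"
        using l(2)[of "e / 2"] e eventually_ge_at_top[of K] by (simp add: eventually_conj_iff)
      then obtain m where m: "d (x (s m t)) l < e / 2" "m \<ge> K"
        by (metis (mono_tags, lifting) eventually_happens' sequentially_bot)
      have "(1 / 2 :: real) ^ m \<le> (1 / 2) ^ K" using m by (auto intro: power_decreasing)
      moreover have "d (x (s m t)) (x (s n t)) \<le> (1 / 2) ^ m + (1 / 2) ^ n"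
        using \<open>fast t\<close> by (simp add: fast_def)
      moreover have "d l (x (s n t)) \<le> d l (x (s m t)) + d (x (s m t)) (x (s n t))"
        using l(1) by (intro triangle) auto
      ultimately show "d l (x (s n t)) \<le> (1 / 2) ^ n + e"
        using m(1) K commute[of l "x (s m t)"] by linarith
    qed
    then have "\<exists>l. l \<in> M \<and> (\<forall>n. d l (x (s n t)) \<le> (1 / 2) ^ n)" using l by blast
    from someI_ex[OF this] show "r t \<in> M" "d (r t) (x (s n t)) \<le> (1 / 2) ^ n"
      using \<open>fast t\<close> by (auto simp: r_def)
  qed
  have rM: "r t \<in> M" for t using r(1)[of t] by (cases "fast t") (auto simp: r_def)
  have r_h: "r (h y) = y" if "y \<in> M" for y
  proof -
    have y: "d y (x (s n (h y))) < (1 / 2) ^ n" for n using idx[OF that] by (simp add: s_h)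
    have "fast (h y)"
      unfolding fast_def
    proof (intro allI)
      fix n m
      have "d (x (s n (h y))) (x (s m (h y))) \<le> d (x (s n (h y))) y + d y (x (s m (h y)))"
        using that by (intro triangle) auto
      then show "d (x (s n (h y))) (x (s m (h y))) \<le> (1 / 2) ^ n + (1 / 2) ^ m"
        using y[of n] y[of m] commute[of y "x (s n (h y))"] by linarith
    qed
    note r' = r[OF this]
    have "d (r (h y)) y \<le> 0 + e" if "e > 0" for e
    proof -
      obtain n where n: "2 * (1 / 2) ^ n < e" using small[of e 2] \<open>e > 0\<close> by auto
      have "d (r (h y)) y \<le> d (r (h y)) (x (s n (h y))) + d (x (s n (h y))) y"
        using \<open>y \<in> M\<close> r'(1) by (intro triangle) auto
      then show ?thesis
        using n y[of n] r'(2)[of n] commute[of y "x (s n (h y))"] by linarith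
    qed
    then have "d (r (h y)) y \<le> 0" by (rule field_le_epsilon)
    then have "d (r (h y)) y = 0" using nonneg[of "r (h y)" y] by linarith
    then show ?thesis using r'(1) that by simp
  qed
  have "r \<in> measurable borel (sigma (space N) {G. openin X G})"
  proof (rule measurable_measure_of)
    show "{G. openin X G} \<subseteq> Pow (space N)" using X(1) openin_subset by fastforce
    show "r \<in> space borel \<rightarrow> space N" unfolding sp using rM by auto
    fix G assume "G \<in> {G. openin X G}"
    then have G: "openin mtopology G" by (simp add: XM)
    \<comment> \<open>A choice operator gives no measurability by itself. The preimage of an open
      set is described instead by the closed balls around decoded points that lie inside
      \<open>G\<close>: these are countably many conditions on the decoded indices.\<close>
    have "r -` G \<inter> space borel =
       {t. fast t \<and> (\<exists>n. \<exists>k. mcball (x k) ((1 / 2) ^ n) \<subseteq> G \<and> s n t = k)} \<union> {t. \<not> fast t \<and> x 0 \<in> G}"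
    proof -
      have "r t \<in> G \<longleftrightarrow> (\<exists>n. mcball (x (s n t)) ((1 / 2) ^ n) \<subseteq> G)" if "fast t" for t
      proof
        assume "r t \<in> G"
        then obtain e where e: "e > 0" "mball (r t) e \<subseteq> G" using G by (auto simp: openin_mtopology)
        obtain n where n: "2 * (1 / 2) ^ n < e" using small[of e 2] e by auto
        have "mcball (x (s n t)) ((1 / 2) ^ n) \<subseteq> mball (r t) e"
        proof
          fix z assume z: "z \<in> mcball (x (s n t)) ((1 / 2) ^ n)"
          then have "d (r t) z \<le> d (r t) (x (s n t)) + d (x (s n t)) z"
            using rM by (intro triangle) auto
          then show "z \<in> mball (r t) e" using z r(1)[OF that] r(2)[OF that, of n] n by auto
        qed
        then show "\<exists>n. mcball (x (s n t)) ((1 / 2) ^ n) \<subseteq> G" using e by blast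
      next
        assume "\<exists>n. mcball (x (s n t)) ((1 / 2) ^ n) \<subseteq> G"
        then show "r t \<in> G" using r[OF that] by (auto simp: commute subset_iff)
      qed
      moreover have "r t = x 0" if "\<not> fast t" for t using that by (simp add: r_def)
      ultimately have "r t \<in> G \<longleftrightarrow> fast t \<and> (\<exists>n. \<exists>k. mcball (x k) ((1 / 2) ^ n) \<subseteq> G \<and> s n t = k) \<or> \<not> fast t \<and> x 0 \<in> G"
        for t by (cases "fast t") simp_all
      then show ?thesis by (intro set_eqI) simp
    qed
    also have "\<dots> \<in> sets borel" by measurable
    finally show "r -` G \<inter> space borel \<in> sets borel" .
  qed
  also have "measurable borel (sigma (space N) {G. openin X G}) = measurable borel N"
  proof (intro measurable_cong_sets refl)
    have "{G. openin X G} \<subseteq> Pow (space N)" using X(1) openin_subset by fastforce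
    then show "sets (sigma (space N) {G. openin X G}) = sets N"
      unfolding sets_N by (rule sets_measure_of)
  qed
  finally have "r \<in> measurable borel N" .
  moreover have "0 \<le> h y \<and> h y < 1" for y unfolding h_def using code_nonneg code_less_1 by blast
  ultimately show ?thesis unfolding real_retract_def sp using h_meas r_h by auto
qed

text \<open>The plane is itself a standard Borel space. The map \<open>c\<close> serves as a Borel
  pairing for product spaces, and its restrictions to the lines a = const are disjoint copies of the
  line inside [0,1).\<close>

lemma real_retract_plane:
  "\<exists>c \<rho>. c \<in> borel_measurable (borel \<Otimes>\<^sub>M borel) \<and> \<rho> \<in> measurable borel (borel \<Otimes>\<^sub>M borel) \<and>
     (\<forall>a b. 0 \<le> c (a, b) \<and> c (a, b) < (1 :: real) \<and> \<rho> (c (a, b)) = (a :: real, b :: real))"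
proof -
  have "standard_borel (borel :: (real \<times> real) measure)"
    unfolding standard_borel_def
  proof (intro exI[of _ euclidean] conjI)
    obtain B :: "(real \<times> real) set set" where B: "countable B" "topological_basis B"
      using ex_countable_basis by blast
    then show "second_countable (euclidean :: (real \<times> real) topology)"
      unfolding second_countable_def
      by (intro exI[of _ B]) (auto simp: topological_basis_open elim!: topological_basisE)
  qed (auto simp: completely_metrizable_space_euclidean borel_def)
  then have "real_retract (borel :: (real \<times> real) measure)"
    by (intro standard_borel_imp_real_retract) auto
  then show ?thesis unfolding real_retract_def borel_prod by simp
qed

lemma real_retract_pair:
  fixes M :: "'a measure" and N :: "'b measure"
  assumes "real_retract M" "real_retract N"
  shows "real_retract (M \<Otimes>\<^sub>M N)"
proof -
  obtain c :: "real \<times> real \<Rightarrow> real" and \<rho>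
    where [measurable]: "c \<in> borel_measurable (borel \<Otimes>\<^sub>M borel)" "\<rho> \<in> measurable borel (borel \<Otimes>\<^sub>M borel)"
    and c: "\<And>a b. 0 \<le> c (a, b) \<and> c (a, b) < 1 \<and> \<rho> (c (a, b)) = (a, b)"
    using real_retract_plane by blast
  obtain h :: "'a \<Rightarrow> real" and r where M: "h \<in> borel_measurable M" "r \<in> measurable borel M" "\<And>x. x \<in> space M \<Longrightarrow> r (h x) = x"
    using assms(1) unfolding real_retract_def by blast
  obtain h' :: "'b \<Rightarrow> real" and r' where N: "h' \<in> borel_measurable N" "r' \<in> measurable borel N" "\<And>x. x \<in> space N \<Longrightarrow> r' (h' x) = x"
    using assms(2) unfolding real_retract_def by blast
  note [measurable] = M(1,2) N(1,2)
  show ?thesis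
    unfolding real_retract_def
  proof (intro exI[of _ "\<lambda>z. c (h (fst z), h' (snd z))"] exI[of _ "\<lambda>y. (r (fst (\<rho> y)), r' (snd (\<rho> y)))"] conjI)
    show "(\<lambda>z. c (h (fst z), h' (snd z))) \<in> borel_measurable (M \<Otimes>\<^sub>M N)"
      by measurable
    show "(\<lambda>y. (r (fst (\<rho> y)), r' (snd (\<rho> y)))) \<in> borel \<rightarrow>\<^sub>M M \<Otimes>\<^sub>M N"
      by measurable
    show "\<forall>x\<in>space (M \<Otimes>\<^sub>M N). 0 \<le> c (h (fst x), h' (snd x)) \<and> c (h (fst x), h' (snd x)) < 1 \<and>
       (r (fst (\<rho> (c (h (fst x), h' (snd x))))), r' (snd (\<rho> (c (h (fst x), h' (snd x)))))) = x"
      using c M(3) N(3) by (auto simp: space_pair_measure)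
  qed
qed

section \<open>A Borel Schroeder-Bernstein theorem and quantile functions\<close>

lemma borel_schroeder_bernstein:
  fixes A :: "real set" and X :: "'a set" and \<alpha> :: "real \<Rightarrow> 'a" and \<beta> :: "'a \<Rightarrow> real"
  assumes [measurable]: "A \<in> sets borel" "X \<in> sets M"
      "\<alpha> \<in> measurable borel M" "\<beta> \<in> borel_measurable M"
      "\<alpha>' \<in> borel_measurable M" "\<beta>' \<in> measurable borel M"
    and \<alpha>: "\<And>u. u \<in> A \<Longrightarrow> \<alpha> u \<in> X \<and> \<alpha>' (\<alpha> u) = u"
    and \<beta>: "\<And>x. x \<in> X \<Longrightarrow> \<beta> x \<in> A \<and> \<beta>' (\<beta> x) = x"
  shows "\<exists>f. f \<in> measurable borel M \<and> bij_betw f A X"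
proof -
  \<comment> \<open>The usual chains: \<open>D 0\<close> is A without the image of X under \<beta>,
    and \<open>D (Suc n)\<close> is the image of \<open>D n\<close> under \<beta> \<circ> \<alpha>.
    The left inverses express both by preimages, which makes them Borel.\<close>
  define D where "D = rec_nat {u \<in> A. \<not> (\<beta>' u \<in> X \<and> \<beta> (\<beta>' u) = u)}
      (\<lambda>_ D. {u \<in> A. \<alpha>' (\<beta>' u) \<in> D \<and> \<beta>' u \<in> X \<and> \<beta> (\<alpha> (\<alpha>' (\<beta>' u))) = u})"
  have D0: "D 0 = {u \<in> A. \<not> (\<beta>' u \<in> X \<and> \<beta> (\<beta>' u) = u)}" by (simp add: D_def)
  have DS: "D (Suc n) = {u \<in> A. \<alpha>' (\<beta>' u) \<in> D n \<and> \<beta>' u \<in> X \<and> \<beta> (\<alpha> (\<alpha>' (\<beta>' u))) = u}" for n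
    by (simp add: D_def)
  have DA: "D n \<subseteq> A" for n by (cases n) (auto simp: D0 DS)
  have [measurable]: "D n \<in> sets borel" for n
  proof (induction n)
    case 0
    then show ?case unfolding D0 by measurable
  next
    case (Suc n)
    note [measurable] = Suc
    show ?case unfolding DS by measurable
  qed
  define C where "C = (\<Union>n. D n)"
  have [measurable]: "C \<in> sets borel" unfolding C_def by measurable
  define f where "f u = (if u \<in> C then \<alpha> u else \<beta>' u)" for u
  have "f \<in> measurable borel M" unfolding f_def by measurable
  moreover have "bij_betw f A X"
    unfolding bij_betw_def
  proof (intro conjI inj_onI set_eqI iffI)
    have off: "\<beta>' u \<in> X \<and> \<beta> (\<beta>' u) = u" if "u \<in> A" "u \<notin> C" for u
      using that D0 by (auto simp: C_def)
    \<comment> \<open>If \<alpha> u = \<beta>' v with u on a chain, then v = \<beta> (\<alpha> u) is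
      the next element of that chain.\<close>
    have mix: False if m: "u \<in> A" "u \<in> C" "v \<in> A" "v \<notin> C" "\<alpha> u = \<beta>' v" for u v
    proof -
      obtain n where "u \<in> D n" using m(2) by (auto simp: C_def)
      then have "v \<in> D (Suc n)"
        unfolding DS using m(1,3) off[OF m(3,4)] \<alpha>[OF m(1)] m(5)[symmetric] by simp
      then show False using m(4) by (auto simp: C_def)
    qed
    show "u = v" if uv: "u \<in> A" "v \<in> A" "f u = f v" for u v
    proof (cases "u \<in> C")
      case u: True
      then have "v \<in> C" using mix[OF uv(1) u uv(2)] uv(3) by (auto simp: f_def)
      then have "\<alpha> u = \<alpha> v" using u uv(3) by (simp add: f_def)
      then show ?thesis using \<alpha>[OF uv(1)] \<alpha>[OF uv(2)] by metis
    next
      case u: False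
      then have v: "v \<notin> C" using mix[OF uv(2) _ uv(1) u] uv(3) by (auto simp: f_def)
      then have "\<beta>' u = \<beta>' v" using u uv(3) by (simp add: f_def)
      then show ?thesis using off[OF uv(1) u] off[OF uv(2) v] by metis
    qed
    show "x \<in> X" if "x \<in> f ` A" for x
      using that \<alpha> off by (auto simp: f_def split: if_splits)
    show "x \<in> f ` A" if x: "x \<in> X" for x
    proof (cases "\<beta> x \<in> C")
      case True
      then obtain n where n: "\<beta> x \<in> D n" by (auto simp: C_def)
      have "n \<noteq> 0" using n \<beta>[OF x] x by (intro notI) (simp add: D0)
      then obtain m where "n = Suc m" using not0_implies_Suc by blast
      with n have m: "\<alpha>' x \<in> D m" "\<beta> (\<alpha> (\<alpha>' x)) = \<beta> x" using \<beta>[OF x] by (auto simp: DS)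
      then have "\<alpha> (\<alpha>' x) = x" using \<alpha>[of "\<alpha>' x"] \<beta>[of "\<alpha> (\<alpha>' x)"] \<beta>[OF x] DA by (metis subsetD)
      moreover have "\<alpha>' x \<in> C" "\<alpha>' x \<in> A" using m DA by (auto simp: C_def)
      ultimately show ?thesis by (auto simp: f_def intro!: image_eqI[of _ _ "\<alpha>' x"])
    next
      case False
      then show ?thesis using \<beta>[OF x] by (auto simp: f_def intro!: image_eqI[of _ _ "\<beta> x"])
    qed
  qed
  ultimately show ?thesis by blast
qed

text \<open>Without atoms the distribution function is continuous, so C (I u) > u would give C y > u
  for some y < I u, against the equivalence of u \<le> C y and I u \<le> y in
  \<open>pseudoinverse\<close>.\<close>

lemma (in cdf_distribution) cdf_quantile:
  assumes "\<And>x. measure M {x} = 0" "0 < u" "u < 1"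
  shows "C (I u) = u"
proof (rule antisym)
  show "u \<le> C (I u)" using pseudoinverse[OF assms(2,3)] by blast
  show "C (I u) \<le> u"
  proof (rule ccontr)
    assume "\<not> C (I u) \<le> u"
    then have gt: "u < C (I u)" by simp
    have "(C \<longlongrightarrow> C (I u)) (at_left (I u))"
      using assms(1) isCont_cdf unfolding isCont_def by (metis filterlim_at_split)
    then have "\<forall>\<^sub>F y in at_left (I u). u < C y" using gt by (rule order_tendstoD)
    moreover have "\<forall>\<^sub>F y in at_left (I u). y < I u" by (simp add: eventually_at_filter)
    ultimately have "\<forall>\<^sub>F y in at_left (I u). u < C y \<and> y < I u" by (rule eventually_conj)
    then obtain y where "u < C y" "y < I u"
      using eventually_happens'[OF trivial_limit_at_left_real] by blast
    then show False using pseudoinverse[OF assms(2,3), of y] by simp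
  qed
qed

lemma (in cdf_distribution) measurable_quantile_extended:
  "(\<lambda>u. if u \<in> {0<..<1} then I u else 0) \<in> borel_measurable borel"
  by (rule iffD1[OF measurable_restrict_space_iff measurable_CI]) auto

text \<open>The quantile function of the uniform distribution on a compact subset of \<open>B\<close> takes all its
  values in that subset.\<close>

lemma borel_embedding_of_unit_interval:
  fixes B :: "real set"
  assumes "B \<in> sets borel" "0 < emeasure lborel B" "emeasure lborel B < \<infinity>"
  shows "\<exists>s t. s \<in> borel_measurable borel \<and> t \<in> borel_measurable borel \<and>
           (\<forall>x. 0 \<le> x \<longrightarrow> x < (1::real) \<longrightarrow> s x \<in> B \<and> t (s x) = x)"
proof -
  define \<mu> where "\<mu> = density lborel (indicator B :: real \<Rightarrow> ennreal)"
  have \<mu>: "emeasure \<mu> A = emeasure lborel (B \<inter> A)" if "A \<in> sets borel" for A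
    unfolding \<mu>_def using that assms(1) by (intro emeasure_restricted) auto
  have "emeasure \<mu> (space \<mu>) \<noteq> \<infinity>" using \<mu>[of UNIV] assms(3) by (simp add: \<mu>_def)
  then have "(SUP K\<in>{K. K \<subseteq> B \<and> compact K}. emeasure \<mu> K) = emeasure \<mu> B"
    using assms(1) by (intro inner_regular[symmetric]) (auto simp: \<mu>_def)
  then have "0 < (SUP K\<in>{K. K \<subseteq> B \<and> compact K}. emeasure \<mu> K)"
    using \<mu>[OF assms(1)] assms(2) by simp
  then obtain K where K: "compact K" "K \<subseteq> B" "0 < emeasure \<mu> K"
    by (auto simp: less_SUP_iff)
  have Kb [measurable]: "K \<in> sets borel" using K(1) by (simp add: borel_compact)
  have "B \<inter> K = K" using K(2) by blast
  then have eK: "emeasure lborel K \<noteq> 0" using \<mu>[OF Kb] K(3) by simp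
  have eK': "emeasure lborel K \<noteq> \<infinity>" using emeasure_bounded_finite[OF compact_imp_bounded[OF K(1)]] by auto
  define \<nu> where "\<nu> = uniform_measure lborel K"
  interpret prob_space \<nu> unfolding \<nu>_def using eK eK' by (rule prob_space_uniform_measure)
  interpret cdf_distribution \<nu> by standard (simp add: \<nu>_def)
  have \<nu>: "measure \<nu> A = measure lborel (K \<inter> A) / measure lborel K" if "A \<in> sets borel" for A
    unfolding \<nu>_def using eK eK' that by (intro measure_uniform_measure) auto
  have null: "measure \<nu> {x} = 0" for x
  proof -
    have "measure lborel (K \<inter> {x}) = 0"
      by (rule measure_eq_0_null_sets) (auto intro!: null_sets_subset[of "{x}"] finite_imp_null_set_lborel)
    then show ?thesis by (simp add: \<nu>)
  qed
  \<comment> \<open>If \<open>I u\<close> missed \<open>K\<close>, so would an interval around it,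
    and the distribution function would reach u already at I u - e/2.\<close>
  have IK: "I u \<in> K" if u: "0 < u" "u < 1" for u
  proof (rule ccontr)
    assume "I u \<notin> K"
    then have "I u \<in> - K" "open (- K)" using K(1) compact_imp_closed by (auto intro: open_Compl)
    then obtain e where e: "e > 0" "ball (I u) e \<subseteq> - K" by (meson open_contains_ball)
    have "K \<inter> {..I u} = K \<inter> {..I u - e / 2}"
    proof -
      have "y \<le> I u - e / 2" if "y \<in> K" "y \<le> I u" for y
      proof (rule ccontr)
        assume "\<not> y \<le> I u - e / 2"
        then have "y \<in> ball (I u) e" using that e by (auto simp: dist_real_def)
        then show False using e that by blast
      qed
      then show ?thesis using e by (auto; fastforce)
    qed
    then have "C (I u) = C (I u - e / 2)" by (simp add: cdf_def \<nu>)
    then have "u \<le> C (I u - e / 2)" using cdf_quantile[OF null u] by simp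
    then have "I u \<le> I u - e / 2" by (rule pseudoinverse[OF u, THEN iffD1])
    then show False using e(1) by simp
  qed
  \<comment> \<open>The substitution (x + 1)/2 sends [0,1) into (0,1), where the quantile identity
    holds; \<open>t\<close> undoes it.\<close>
  define s where "s x = (\<lambda>u. if u \<in> {0<..<1} then I u else 0) ((x + 1) / 2)" for x
  define t where "t y = 2 * C y - 1" for y
  have "s \<in> borel_measurable borel"
    unfolding s_def by (rule measurable_compose[OF _ measurable_quantile_extended]) measurable
  moreover have "t \<in> borel_measurable borel" unfolding t_def by measurable
  moreover have "s x \<in> B \<and> t (s x) = x" if "0 \<le> x" "x < 1" for x
  proof -
    have u: "0 < (x + 1) / 2" "(x + 1) / 2 < 1" using that by auto
    have sx: "s x = I ((x + 1) / 2)" using that by (simp add: s_def)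
    have "C (s x) = (x + 1) / 2" unfolding sx by (rule cdf_quantile[OF null u])
    moreover have "s x \<in> B" unfolding sx using IK[OF u] K(2) by blast
    ultimately show ?thesis by (simp add: t_def)
  qed
  ultimately show ?thesis by blast
qed

lemma AE_unit_interval:
  "(AE u in unit_interval. P u) \<longleftrightarrow> (AE u in lborel. 0 \<le> u \<and> u < 1 \<longrightarrow> P u)"
  unfolding unit_interval_def by (subst AE_restrict_space_iff) auto

lemma emeasure_unit_interval:
  assumes "A \<in> sets borel" "A \<subseteq> {0..<1}"
  shows "emeasure unit_interval A = emeasure lborel A"
  using assms by (simp add: unit_interval_def emeasure_restrict_space)

lemma space_unit_interval [simp]: "space unit_interval = {0..<1}"
  by (simp add: unit_interval_def space_restrict_space)

lemma measurable_unit_interval: "f \<in> measurable borel M \<Longrightarrow> f \<in> measurable unit_interval M"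
  unfolding unit_interval_def by (intro measurable_restrict_space1) simp

lemma AE_lborel_open_unit_interval:
  "(AE u in lborel. 0 \<le> u \<and> u < 1 \<longrightarrow> P u) \<longleftrightarrow> (AE u in lborel. 0 < u \<and> u < (1::real) \<longrightarrow> P u)"
proof
  assume "AE u in lborel. 0 < u \<and> u < (1::real) \<longrightarrow> P u"
  with AE_lborel_singleton[of 0] show "AE u in lborel. 0 \<le> u \<and> u < 1 \<longrightarrow> P u"
    by eventually_elim auto
qed (auto elim: eventually_mono)

text \<open>Almost everywhere the parametrization is \<open>r\<close> composed with the quantile function of the
  distribution of \<open>h\<close>. The exceptional null sets are matched by the Schroeder-Bernstein argument once
  they are enlarged by a null set that contains a copy of the whole interval; this null set is a
  slice of a copy of the plane.\<close>

lemma quantile_parametrization: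
  fixes M :: "'a measure" and h :: "'a \<Rightarrow> real"
  assumes "prob_space M" and h [measurable]: "h \<in> borel_measurable M"
    and r [measurable]: "r \<in> measurable borel M"
    and rh: "\<And>x. x \<in> space M \<Longrightarrow> r (h x) = x"
    and null: "\<And>x. x \<in> space M \<Longrightarrow> emeasure M {x} = 0"
  shows "\<exists>f g Q. measure_preserving_bij unit_interval M f \<and> g \<in> borel_measurable M \<and>
    mono_on {0<..<1} Q \<and> (AE u in unit_interval. g (f u) = u \<and> h (f u) = Q u)"
proof -
  interpret M: prob_space M by fact
  define \<nu> where "\<nu> = distr M borel h"
  interpret cdf_distribution \<nu>
    unfolding cdf_distribution_def \<nu>_def by (rule M.real_distribution_distr) measurable
  have null_\<nu>: "measure \<nu> {y} = 0" for y
  proof -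
    have "h -` {y} \<inter> space M \<subseteq> {r y}" using rh by auto
    then have "emeasure M (h -` {y} \<inter> space M) = 0"
      using null[of "r y"] by (cases "h -` {y} \<inter> space M = {}") (auto simp: subset_singleton_iff)
    then show ?thesis by (simp add: \<nu>_def measure_def emeasure_distr)
  qed
  define Q where "Q u = (if u \<in> {0<..<1} then I u else 0)" for u
  have [measurable]: "Q \<in> borel_measurable borel"
    unfolding Q_def[abs_def] by (rule measurable_quantile_extended)
  have mono_Q: "mono_on {0<..<1} Q"
    using mono_I by (auto simp: mono_on_def Q_def)
  have CQ: "C (Q u) = u" if "0 < u" "u < 1" for u
    using cdf_quantile[OF null_\<nu> that] that by (simp add: Q_def)
  let ?R = "restrict_space lborel {0<..<1::real}"
  have distr_Q: "distr ?R borel Q = \<nu>"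
    by (rule trans[OF distr_cong distr_I_eq_M]) (auto simp: Q_def space_restrict_space)
  have [measurable]: "Q \<in> borel_measurable ?R"
    by (intro measurable_restrict_space1) measurable
  define k where "k u = r (Q u)" for u
  have [measurable]: "k \<in> measurable borel M" unfolding k_def by measurable
  \<comment> \<open>On this set, which is almost all of (0,1), \<open>k\<close> is injective with
    left inverse C \<circ> h.\<close>
  define B where "B = {u. 0 < u \<and> u < 1 \<and> h (k u) = Q u}"
  have [measurable]: "B \<in> sets borel" unfolding B_def by measurable
  have "AE y in distr ?R borel Q. h (r y) = y"
    unfolding distr_Q \<nu>_def by (subst AE_distr_iff) (auto simp: rh)
  then have "AE u in ?R. h (r (Q u)) = Q u" by (subst (asm) AE_distr_iff) auto
  then have "AE u in lborel. u \<in> {0<..<1} \<longrightarrow> h (r (Q u)) = Q u"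
    by (subst (asm) AE_restrict_space_iff) auto
  then have AE_B: "AE u in lborel. 0 < u \<and> u < 1 \<longrightarrow> u \<in> B"
    by eventually_elim (simp add: B_def k_def)
  have B01: "B \<subseteq> {0<..<1}" by (auto simp: B_def)
  have hk: "h (k u) = Q u" "C (h (k u)) = u" if "u \<in> B" for u
    using that CQ by (auto simp: B_def)
  have ksp: "k u \<in> space M" for u using measurable_space[OF \<open>k \<in> measurable borel M\<close>] by simp
  have "emeasure lborel B = emeasure lborel {0<..<1::real}"
  proof (rule emeasure_eq_AE)
    show "AE u in lborel. u \<in> B \<longleftrightarrow> u \<in> {0<..<1}"
      using AE_B by eventually_elim (use B01 in auto)
  qed auto
  then have B1: "emeasure lborel B = 1" by simp
  then obtain s t where [measurable]: "s \<in> borel_measurable borel" "t \<in> borel_measurable borel"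
    and st: "\<And>x. 0 \<le> x \<Longrightarrow> x < (1::real) \<Longrightarrow> s x \<in> B \<and> t (s x) = x"
    using borel_embedding_of_unit_interval[of B] by auto
  obtain c :: "real \<times> real \<Rightarrow> real" and \<rho>
    where [measurable]: "c \<in> borel_measurable (borel \<Otimes>\<^sub>M borel)" "\<rho> \<in> measurable borel (borel \<Otimes>\<^sub>M borel)"
    and c: "\<And>a b. 0 \<le> c (a, b) \<and> c (a, b) < 1 \<and> \<rho> (c (a, b)) = (a, b)"
    using real_retract_plane by blast
  have "real_distribution (distr ?R borel (\<lambda>u. fst (\<rho> (t u))))"
    by (intro prob_space.real_distribution_distr)
      (auto simp: emeasure_restrict_space space_restrict_space intro!: prob_spaceI measurable_restrict_space1)
  then interpret T: real_distribution "distr ?R borel (\<lambda>u. fst (\<rho> (t u)))" .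
  \<comment> \<open>The first coordinate of the copied plane has at most countably many atoms, so
    some value \<tau> has a null slice.\<close>
  obtain \<tau> where "measure (distr ?R borel (\<lambda>u. fst (\<rho> (t u)))) {\<tau>} = 0"
    using T.countable_atoms uncountable_UNIV_real
    by (metis (mono_tags, lifting) UNIV_eq_I less_eq_real_def measure_nonneg mem_Collect_eq)
  then have "emeasure (distr ?R borel (\<lambda>u. fst (\<rho> (t u)))) {\<tau>} = 0"
    by (simp add: T.emeasure_eq_measure)
  define N where "N = {u \<in> B. fst (\<rho> (t u)) = \<tau>}"
  have [measurable]: "N \<in> sets borel" unfolding N_def by measurable
  have "emeasure lborel N = 0"
  proof -
    have "AE y in distr ?R borel (\<lambda>u. fst (\<rho> (t u))). y \<noteq> \<tau>"
      using \<open>emeasure _ {\<tau>} = 0\<close> by (intro AE_I[of _ _ "{\<tau>}"]) auto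
    then have "AE u in ?R. fst (\<rho> (t u)) \<noteq> \<tau>"
      by (subst (asm) AE_distr_iff) (auto intro!: measurable_restrict_space1)
    then have "AE u in lborel. u \<in> {0<..<1} \<longrightarrow> fst (\<rho> (t u)) \<noteq> \<tau>"
      by (subst (asm) AE_restrict_space_iff) auto
    then have "AE u in lborel. u \<notin> N"
      by eventually_elim (use B01 in \<open>auto simp: N_def\<close>)
    then show ?thesis by (subst (asm) AE_iff_measurable[of N]) auto
  qed
  then have "AE u in lborel. u \<notin> N" by (intro AE_not_in) (auto simp: null_sets_def)
  then have AE_BN: "AE u in lborel. 0 \<le> u \<and> u < 1 \<longrightarrow> u \<in> B - N"
    using AE_B unfolding AE_lborel_open_unit_interval by eventually_elim auto
  \<comment> \<open>A Borel copy of the whole line inside the null set \<open>N\<close>, with left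
    inverse snd \<circ> \<rho> \<circ> t.\<close>
  define w where "w x = s (c (\<tau>, x))" for x
  have [measurable]: "w \<in> borel_measurable borel" unfolding w_def by measurable
  have w: "w x \<in> N" "w x \<in> B" "snd (\<rho> (t (w x))) = x" for x
    using st[of "c (\<tau>, x)"] c[of \<tau> x] by (auto simp: w_def N_def)
  \<comment> \<open>\<open>k\<close> maps B - N bijectively onto the complement of \<open>X\<close>,
    so \<open>A\<close> and \<open>X\<close> remain to be matched. Removing \<open>N\<close> from
    the domain has put copies of the line into both: \<open>w\<close> has its values in N
    \<subseteq> A, and \<open>k\<close> maps \<open>N\<close> into \<open>X\<close>.\<close>
  define A where "A = {0..<1} - (B - N)"
  define X where "X = {x \<in> space M. \<not> (C (h x) \<in> B - N \<and> h (k (C (h x))) = h x)}"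
  have [measurable]: "A \<in> sets borel" "X \<in> sets M" unfolding A_def X_def by measurable
  have kX: "k u \<in> X \<longleftrightarrow> u \<in> N" if "u \<in> B" for u
    using hk[OF that] that ksp by (auto simp: X_def)
  have "\<exists>f. f \<in> measurable borel M \<and> bij_betw f A X"
  proof (rule borel_schroeder_bernstein)
    show "(\<lambda>u. k (w u)) \<in> measurable borel M" "(\<lambda>x. w (h x)) \<in> borel_measurable M"
      "(\<lambda>x. snd (\<rho> (t (C (h x))))) \<in> borel_measurable M"
      "(\<lambda>u. r (snd (\<rho> (t u)))) \<in> measurable borel M"
      by measurable
    show "k (w u) \<in> X \<and> snd (\<rho> (t (C (h (k (w u)))))) = u" for u
      using kX w hk[of "w u"] by simp
    show "w (h x) \<in> A \<and> r (snd (\<rho> (t (w (h x))))) = x" if "x \<in> X" for x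
      using w B01 that rh by (auto simp: A_def X_def subset_iff less_imp_le)
  qed measurable
  then obtain f0 where [measurable]: "f0 \<in> measurable borel M" and f0: "bij_betw f0 A X" by blast
  define f where "f u = (if u \<in> B - N then k u else f0 u)" for u
  have f_meas [measurable]: "f \<in> measurable borel M" unfolding f_def by measurable
  have fk: "AE u in lborel. 0 \<le> u \<and> u < 1 \<longrightarrow> f u = k u"
    using AE_BN by eventually_elim (auto simp: f_def)
  have "bij_betw f (B - N) (space M - X)"
  proof (rule bij_betwI')
    show "f u = f v \<longleftrightarrow> u = v" if "u \<in> B - N" "v \<in> B - N" for u v
      using that hk by (auto simp: f_def) metis
    show "f u \<in> space M - X" if "u \<in> B - N" for u
      using that kX ksp by (auto simp: f_def)
    show "\<exists>u\<in>B - N. x = f u" if "x \<in> space M - X" for x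
      using that rh[of x] rh[OF ksp, of "C (h x)"] by (intro bexI[of _ "C (h x)"]) (auto simp: X_def f_def)
  qed
  moreover have "bij_betw f A X"
    using f0 by (subst bij_betw_cong[of A f f0]) (auto simp: A_def f_def)
  ultimately have "bij_betw f ((B - N) \<union> A) ((space M - X) \<union> X)"
    by (intro bij_betw_combine) auto
  moreover have "(B - N) \<union> A = {0..<1}" "(space M - X) \<union> X = space M"
    using B01 by (auto simp: A_def X_def)
  ultimately have "bij_betw f (space unit_interval) (space M)" by simp
  moreover have "distr unit_interval M f = M"
  proof (rule measure_eqI)
    fix S assume "S \<in> sets (distr unit_interval M f)"
    then have [measurable]: "S \<in> sets M" by simp
    have [measurable]: "r -` S \<in> sets borel" using measurable_sets[OF r \<open>S \<in> sets M\<close>] by simp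
    have "emeasure (distr unit_interval M f) S = emeasure unit_interval (f -` S \<inter> {0..<1})"
      by (subst emeasure_distr) (auto intro: measurable_unit_interval)
    also have "\<dots> = emeasure lborel {u. 0 \<le> u \<and> u < 1 \<and> f u \<in> S}"
      by (subst emeasure_unit_interval) (auto intro!: arg_cong[where f = "emeasure lborel"])
    also have "\<dots> = emeasure lborel {u. 0 < u \<and> u < 1 \<and> k u \<in> S}"
    proof (rule emeasure_eq_AE)
      show "AE u in lborel. u \<in> {u. 0 \<le> u \<and> u < 1 \<and> f u \<in> S} \<longleftrightarrow> u \<in> {u. 0 < u \<and> u < 1 \<and> k u \<in> S}"
        using fk AE_lborel_singleton[of 0] by eventually_elim auto
    qed measurable
    also have "\<dots> = emeasure ?R (Q -` (r -` S) \<inter> space ?R)"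
      by (subst emeasure_restrict_space)
        (auto simp: space_restrict_space k_def intro!: arg_cong[where f = "emeasure lborel"])
    also have "\<dots> = emeasure (distr ?R borel Q) (r -` S \<inter> space borel)"
      by (subst emeasure_distr) auto
    also have "\<dots> = emeasure M (h -` (r -` S) \<inter> space M)"
      unfolding distr_Q \<nu>_def by (subst emeasure_distr) auto
    also have "h -` (r -` S) \<inter> space M = S"
      using rh sets.sets_into_space[OF \<open>S \<in> sets M\<close>] by auto
    finally show "emeasure (distr unit_interval M f) S = emeasure M S" .
  qed simp
  ultimately have "measure_preserving_bij unit_interval M f"
    unfolding measure_preserving_bij_def measure_preserving_def
    using measurable_unit_interval[OF f_meas] by blast
  moreover have "AE u in unit_interval. C (h (f u)) = u \<and> h (f u) = Q u"
    unfolding AE_unit_interval using AE_BN by eventually_elim (use hk in \<open>auto simp: f_def\<close>)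
  moreover have "(\<lambda>x. C (h x)) \<in> borel_measurable M" by measurable
  ultimately show ?thesis using mono_Q by blast
qed

section \<open>Weak regularity\<close>

lemma measurable_step:
  fixes G :: "nat \<Rightarrow> nat \<Rightarrow> real"
  assumes [measurable]: "i \<in> measurable M (count_space UNIV)" "j \<in> measurable N (count_space UNIV)"
  shows "(\<lambda>z. G (i (fst z)) (j (snd z))) \<in> borel_measurable (M \<Otimes>\<^sub>M N)"
proof (rule measurable_compose_countable[of "\<lambda>p z. G p (j (snd z))" _ _ "\<lambda>z. i (fst z)"])
  show "(\<lambda>z. G p (j (snd z))) \<in> borel_measurable (M \<Otimes>\<^sub>M N)" for p
    by (rule measurable_compose_countable[of "\<lambda>q z. G p q" _ _ "\<lambda>z. j (snd z)"]) measurable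
qed measurable

text \<open>A graphon without the standard Borel condition, so that pullbacks along a
  parametrization are instances as well.\<close>

locale kernel = prob_space M for M :: "'a measure" +
  fixes W :: "'a \<Rightarrow> 'a \<Rightarrow> real"
  assumes W_measurable [measurable]: "case_prod W \<in> borel_measurable (M \<Otimes>\<^sub>M M)"
    and W_sym: "\<And>x y. x \<in> space M \<Longrightarrow> y \<in> space M \<Longrightarrow> W x y = W y x"
    and W_nonneg: "\<And>x y. x \<in> space M \<Longrightarrow> y \<in> space M \<Longrightarrow> 0 \<le> W x y"
    and W_le_1: "\<And>x y. x \<in> space M \<Longrightarrow> y \<in> space M \<Longrightarrow> W x y \<le> 1"
begin

sublocale PP: pair_prob_space M M by unfold_locales

abbreviation MM :: "('a \<times> 'a) measure" where "MM \<equiv> M \<Otimes>\<^sub>M M"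

lemma W_bounds: "z \<in> space MM \<Longrightarrow> 0 \<le> case_prod W z" "z \<in> space MM \<Longrightarrow> case_prod W z \<le> 1"
  using W_nonneg W_le_1 by (auto simp: space_pair_measure)

lemma integrable_bounded:
  fixes f :: "'a \<times> 'a \<Rightarrow> real"
  assumes "f \<in> borel_measurable MM" "\<And>z. z \<in> space MM \<Longrightarrow> \<bar>f z\<bar> \<le> c"
  shows "integrable MM f"
  using assms by (intro PP.integrable_const_bound[of _ c] AE_I2) auto

lemma integrable_W_indicator:
  assumes [measurable]: "A \<in> sets MM"
  shows "integrable MM (\<lambda>z. case_prod W z * indicator A z)"
proof (intro integrable_bounded[of _ 1])
  show "\<bar>case_prod W z * indicator A z\<bar> \<le> 1" if "z \<in> space MM" for z
    using W_bounds[OF that] by (simp add: indicator_def)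
qed measurable

lemma integral_indicator_Times:
  assumes "A \<in> sets M" "B \<in> sets M"
  shows "(\<integral>z. indicator (A \<times> B) z \<partial>MM) = measure M A * measure M B"
  using assms by (simp add: measure_def emeasure_pair_measure_Times enn2real_mult)

abbreviation cell :: "('a \<Rightarrow> nat) \<Rightarrow> nat \<Rightarrow> 'a set" where
  "cell i p \<equiv> {x \<in> space M. i x = p}"

text \<open>These are the values of the conditional expectation of W on the products of cells. If a
  cell is null, division by zero yields 0, which keeps the averages in [0,1].\<close>

definition avg :: "('a \<Rightarrow> nat) \<Rightarrow> nat \<Rightarrow> nat \<Rightarrow> real" where
  "avg i p q = (\<integral>z. case_prod W z * indicator (cell i p \<times> cell i q) z \<partial>MM) /
     (measure M (cell i p) * measure M (cell i q))"

definition step :: "('a \<Rightarrow> nat) \<Rightarrow> 'a \<times> 'a \<Rightarrow> real" where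
  "step i z = avg i (i (fst z)) (i (snd z))"

text \<open>A partition into at most \<open>k\<close> measurable cells, coded by a function to the
  numbers so that refinements become arithmetic.\<close>

definition index :: "nat \<Rightarrow> ('a \<Rightarrow> nat) \<Rightarrow> bool" where
  "index k i \<longleftrightarrow> i \<in> measurable M (count_space UNIV) \<and> (\<forall>x\<in>space M. i x < k)"

lemma cell_sets:
  assumes "index k i"
  shows "cell i p \<in> sets M"
proof -
  have [measurable]: "i \<in> measurable M (count_space UNIV)" using assms by (simp add: index_def)
  show ?thesis by measurable
qed

lemma integral_step_expand:
  fixes \<Phi> :: "'a \<times> 'a \<Rightarrow> real" and G :: "nat \<Rightarrow> nat \<Rightarrow> real"
  assumes i: "index k i" and \<Phi>: "\<Phi> \<in> borel_measurable MM" "\<And>z. z \<in> space MM \<Longrightarrow> \<bar>\<Phi> z\<bar> \<le> c"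
  shows "(\<integral>z. \<Phi> z * G (i (fst z)) (i (snd z)) \<partial>MM) =
    (\<Sum>p<k. \<Sum>q<k. G p q * (\<integral>z. \<Phi> z * indicator (cell i p \<times> cell i q) z \<partial>MM))"
proof -
  have [measurable]: "cell i p \<in> sets M" for p using i by (rule cell_sets)
  note [measurable] = \<Phi>(1)
  have int: "integrable MM (\<lambda>z. \<Phi> z * indicator (cell i p \<times> cell i q) z)" for p q
    by (rule integrable_bounded[of _ c]) (use \<Phi>(2) in \<open>auto simp: indicator_def intro: order_trans[OF abs_ge_zero]\<close>)
  have "(\<integral>z. \<Phi> z * G (i (fst z)) (i (snd z)) \<partial>MM) =
      (\<integral>z. (\<Sum>p<k. \<Sum>q<k. G p q * (\<Phi> z * indicator (cell i p \<times> cell i q) z)) \<partial>MM)"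
  proof (rule Bochner_Integration.integral_cong[OF refl])
    fix z assume z: "z \<in> space MM"
    then have z': "fst z \<in> space M" "snd z \<in> space M" by (auto simp: space_pair_measure)
    then have lt: "i (fst z) < k" "i (snd z) < k" using i by (auto simp: index_def)
    have "G p q * (\<Phi> z * indicator (cell i p \<times> cell i q) z) =
        (if p = i (fst z) then if q = i (snd z) then G p q * \<Phi> z else 0 else 0)" for p q
      using z' by (cases z) (auto simp: indicator_def)
    then have "(\<Sum>q<k. G p q * (\<Phi> z * indicator (cell i p \<times> cell i q) z)) =
        (if p = i (fst z) then G p (i (snd z)) * \<Phi> z else 0)" for p
      using lt by simp
    then have "(\<Sum>p<k. \<Sum>q<k. G p q * (\<Phi> z * indicator (cell i p \<times> cell i q) z)) =
        \<Phi> z * G (i (fst z)) (i (snd z))"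
      using lt by simp
    then show "\<Phi> z * G (i (fst z)) (i (snd z)) =
      (\<Sum>p<k. \<Sum>q<k. G p q * (\<Phi> z * indicator (cell i p \<times> cell i q) z))" by simp
  qed
  also have "\<dots> = (\<Sum>p<k. \<Sum>q<k. G p q * (\<integral>z. \<Phi> z * indicator (cell i p \<times> cell i q) z \<partial>MM))"
    using int by (simp add: Bochner_Integration.integral_sum integrable_sum)
  finally show ?thesis .
qed

lemma W_cell_le:
  assumes i: "index k i"
  shows "0 \<le> (\<integral>z. case_prod W z * indicator (cell i p \<times> cell i q) z \<partial>MM)"
    and "(\<integral>z. case_prod W z * indicator (cell i p \<times> cell i q) z \<partial>MM)
         \<le> measure M (cell i p) * measure M (cell i q)"
proof -
  have [measurable]: "cell i p \<in> sets M" for p using i by (rule cell_sets)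
  show "0 \<le> (\<integral>z. case_prod W z * indicator (cell i p \<times> cell i q) z \<partial>MM)"
    using W_bounds by (intro integral_nonneg_AE AE_I2) auto
  have "(\<integral>z. case_prod W z * indicator (cell i p \<times> cell i q) z \<partial>MM)
      \<le> (\<integral>z. indicator (cell i p \<times> cell i q) z \<partial>MM)"
    using W_bounds
    by (intro integral_mono integrable_W_indicator integrable_bounded[of _ 1])
      (auto simp: indicator_def mult_le_one split: prod.splits)
  also have "\<dots> = measure M (cell i p) * measure M (cell i q)"
    by (intro integral_indicator_Times) measurable
  finally show "(\<integral>z. case_prod W z * indicator (cell i p \<times> cell i q) z \<partial>MM)
         \<le> measure M (cell i p) * measure M (cell i q)" .
qed

lemma avg_bounds: "index k i \<Longrightarrow> 0 \<le> avg i p q" "index k i \<Longrightarrow> avg i p q \<le> 1"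
  unfolding avg_def using W_cell_le[of k i p q]
  by (auto intro!: divide_nonneg_nonneg simp: divide_le_eq_1 less_le)

lemma avg_sym:
  assumes "index k i"
  shows "avg i p q = avg i q p"
proof -
  have [measurable]: "cell i p \<in> sets M" for p using assms by (rule cell_sets)
  have "(\<integral>z. case_prod W z * indicator (cell i p \<times> cell i q) z \<partial>MM) =
     (\<integral>(x, y). case_prod W (y, x) * indicator (cell i p \<times> cell i q) (y, x) \<partial>MM)"
    by (rule PP.integral_product_swap[symmetric]) measurable
  also have "\<dots> = (\<integral>z. case_prod W z * indicator (cell i q \<times> cell i p) z \<partial>MM)"
    by (rule Bochner_Integration.integral_cong[OF refl])
      (auto simp: space_pair_measure W_sym indicator_def)
  finally show ?thesis by (simp add: avg_def mult.commute)
qed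

lemma step_bounds: "index k i \<Longrightarrow> 0 \<le> step i z" "index k i \<Longrightarrow> step i z \<le> 1"
  unfolding step_def by (auto intro: avg_bounds)

lemma measurable_index_fun:
  assumes "index k i"
  shows "(\<lambda>z. G (i (fst z)) (i (snd z)) :: real) \<in> borel_measurable MM"
  using assms unfolding index_def by (intro measurable_step) auto

lemma measurable_step_W: "index k i \<Longrightarrow> step i \<in> borel_measurable MM"
  unfolding step_def[abs_def] by (rule measurable_index_fun)

lemma step_orthogonal:
  assumes i: "index k i"
  shows "(\<integral>z. (case_prod W z - step i z) * G (i (fst z)) (i (snd z)) \<partial>MM) = 0"
proof -
  have [measurable]: "cell i p \<in> sets M" for p using i by (rule cell_sets)
  note [measurable] = measurable_step_W[OF i]
  have zero: "(\<integral>z. (case_prod W z - step i z) * indicator (cell i p \<times> cell i q) z \<partial>MM) = 0" for p q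
  proof -
    have "(\<integral>z. (case_prod W z - step i z) * indicator (cell i p \<times> cell i q) z \<partial>MM) =
       (\<integral>z. case_prod W z * indicator (cell i p \<times> cell i q) z - avg i p q * indicator (cell i p \<times> cell i q) z \<partial>MM)"
      by (rule Bochner_Integration.integral_cong[OF refl]) (auto simp: indicator_def step_def)
    also have "\<dots> = (\<integral>z. case_prod W z * indicator (cell i p \<times> cell i q) z \<partial>MM) -
        (\<integral>z. avg i p q * indicator (cell i p \<times> cell i q) z \<partial>MM)"
      by (intro Bochner_Integration.integral_diff integrable_W_indicator integrable_bounded[of _ "\<bar>avg i p q\<bar>"])
        (auto simp: indicator_def)
    also have "(\<integral>z. avg i p q * indicator (cell i p \<times> cell i q) z \<partial>MM) =
        avg i p q * (measure M (cell i p) * measure M (cell i q))"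
      by (simp only: integral_mult_right_zero integral_indicator_Times cell_sets[OF i])
    \<comment> \<open>If one of the two cells is null, \<open>W_cell_le\<close> makes the integral
      vanish, in agreement with the convention in \<open>avg\<close>.\<close>
    also have "\<dots> = (\<integral>z. case_prod W z * indicator (cell i p \<times> cell i q) z \<partial>MM)"
      using W_cell_le[OF i, of p q] by (auto simp: avg_def)
    finally show ?thesis by simp
  qed
  have "\<bar>case_prod W z - step i z\<bar> \<le> 1" if "z \<in> space MM" for z
    using W_bounds[OF that] step_bounds[OF i, of z] by linarith
  then show ?thesis by (subst integral_step_expand[OF i, of _ 1]) (auto simp: zero)
qed

text \<open>The orthogonality of \<open>W - step i\<close> to the functions of the index makes the energies of a partition and
  of a refinement differ by the squared distance of the two step functions.\<close>

lemma energy_increment: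
  assumes i: "index k i" and S: "S \<in> sets M" and T: "T \<in> sets M" and "0 < \<epsilon>"
    and large: "\<epsilon> < \<bar>\<integral>z. (case_prod W z - step i z) * indicator (S \<times> T) z \<partial>MM\<bar>"
  shows "\<exists>j. index (4 * k) j \<and> (\<integral>z. (step i z)\<^sup>2 \<partial>MM) + \<epsilon>\<^sup>2 \<le> (\<integral>z. (step j z)\<^sup>2 \<partial>MM)"
proof -
  \<comment> \<open>The two bits of \<open>b\<close> record membership in S and in T; the refined
    index i + k b is decoded by \<open>mod\<close> and \<open>div\<close>.\<close>
  define b where "b x = (if x \<in> S then 1 else 0) + (if x \<in> T then 2 else (0::nat))" for x
  define j where "j x = i x + k * b x" for x
  have b4: "b x \<le> 3" for x by (simp add: b_def)
  have [measurable]: "i \<in> measurable M (count_space UNIV)" using i by (simp add: index_def)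
  note [measurable] = S T
  have "b \<in> measurable M (count_space UNIV)" unfolding b_def by measurable
  then have "j \<in> measurable M (count_space UNIV)" unfolding j_def[abs_def] by measurable
  moreover have "j x < 4 * k" if "x \<in> space M" for x
  proof -
    have "k * b x \<le> k * 3" using b4 by (rule mult_left_mono) simp
    moreover have "i x < k" using i that by (simp add: index_def)
    ultimately show ?thesis unfolding j_def by linarith
  qed
  ultimately have j: "index (4 * k) j" by (simp add: index_def)
  have dec: "i x = j x mod k" "b x = j x div k" if "x \<in> space M" for x
    using that i by (auto simp: j_def index_def)
  have Sb: "x \<in> S \<longleftrightarrow> odd (b x)" and Tb: "x \<in> T \<longleftrightarrow> 2 \<le> b x" for x by (auto simp: b_def)
  define u where "u = step i"
  define v where "v = step j"
  define w where "w = case_prod W"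
  define \<theta> :: "'a \<times> 'a \<Rightarrow> real" where "\<theta> = indicator (S \<times> T)"
  have [measurable]: "u \<in> borel_measurable MM" "v \<in> borel_measurable MM" "w \<in> borel_measurable MM"
    "\<theta> \<in> borel_measurable MM"
    using measurable_step_W[OF i] measurable_step_W[OF j] by (auto simp: u_def v_def w_def \<theta>_def)
  have bnd: "\<bar>u z\<bar> \<le> 1" "\<bar>v z\<bar> \<le> 1" "\<bar>\<theta> z\<bar> \<le> 1" for z
    using step_bounds[OF i, of z] step_bounds[OF j, of z] by (auto simp: u_def v_def \<theta>_def indicator_def)
  have bndw: "\<bar>w z\<bar> \<le> 1" if "z \<in> space MM" for z
    using W_bounds[OF that] by (simp add: w_def)
  have int: "integrable MM (\<lambda>z. f z * g z)"
    if "f \<in> {u, v, w, \<theta>}" "g \<in> {u, v, w, \<theta>}" for f g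
    using that bnd bndw by (intro integrable_bounded[of _ 1]) (auto simp: abs_mult intro!: mult_le_one)
  define L where "L f g = (\<integral>z. f z * g z \<partial>MM)" for f g :: "'a \<times> 'a \<Rightarrow> real"
  have orth: "L w g = L v g" if "g \<in> {u, v, \<theta>}" "\<And>z. z \<in> space MM \<Longrightarrow> g z = G (j (fst z)) (j (snd z))" for g G
  proof -
    have "L w g - L v g = (\<integral>z. (w z - v z) * g z \<partial>MM)"
      unfolding L_def using int that(1) by (subst Bochner_Integration.integral_diff[symmetric]) (auto simp: algebra_simps)
    also have "\<dots> = (\<integral>z. (case_prod W z - step j z) * G (j (fst z)) (j (snd z)) \<partial>MM)"
      using that(2) by (intro Bochner_Integration.integral_cong refl) (simp add: w_def v_def)
    finally show ?thesis using step_orthogonal[OF j] by simp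
  qed
  have wu: "L w u = L v u"
    by (rule orth[of u "\<lambda>p q. avg i (p mod k) (q mod k)"])
      (auto simp: u_def step_def space_pair_measure dec(1)[symmetric])
  have wchi: "L w \<theta> = L v \<theta>"
    by (rule orth[of \<theta> "\<lambda>p q. of_bool (odd (p div k) \<and> 2 \<le> q div k)"])
      (auto simp: \<theta>_def indicator_def space_pair_measure dec(2)[symmetric] Sb Tb)
  have wu': "L w u = L u u"
  proof -
    have "L w u - L u u = (\<integral>z. (w z - u z) * u z \<partial>MM)"
      unfolding L_def using int by (subst Bochner_Integration.integral_diff[symmetric]) (auto simp: algebra_simps)
    also have "\<dots> = 0"
      using step_orthogonal[OF i, of "avg i"] by (simp add: w_def u_def step_def)
    finally show ?thesis by simp
  qed
  define c where "c = L w \<theta> - L u \<theta>"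
  have "c = (\<integral>z. (w z - u z) * \<theta> z \<partial>MM)"
    unfolding c_def L_def using int by (subst Bochner_Integration.integral_diff[symmetric]) (auto simp: algebra_simps)
  then have "\<epsilon> < \<bar>c\<bar>" using large by (simp add: w_def u_def \<theta>_def)
  then have "\<epsilon>\<^sup>2 \<le> c\<^sup>2" using \<open>0 < \<epsilon>\<close> by (metis abs_of_pos less_imp_le power2_abs power_mono)
  \<comment> \<open>Expand the squared norm of v - u - c \<theta>. The inner product of v and u is
    the squared norm of u, that of v - u and \<theta> is c, and \<theta> has norm at most 1; so the
    squared norm of v exceeds that of u by at least c^2.\<close>
  moreover have "0 \<le> (\<integral>z. (v z - u z - c * \<theta> z)\<^sup>2 \<partial>MM)" by (intro integral_nonneg_AE AE_I2) simp
  moreover have "(\<integral>z. (v z - u z - c * \<theta> z)\<^sup>2 \<partial>MM) =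
     (\<integral>z. v z * v z + u z * u z + c\<^sup>2 * (\<theta> z * \<theta> z) - 2 * (v z * u z) - 2 * c * (v z * \<theta> z) + 2 * c * (u z * \<theta> z) \<partial>MM)"
    by (intro Bochner_Integration.integral_cong refl) (simp add: power2_eq_square algebra_simps)
  moreover have "\<dots> = L v v + L u u + c\<^sup>2 * L \<theta> \<theta> - 2 * L v u - 2 * c * L v \<theta> + 2 * c * L u \<theta>"
    unfolding L_def using int by simp
  moreover have "L \<theta> \<theta> \<le> (\<integral>z. 1 \<partial>MM)"
    unfolding L_def by (intro integral_mono int) (auto simp: \<theta>_def indicator_def)
  then have "c\<^sup>2 * L \<theta> \<theta> \<le> c\<^sup>2 * 1" by (intro mult_left_mono) (auto simp: PP.prob_space)
  moreover have "2 * c * L v \<theta> - 2 * c * L u \<theta> = 2 * c\<^sup>2"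
    using wchi by (simp add: c_def power2_eq_square algebra_simps)
  ultimately have "L u u + \<epsilon>\<^sup>2 \<le> L v v" using wu wu' by linarith
  then show ?thesis using j by (intro exI[of _ j]) (simp add: L_def u_def v_def power2_eq_square)
qed

text \<open>The energy lies in [0,1] and every violated cut raises it by \<epsilon>^2, so there are
  fewer than t refinements, each multiplying the number of cells by four. The bound 4^t is the same
  for all kernels.\<close>

lemma weak_regularity:
  assumes "0 < \<epsilon>" "1 < real t * \<epsilon>\<^sup>2"
  shows "\<exists>k i. k \<le> 4 ^ t \<and> index k i \<and>
    (\<forall>S\<in>sets M. \<forall>T\<in>sets M. \<bar>\<integral>z. (case_prod W z - step i z) * indicator (S \<times> T) z \<partial>MM\<bar> \<le> \<epsilon>)"
proof (rule ccontr)
  assume no: "\<not> ?thesis"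
  have "\<exists>k i. k \<le> 4 ^ s \<and> index k i \<and> real s * \<epsilon>\<^sup>2 \<le> (\<integral>z. (step i z)\<^sup>2 \<partial>MM)" if "s \<le> t" for s
    using that
  proof (induction s)
    case 0
    have "index 1 (\<lambda>_. 0)" by (simp add: index_def)
    then show ?case by (intro exI[of _ 1] exI[of _ "\<lambda>_. 0"]) auto
  next
    case (Suc s)
    then obtain k i where ki: "k \<le> 4 ^ s" "index k i" "real s * \<epsilon>\<^sup>2 \<le> (\<integral>z. (step i z)\<^sup>2 \<partial>MM)" by auto
    have "k \<le> 4 ^ t" using ki(1) Suc.prems power_increasing[of s t "4::nat"] by linarith
    then obtain S T where ST: "S \<in> sets M" "T \<in> sets M"
      "\<epsilon> < \<bar>\<integral>z. (case_prod W z - step i z) * indicator (S \<times> T) z \<partial>MM\<bar>"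
      using no ki(2) by (meson not_le)
    obtain j where "index (4 * k) j" "(\<integral>z. (step i z)\<^sup>2 \<partial>MM) + \<epsilon>\<^sup>2 \<le> (\<integral>z. (step j z)\<^sup>2 \<partial>MM)"
      using energy_increment[OF ki(2) ST(1,2) assms(1) ST(3)] by blast
    then show ?case using ki by (intro exI[of _ "4 * k"] exI[of _ j]) (auto simp: algebra_simps)
  qed
  then obtain k i where ki: "index k i" "real t * \<epsilon>\<^sup>2 \<le> (\<integral>z. (step i z)\<^sup>2 \<partial>MM)" by blast
  have [measurable]: "step i \<in> borel_measurable MM" by (rule measurable_step_W[OF ki(1)])
  have le1: "(step i z)\<^sup>2 \<le> 1" for z using step_bounds[OF ki(1), of z] by (simp add: power_le_one)
  then have "(\<integral>z. (step i z)\<^sup>2 \<partial>MM) \<le> (\<integral>z. 1 \<partial>MM)"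
    by (intro integral_mono integrable_bounded[of _ 1]) auto
  then show False using ki(2) assms(2) by (simp add: PP.prob_space)
qed

end

section \<open>Degrees and approximation by regular graphs\<close>

lemma AE_pair_fst:
  assumes "prob_space N" "AE x in M. P x"
  shows "AE z in M \<Otimes>\<^sub>M N. P (fst z)"
proof -
  interpret N: prob_space N by fact
  obtain X where X: "{x \<in> space M. \<not> P x} \<subseteq> X" "emeasure M X = 0" "X \<in> sets M"
    using assms(2) by (rule AE_E)
  have "emeasure (M \<Otimes>\<^sub>M N) (X \<times> space N) = 0"
    using X by (simp add: N.emeasure_pair_measure_Times)
  then show ?thesis
    using X by (intro AE_I[of _ _ "X \<times> space N"]) (auto simp: space_pair_measure)
qed

lemma AE_pair_snd:
  assumes "prob_space N" "AE y in N. P y"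
  shows "AE z in M \<Otimes>\<^sub>M N. P (snd z)"
proof -
  interpret N: prob_space N by fact
  obtain X where X: "{x \<in> space N. \<not> P x} \<subseteq> X" "emeasure N X = 0" "X \<in> sets N"
    using assms(2) by (rule AE_E)
  have "emeasure (M \<Otimes>\<^sub>M N) (space M \<times> X) = 0"
    using X by (simp add: N.emeasure_pair_measure_Times)
  then show ?thesis
    using X by (intro AE_I[of _ _ "space M \<times> X"]) (auto simp: space_pair_measure)
qed

lemma measure_preserving_pair:
  assumes "measure_preserving M N f" "prob_space N"
  shows "(\<lambda>z. (f (fst z), f (snd z))) \<in> measurable (M \<Otimes>\<^sub>M M) (N \<Otimes>\<^sub>M N)"
    and "distr (M \<Otimes>\<^sub>M M) (N \<Otimes>\<^sub>M N) (\<lambda>z. (f (fst z), f (snd z))) = N \<Otimes>\<^sub>M N"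
proof -
  have f [measurable]: "f \<in> measurable M N" and d: "distr M N f = N"
    using assms(1) by (auto simp: measure_preserving_def)
  show "(\<lambda>z. (f (fst z), f (snd z))) \<in> measurable (M \<Otimes>\<^sub>M M) (N \<Otimes>\<^sub>M N)" by measurable
  show "distr (M \<Otimes>\<^sub>M M) (N \<Otimes>\<^sub>M N) (\<lambda>z. (f (fst z), f (snd z))) = N \<Otimes>\<^sub>M N"
    using pair_measure_distr[OF f f] d assms(2) by (simp add: split_def prob_space_imp_sigma_finite)
qed

lemma AE_measure_preserving_pair:
  assumes f: "measure_preserving M N f" and N: "prob_space N"
    and AE: "AE z in N \<Otimes>\<^sub>M N. P z"
  shows "AE z in M \<Otimes>\<^sub>M M. P (f (fst z), f (snd z))"
  by (rule AE_distrD[OF measure_preserving_pair(1)[OF f N]])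
    (simp only: measure_preserving_pair(2)[OF f N] AE)

lemma AE_measure_preserving_pair_iff:
  fixes V :: "'b \<Rightarrow> 'b \<Rightarrow> real"
  assumes f: "measure_preserving M N f" and N: "prob_space N"
    and [measurable]: "case_prod V \<in> borel_measurable (N \<Otimes>\<^sub>M N)"
    and AE: "AE z in M \<Otimes>\<^sub>M M. V (f (fst z)) (f (snd z)) = d"
  shows "AE z in N \<Otimes>\<^sub>M N. V (fst z) (snd z) = d"
proof -
  have "AE z in distr (M \<Otimes>\<^sub>M M) (N \<Otimes>\<^sub>M N) (\<lambda>z. (f (fst z), f (snd z))). case_prod V z = d"
    using AE by (subst AE_distr_iff[OF measure_preserving_pair(1)[OF f N]]) auto
  then show ?thesis
    unfolding measure_preserving_pair(2)[OF f N] by (simp add: split_def)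
qed

lemma subalgebra_pair:
  assumes "sigma_algebra (space M) C" "C \<subseteq> sets M"
  shows "subalgebra (M \<Otimes>\<^sub>M M) (sigma (space M) C \<Otimes>\<^sub>M sigma (space M) C)"
proof -
  have "sets (sigma (space M) C) = C"
    using assms(1) by (rule sigma_algebra.sets_measure_of_eq)
  then show ?thesis
    unfolding subalgebra_def sets_pair_measure using assms(2)
    by (auto simp: space_pair_measure space_measure_of_conv intro!: sigma_sets_mono')
qed

text \<open>The constant graphon is its own conditional expectation, so its quotient equals d almost
  everywhere. The isomorphism carries this to the quotient of W, and the quotient map carries it
  back to the conditional expectation of W.\<close>

lemma fractionally_isomorphic_const_degree:
  assumes "graphon M W" "0 \<le> d" "d \<le> 1" and frac: "fractionally_isomorphic M W M (const_graphon d)"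
  shows "AE x in M. (\<integral>y. W x y \<partial>M) = d"
proof -
  have "prob_space M" and W [measurable]: "case_prod W \<in> borel_measurable (M \<Otimes>\<^sub>M M)"
    and Wb: "\<And>x y. x \<in> space M \<Longrightarrow> y \<in> space M \<Longrightarrow> W x y = W y x \<and> 0 \<le> W x y \<and> W x y \<le> 1"
    using assms(1) by (auto simp: graphon_def standard_prob_space_def)
  then interpret kernel M W unfolding kernel_def kernel_axioms_def by blast
  define C where "C = min_invariant_algebra M W"
  define C' where "C' = min_invariant_algebra M (const_graphon d :: 'a \<Rightarrow> 'a \<Rightarrow> real)"
  let ?F = "sigma (space M) C" and ?F' = "sigma (space M) C'"
  obtain M' :: "real measure" and p W' and N' :: "real measure" and q U'
    where Q: "quotient_graphon M W C M' p W'" "quotient_graphon M (const_graphon d) C' N' q U'"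
      and iso: "graphon_iso M' W' N' U'"
    using frac unfolding fractionally_isomorphic_def C_def C'_def by blast
  have prob: "prob_space M'" "prob_space N'"
    and meas [measurable]: "case_prod W' \<in> borel_measurable (M' \<Otimes>\<^sub>M M')" "case_prod U' \<in> borel_measurable (N' \<Otimes>\<^sub>M N')"
    and mp: "measure_preserving M M' p" "measure_preserving M N' q"
    using Q by (simp_all add: quotient_graphon_def quotient_space_def graphon_def standard_prob_space_def)
  have inv: "invariant_algebra M W C"
    unfolding C_def by (rule min_invariant_algebra(1)[OF assms(1)])
  then have C: "sigma_algebra (space M) C" "C \<subseteq> sets M"
    by (auto simp: invariant_algebra_def relatively_complete_def)
  have U'_eq: "AE z in N' \<Otimes>\<^sub>M N'. U' (fst z) (snd z) = d"
  proof -
    have "graphon M (const_graphon d)"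
      using assms(1-3) by (auto simp: graphon_def const_graphon_def split_def)
    then have "invariant_algebra M (const_graphon d) C'"
      unfolding C'_def by (rule min_invariant_algebra(1))
    then have "subalgebra MM (?F' \<Otimes>\<^sub>M ?F')"
      by (intro subalgebra_pair) (auto simp: invariant_algebra_def relatively_complete_def)
    then interpret F': finite_measure_subalgebra MM "?F' \<Otimes>\<^sub>M ?F'" by unfold_locales
    have "AE z in MM. real_cond_exp MM (?F' \<Otimes>\<^sub>M ?F') (case_prod (const_graphon d)) z = case_prod (const_graphon d) z"
      by (intro F'.real_cond_exp_F_meas) (auto simp: const_graphon_def split_def)
    moreover have "AE z in MM. U' (q (fst z)) (q (snd z)) = real_cond_exp MM (?F' \<Otimes>\<^sub>M ?F') (case_prod (const_graphon d)) z"
      using Q(2) unfolding quotient_graphon_def by (simp add: split_def)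
    ultimately have "AE z in MM. U' (q (fst z)) (q (snd z)) = d"
      by eventually_elim (simp add: const_graphon_def split_def)
    then show ?thesis by (rule AE_measure_preserving_pair_iff[OF mp(2) prob(2) meas(2)])
  qed
  obtain f where f: "measure_preserving N' M' f" "AE z in N' \<Otimes>\<^sub>M N'. W' (f (fst z)) (f (snd z)) = U' (fst z) (snd z)"
    using iso unfolding graphon_iso_def measure_preserving_bij_def pullback_def by (auto simp: split_def)
  have "AE z in N' \<Otimes>\<^sub>M N'. W' (f (fst z)) (f (snd z)) = d"
    using f(2) U'_eq by eventually_elim simp
  then have "AE z in M' \<Otimes>\<^sub>M M'. W' (fst z) (snd z) = d"
    by (rule AE_measure_preserving_pair_iff[OF f(1) prob(1) meas(1)])
  from AE_measure_preserving_pair[OF mp(1) prob(1) this]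
  have W'p: "AE z in MM. W' (p (fst z)) (p (snd z)) = d" by simp
  interpret F: finite_measure_subalgebra MM "?F \<Otimes>\<^sub>M ?F"
    using subalgebra_pair[OF C] by unfold_locales
  have "AE z in MM. W' (p (fst z)) (p (snd z)) = real_cond_exp MM (?F \<Otimes>\<^sub>M ?F) (case_prod W) z"
    using Q(1) unfolding quotient_graphon_def by (simp add: split_def)
  then have cond: "AE z in MM. real_cond_exp MM (?F \<Otimes>\<^sub>M ?F) (case_prod W) z = d"
    using W'p by eventually_elim simp
  have setsF: "sets ?F = C" using C(1) by (rule sigma_algebra.sets_measure_of_eq)
  have subF: "subalgebra M ?F" using C setsF by (simp add: subalgebra_def space_measure_of_conv)
  interpret F1: finite_measure_subalgebra M ?F using subF by unfold_locales
  define T where "T x = (\<integral>y. W x y \<partial>M)" for x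
  \<comment> \<open>The degree function is the operator of W applied to 1, so invariance of
    \<open>C\<close> makes it \<open>C\<close>-measurable.\<close>
  have "(\<lambda>_. 1) \<in> borel_measurable ?F" by simp
  then have "graphon_op M W (\<lambda>_. 1) \<in> borel_measurable ?F"
    using inv unfolding invariant_algebra_def by simp
  then have TF: "T \<in> borel_measurable ?F" by (simp add: graphon_op_def T_def[abs_def])
  have T_le: "\<bar>T x\<bar> \<le> 1" if "x \<in> space M" for x
  proof -
    have [measurable]: "W x \<in> borel_measurable M" using that W by measurable
    have "integrable M (W x)"
      using Wb that by (intro integrable_const_bound[of _ 1] AE_I2) auto
    then have "T x \<le> (\<integral>y. 1 \<partial>M)" unfolding T_def using Wb that by (intro integral_mono) auto
    moreover have "0 \<le> T x" unfolding T_def using Wb that by (intro integral_nonneg_AE AE_I2) auto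
    ultimately show ?thesis by (simp add: prob_space)
  qed
  have T_int: "integrable M T"
    using T_le measurable_from_subalg[OF subF TF] by (intro integrable_const_bound[of _ 1] AE_I2) auto
  \<comment> \<open>As A \<times> space M belongs to the product algebra, W and its conditional
    expectation d have equal integrals over it. By Fubini \<open>T\<close> has the same integrals as
    d over all sets of \<open>C\<close>, which characterizes the conditional expectation of
    d.\<close>
  have "(\<integral>x\<in>A. d \<partial>M) = (\<integral>x\<in>A. T x \<partial>M)" if "A \<in> sets ?F" for A
  proof -
    have A [measurable]: "A \<in> sets M" using that setsF C by auto
    have "space M \<in> sets ?F" using sets.top[of ?F] by (simp add: space_measure_of_conv)
    then have AF: "A \<times> space M \<in> sets (?F \<Otimes>\<^sub>M ?F)" using that by (intro pair_measureI)
    have intW: "integrable MM (case_prod W)"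
      using W_bounds by (intro integrable_bounded[of _ 1]) auto
    have "(\<integral>x\<in>A. T x \<partial>M) = (\<integral>x. (\<integral>y. indicator (A \<times> space M) (x, y) * case_prod W (x, y) \<partial>M) \<partial>M)"
      unfolding set_lebesgue_integral_def T_def
      by (intro Bochner_Integration.integral_cong refl) (auto simp: indicator_def cong: Bochner_Integration.integral_cong)
    also have "\<dots> = (\<integral>z. indicator (A \<times> space M) z * case_prod W z \<partial>MM)"
      using integrable_W_indicator[of "A \<times> space M"] by (intro PP.integral_fst') (simp add: mult.commute)
    also have "\<dots> = (\<integral>z\<in>A \<times> space M. case_prod W z \<partial>MM)"
      by (simp add: set_lebesgue_integral_def)
    also have "\<dots> = (\<integral>z\<in>A \<times> space M. real_cond_exp MM (?F \<Otimes>\<^sub>M ?F) (case_prod W) z \<partial>MM)"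
      by (rule F.real_cond_exp_intA[OF intW AF])
    also have "\<dots> = (\<integral>z\<in>A \<times> space M. d \<partial>MM)"
      unfolding set_lebesgue_integral_def using cond
      by (intro integral_cong_AE) (auto elim!: eventually_mono)
    also have "\<dots> = d * measure M A"
      using integral_indicator_Times[OF A sets.top] by (simp add: set_lebesgue_integral_def prob_space)
    also have "\<dots> = (\<integral>x\<in>A. d \<partial>M)" by (simp add: set_lebesgue_integral_def)
    finally show ?thesis by simp
  qed
  then have "AE x in M. real_cond_exp M ?F (\<lambda>_. d) x = T x"
    by (intro F1.real_cond_exp_charact TF T_int) auto
  moreover have "AE x in M. real_cond_exp M ?F (\<lambda>_. d) x = d" by (intro F1.real_cond_exp_F_meas) auto
  ultimately show ?thesis unfolding T_def by eventually_elim simp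
qed

section \<open>From cuts by measurable sets to cuts by sets of vertices\<close>

lemma exists_maximizing_subset:
  fixes x s :: "'v \<Rightarrow> real"
  assumes "finite V" "\<And>v. v \<in> V \<Longrightarrow> 0 \<le> s v \<and> s v \<le> c"
  shows "\<exists>T\<subseteq>V. (\<Sum>v\<in>V. x v * s v) \<le> c * (\<Sum>v\<in>T. x v)"
proof (intro exI conjI)
  let ?T = "{v \<in> V. 0 < x v}"
  have "(\<Sum>v\<in>V. x v * s v) \<le> (\<Sum>v\<in>V. if 0 < x v then c * x v else 0)"
  proof (rule sum_mono)
    fix v assume "v \<in> V"
    then show "x v * s v \<le> (if 0 < x v then c * x v else 0)"
      using assms(2)[of v] by (auto simp: mult.commute[of c] intro: mult_left_mono mult_nonpos_nonneg)
  qed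
  also have "\<dots> = (\<Sum>v\<in>?T. c * x v)"
    by (rule sum.inter_filter[OF assms(1), symmetric])
  also have "\<dots> = c * (\<Sum>v\<in>?T. x v)"
    by (simp only: sum_distrib_left)
  finally show "(\<Sum>v\<in>V. x v * s v) \<le> c * (\<Sum>v\<in>?T. x v)" .
qed auto

text \<open>A bilinear form on a box is largest at a vertex: first one argument, then the other, is
  moved to the endpoints 0 and c. With the measures of S and T inside each block as arguments, this
  reduces arbitrary measurable S and T to unions of blocks.\<close>

lemma bilinear_le_cut:
  fixes F :: "'v \<Rightarrow> 'v \<Rightarrow> real"
  assumes V: "finite V" and "0 \<le> c"
    and cut: "\<And>S T. S \<subseteq> V \<Longrightarrow> T \<subseteq> V \<Longrightarrow> (\<Sum>u\<in>S. \<Sum>v\<in>T. F u v) \<le> e"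
    and s: "\<And>v. v \<in> V \<Longrightarrow> 0 \<le> s v \<and> s v \<le> c" and t: "\<And>v. v \<in> V \<Longrightarrow> 0 \<le> t v \<and> t v \<le> c"
  shows "(\<Sum>u\<in>V. \<Sum>v\<in>V. F u v * (s u * t v)) \<le> e * c\<^sup>2"
proof -
  obtain T where T: "T \<subseteq> V" "(\<Sum>v\<in>V. (\<Sum>u\<in>V. F u v * s u) * t v) \<le> c * (\<Sum>v\<in>T. \<Sum>u\<in>V. F u v * s u)"
    using exists_maximizing_subset[of V t c "\<lambda>v. \<Sum>u\<in>V. F u v * s u"] V t by auto
  obtain S where S: "S \<subseteq> V" "(\<Sum>u\<in>V. (\<Sum>v\<in>T. F u v) * s u) \<le> c * (\<Sum>u\<in>S. \<Sum>v\<in>T. F u v)"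
    using exists_maximizing_subset[of V s c "\<lambda>u. \<Sum>v\<in>T. F u v"] V s by auto
  have "(\<Sum>u\<in>V. \<Sum>v\<in>V. F u v * (s u * t v)) = (\<Sum>v\<in>V. (\<Sum>u\<in>V. F u v * s u) * t v)"
    by (subst sum.swap) (simp add: sum_distrib_right mult.assoc)
  also note T(2)
  also have "(\<Sum>v\<in>T. \<Sum>u\<in>V. F u v * s u) = (\<Sum>u\<in>V. (\<Sum>v\<in>T. F u v) * s u)"
    by (subst sum.swap) (simp add: sum_distrib_right)
  also have "c * \<dots> \<le> c * (c * (\<Sum>u\<in>S. \<Sum>v\<in>T. F u v))"
    using S(2) \<open>0 \<le> c\<close> by (rule mult_left_mono)
  also have "\<dots> \<le> c * (c * e)"
    using cut[OF S(1) T(1)] \<open>0 \<le> c\<close> by (intro mult_left_mono)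
  finally show ?thesis by (simp add: power2_eq_square algebra_simps)
qed

lemma abs_bilinear_le_cut:
  fixes F :: "'v \<Rightarrow> 'v \<Rightarrow> real"
  assumes V: "finite V" and "0 \<le> c"
    and cut: "\<And>S T. S \<subseteq> V \<Longrightarrow> T \<subseteq> V \<Longrightarrow> \<bar>\<Sum>u\<in>S. \<Sum>v\<in>T. F u v\<bar> \<le> e"
    and s: "\<And>v. v \<in> V \<Longrightarrow> 0 \<le> s v \<and> s v \<le> c" and t: "\<And>v. v \<in> V \<Longrightarrow> 0 \<le> t v \<and> t v \<le> c"
  shows "\<bar>\<Sum>u\<in>V. \<Sum>v\<in>V. F u v * (s u * t v)\<bar> \<le> e * c\<^sup>2"
proof -
  have "(\<Sum>u\<in>V. \<Sum>v\<in>V. F u v * (s u * t v)) \<le> e * c\<^sup>2"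
    by (rule bilinear_le_cut[OF V \<open>0 \<le> c\<close> _ s t]) (use cut in \<open>auto simp: abs_le_iff\<close>)
  moreover have "(\<Sum>u\<in>V. \<Sum>v\<in>V. - F u v * (s u * t v)) \<le> e * c\<^sup>2"
    by (rule bilinear_le_cut[OF V \<open>0 \<le> c\<close> _ s t]) (use cut in \<open>auto simp: abs_le_iff sum_negf\<close>)
  ultimately show ?thesis by (simp add: sum_negf)
qed

lemma prob_space_unit_interval: "prob_space unit_interval"
  unfolding unit_interval_def
  by (auto simp: emeasure_restrict_space space_restrict_space intro!: prob_spaceI)

lemma sets_unit_interval: "S \<in> sets unit_interval \<longleftrightarrow> S \<subseteq> {0..<1} \<and> S \<in> sets borel"
  unfolding unit_interval_def by (subst sets_restrict_space_iff) auto

text \<open>Adding the index to the code of a point sorts the code by the index, so that the quantile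
  parametrization turns the classes of the index into consecutive intervals.\<close>

lemma step_parametrization:
  fixes M :: "'a measure" and i :: "'a \<Rightarrow> nat"
  assumes "prob_space M" "real_retract M"
    and null: "\<And>x. x \<in> space M \<Longrightarrow> emeasure M {x} = 0"
    and i [measurable]: "i \<in> measurable M (count_space UNIV)" and ik: "\<And>x. x \<in> space M \<Longrightarrow> i x < k"
  shows "\<exists>f g m. measure_preserving_bij unit_interval M f \<and> g \<in> borel_measurable M \<and>
    mono_on {0..<1} m \<and> (\<forall>u. m u < k) \<and> (AE u in unit_interval. g (f u) = u \<and> i (f u) = m u)"
proof -
  interpret M: prob_space M by fact
  obtain h :: "'a \<Rightarrow> real" and r where [measurable]: "h \<in> borel_measurable M" "r \<in> measurable borel M"
    and hr: "\<And>x. x \<in> space M \<Longrightarrow> 0 \<le> h x \<and> h x < 1 \<and> r (h x) = x"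
    using assms(2) unfolding real_retract_def by blast
  define h' where "h' x = real (i x) + h x" for x
  \<comment> \<open>The integer part is the index, and the fractional part is the old code.\<close>
  define r' where "r' y = r (y - real_of_int \<lfloor>y\<rfloor>)" for y
  have [measurable]: "h' \<in> borel_measurable M" "r' \<in> measurable borel M"
    unfolding h'_def[abs_def] r'_def[abs_def] by measurable
  have fl: "\<lfloor>h' x\<rfloor> = int (i x)" if "x \<in> space M" for x
    using hr[OF that] by (simp add: h'_def floor_eq_iff)
  have rh': "r' (h' x) = x" if "x \<in> space M" for x
    using hr[OF that] fl[OF that] by (simp add: r'_def h'_def)
  obtain f g Q where f: "measure_preserving_bij unit_interval M f" and g: "g \<in> borel_measurable M"
    and Q: "mono_on {0<..<1} Q" "AE u in unit_interval. g (f u) = u \<and> h' (f u) = Q u"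
    using quantile_parametrization[OF assms(1), of h' r'] rh' null by auto
  have "k > 0" using M.not_empty ik by fastforce
  \<comment> \<open>\<open>Q\<close> is monotone on the open interval only, so 0 receives the least
    value. The minimum with k - 1 enforces the bound also at the exceptional points where
    \<open>m\<close> need not agree with the index.\<close>
  define m where "m u = (if u \<le> 0 then 0 else min (k - 1) (nat \<lfloor>Q u\<rfloor>))" for u
  have "m u < k" for u using \<open>k > 0\<close> by (auto simp: m_def)
  moreover have "mono_on {0..<1} m"
  proof (rule mono_onI)
    fix u v :: real assume uv: "u \<in> {0..<1}" "v \<in> {0..<1}" "u \<le> v"
    show "m u \<le> m v"
    proof (cases "u \<le> 0")
      case False
      then have "Q u \<le> Q v" using uv by (intro mono_onD[OF Q(1)]) auto
      then have "nat \<lfloor>Q u\<rfloor> \<le> nat \<lfloor>Q v\<rfloor>" by (intro nat_mono floor_mono)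
      then show ?thesis using False uv by (auto simp: m_def min_le_iff_disj)
    qed (simp add: m_def)
  qed
  moreover have "AE u in unit_interval. g (f u) = u \<and> i (f u) = m u"
  proof -
    have "AE u in unit_interval. u \<noteq> 0"
      unfolding AE_unit_interval using AE_lborel_singleton[of 0] by eventually_elim simp
    with Q(2) AE_space show ?thesis
    proof eventually_elim
      case (elim u)
      then have fu: "f u \<in> space M"
        using f by (auto simp: measure_preserving_bij_def bij_betw_def)
      have "h' (f u) = Q u" using elim by simp
      then have "\<lfloor>Q u\<rfloor> = int (i (f u))" using fl[OF fu] by simp
      moreover have "0 < u" "g (f u) = u" using elim by auto
      ultimately show ?case using ik[OF fu] by (simp add: m_def)
    qed
  qed
  ultimately show ?thesis using f g by blast
qed

section \<open>Equal blocks of the unit interval and graphs on them\<close>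

definition block_index :: "nat \<Rightarrow> real \<Rightarrow> nat" where
  "block_index n x = nat \<lfloor>real n * x\<rfloor>"

lemma block_index_eq_iff:
  assumes "0 < n" "0 \<le> x"
  shows "block_index n x = p \<longleftrightarrow> real p / real n \<le> x \<and> x < (real p + 1) / real n"
proof -
  have "block_index n x = p \<longleftrightarrow> \<lfloor>real n * x\<rfloor> = int p"
    using assms by (auto simp: block_index_def)
  also have "\<dots> \<longleftrightarrow> real p \<le> real n * x \<and> real n * x < real p + 1"
    by (simp add: floor_eq_iff)
  also have "\<dots> \<longleftrightarrow> real p / real n \<le> x \<and> x < (real p + 1) / real n"
    using assms by (simp add: field_simps)
  finally show ?thesis .
qed

text \<open>\<open>block\<close> is numbered from 1 and \<open>block_index\<close> from 0, hence the
  successor.\<close>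

lemma in_block_iff:
  assumes "0 < n" "0 \<le> x" "1 \<le> v"
  shows "x \<in> block n v \<longleftrightarrow> v = Suc (block_index n x)"
  using block_index_eq_iff[OF assms(1,2), of "v - 1"] assms(3)
  by (auto simp: block_def of_nat_diff)

lemma block_index_less:
  assumes "0 < n" "0 \<le> x" "x < 1"
  shows "block_index n x < n"
proof -
  have "real n * x < real n" using assms by simp
  then show ?thesis using assms by (simp add: block_index_def nat_less_iff floor_less_iff)
qed

lemma measurable_block_index [measurable]: "block_index n \<in> measurable unit_interval (count_space UNIV)"
  by (rule measurable_unit_interval) (unfold block_index_def[abs_def], measurable)

lemma measure_block:
  assumes "p < n"
  shows "measure unit_interval {x \<in> space unit_interval. block_index n x = p} = 1 / real n"
proof -
  have n: "0 < n" using assms by simp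
  have "(real p + 1) / real n \<le> 1" using assms by (simp add: field_simps)
  moreover have "0 \<le> real p / real n" by simp
  ultimately have le: "0 \<le> x \<and> x < 1" if "real p / real n \<le> x" "x < (real p + 1) / real n" for x
    using that by linarith
  have eq: "{x \<in> space unit_interval. block_index n x = p} = {real p / real n ..< (real p + 1) / real n}"
    (is "?L = ?R")
  proof (rule set_eqI)
    show "x \<in> ?L \<longleftrightarrow> x \<in> ?R" for x
      using block_index_eq_iff[OF n, of x p] le[of x] by (cases "0 \<le> x") auto
  qed
  have "{real p / real n ..< (real p + 1) / real n} \<subseteq> {0..<1}"
    using le by (intro subsetI) auto
  then have "emeasure unit_interval {real p / real n ..< (real p + 1) / real n}
      = ennreal ((real p + 1) / real n - real p / real n)"
    by (subst emeasure_unit_interval) (auto simp: divide_right_mono)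
  then show ?thesis
    unfolding eq measure_def by (simp add: diff_divide_distrib[symmetric])
qed

text \<open>Rounding works with symmetric relations on \<open>{..<n}\<close>, the representation
  with two-element subsets of \<open>{1..n}\<close>.\<close>

definition shifted_edges :: "(nat \<times> nat) set \<Rightarrow> nat set set" where
  "shifted_edges H = (\<lambda>(u, v). {Suc u, Suc v}) ` H"

lemma shifted_edges_iff: "sym H \<Longrightarrow> {Suc u, Suc v} \<in> shifted_edges H \<longleftrightarrow> (u, v) \<in> H"
  by (auto simp: shifted_edges_def doubleton_eq_iff image_iff dest: symD)

lemma regular_graph_shifted_edges:
  assumes "H \<subseteq> {..<n} \<times> {..<n}" "sym H" "irrefl H" and deg: "\<forall>v\<in>{..<n}. vertex_degree H v = D"
  shows "regular_graph D {1..n} (shifted_edges H)"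
proof -
  have "card {e \<in> shifted_edges H. v \<in> e} = D" if v: "v \<in> {1..n}" for v
  proof -
    obtain w where w: "v = Suc w" "w < n" using v by (cases v) auto
    have "{e \<in> shifted_edges H. v \<in> e} = (\<lambda>u. {Suc w, Suc u}) ` (H `` {w})"
      using assms(2) by (force simp: shifted_edges_def w image_iff insert_commute dest: symD)
    moreover have "inj_on (\<lambda>u. {Suc w, Suc u}) (H `` {w})"
      by (auto simp: inj_on_def doubleton_eq_iff)
    ultimately show ?thesis using deg w by (simp add: card_image vertex_degree_def)
  qed
  moreover have "simple_graph {1..n} (shifted_edges H)"
    using assms(1,3) by (force simp: simple_graph_def shifted_edges_def irrefl_def card_insert_if)
  ultimately show ?thesis by (simp add: regular_graph_def)
qed

lemma graph_graphon_shifted_edges: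
  assumes "H \<subseteq> {..<n} \<times> {..<n}" "sym H" "0 < n" "x \<in> {0..<1}" "y \<in> {0..<1}"
  shows "graph_graphon n (shifted_edges H) x y = of_bool ((block_index n x, block_index n y) \<in> H)"
proof -
  have "x \<in> block n u \<longleftrightarrow> u = Suc (block_index n x)" "y \<in> block n u \<longleftrightarrow> u = Suc (block_index n y)"
    if "u \<in> {1..n}" for u
    using that assms in_block_iff[of n x u] in_block_iff[of n y u] by simp_all
  moreover have "Suc (block_index n x) \<in> {1..n}" "Suc (block_index n y) \<in> {1..n}"
    using assms block_index_less[of n] by (auto simp: Suc_le_eq)
  ultimately have "(\<exists>u\<in>{1..n}. \<exists>v\<in>{1..n}. {u, v} \<in> shifted_edges H \<and> x \<in> block n u \<and> y \<in> block n v) \<longleftrightarrow>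
      {Suc (block_index n x), Suc (block_index n y)} \<in> shifted_edges H"
    by blast
  then show ?thesis unfolding graph_graphon_def shifted_edges_iff[OF assms(2)] by simp
qed

text \<open>Each block on which \<open>m\<close> is not constant contributes to the increase of \<open>m\<close> between the left ends
  of consecutive blocks.\<close>

lemma card_bad_blocks:
  fixes m :: "real \<Rightarrow> nat"
  assumes "0 < n" "mono_on {0..<1} m" "\<And>u. m u < k"
  shows "card {p. p < n \<and> (\<exists>u\<in>{0..<1}. block_index n u = p \<and> m u \<noteq> m (real p / real n))} \<le> k"
    (is "card ?Bad \<le> k")
proof -
  \<comment> \<open>The sentinel \<open>k\<close> at position n exceeds all values of
    \<open>m\<close>, so that the last block has a right end to compare with.\<close>
  define l where "l p = (if p < n then m (real p / real n) else k)" for p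
  have inc: "l p \<le> l (Suc p)" if "p < n" for p
  proof (cases "Suc p < n")
    case True
    then have "m (real p / real n) \<le> m (real (Suc p) / real n)"
      by (intro mono_onD[OF assms(2)]) (auto simp: divide_right_mono)
    then show ?thesis using that True by (simp add: l_def)
  qed (use assms(3)[of "real p / real n"] that in \<open>auto simp: l_def intro: less_imp_le\<close>)
  have bad: "l p < l (Suc p)" if "p \<in> ?Bad" for p
  proof -
    obtain u where u: "0 \<le> u" "u < 1" "block_index n u = p" "m u \<noteq> m (real p / real n)" and "p < n"
      using \<open>p \<in> ?Bad\<close> by auto
    have pu: "real p / real n \<le> u" "u < (real p + 1) / real n"
      using u block_index_eq_iff[OF assms(1) u(1)] by auto
    then have "m (real p / real n) \<le> m u"
      using u \<open>p < n\<close> by (intro mono_onD[OF assms(2)]) auto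
    then have "m (real p / real n) < m u" using u(4) by simp
    moreover have "m u \<le> l (Suc p)"
    proof (cases "Suc p < n")
      case True
      then have "m u \<le> m (real (Suc p) / real n)"
        using u pu by (intro mono_onD[OF assms(2)]) (auto simp: add.commute)
      then show ?thesis using True by (simp add: l_def)
    qed (use assms(3)[of u] in \<open>simp add: l_def\<close>)
    ultimately show ?thesis using \<open>p < n\<close> by (simp add: l_def)
  qed
  have "int (card ?Bad) = (\<Sum>p\<in>?Bad. 1)" by simp
  also have "\<dots> \<le> (\<Sum>p\<in>?Bad. int (l (Suc p)) - int (l p))"
    using bad by (intro sum_mono) fastforce
  also have "\<dots> \<le> (\<Sum>p<n. int (l (Suc p)) - int (l p))"
    using inc by (intro sum_mono2) auto
  also have "\<dots> = int (l n) - int (l 0)"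
    by (rule sum_lessThan_telescope)
  also have "\<dots> \<le> int k" by (simp add: l_def)
  finally show ?thesis by simp
qed

section \<open>Change of variables, and the approximating graph of one kernel\<close>

lemma (in kernel) integral_pullback:
  assumes "measure_preserving N M f" and \<Phi>: "\<Phi> \<in> borel_measurable MM"
  shows "(\<integral>z. \<Phi> (f (fst z), f (snd z)) \<partial>(N \<Otimes>\<^sub>M N)) = (\<integral>z. (\<Phi> z :: real) \<partial>MM)"
  using integral_distr[OF measure_preserving_pair(1)[OF assms(1) prob_space_axioms] \<Phi>]
  by (simp add: measure_preserving_pair(2)[OF assms(1) prob_space_axioms])

lemma (in kernel) kernel_pullback:
  assumes "measure_preserving N M f" "prob_space N"
  shows "kernel N (pullback W f)"
proof -
  have "(\<lambda>z. case_prod W (f (fst z), f (snd z))) \<in> borel_measurable (N \<Otimes>\<^sub>M N)"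
    by (rule measurable_compose[OF measure_preserving_pair(1)[OF assms(1) prob_space_axioms] W_measurable])
  moreover have "f x \<in> space M" if "x \<in> space N" for x
    using assms(1) that by (auto simp: measure_preserving_def dest: measurable_space)
  ultimately show ?thesis
    using assms(2) W_sym W_nonneg W_le_1
    unfolding kernel_def kernel_axioms_def pullback_def by (simp add: split_def)
qed

lemma (in kernel) integrable_times_indicator:
  assumes "F \<in> borel_measurable MM" "\<And>z. z \<in> space MM \<Longrightarrow> \<bar>F z\<bar> \<le> (1::real)" "S \<in> sets M" "T \<in> sets M"
  shows "integrable MM (\<lambda>z. F z * indicator (S \<times> T) z)"
proof (rule integrable_bounded)
  show "(\<lambda>z. F z * indicator (S \<times> T) z) \<in> borel_measurable MM" using assms by measurable
  show "\<bar>F z * indicator (S \<times> T) z\<bar> \<le> 1" if "z \<in> space MM" for z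
    using assms(2)[OF that] by (simp add: indicator_def)
qed

lemma (in kernel) integral_index_fun_Times:
  assumes i: "index k i" and S: "S \<in> sets M" and T: "T \<in> sets M"
  shows "(\<integral>z. F (i (fst z)) (i (snd z)) * indicator (S \<times> T) z \<partial>MM) =
    (\<Sum>p<k. \<Sum>q<k. F p q * (measure M (S \<inter> cell i p) * measure M (T \<inter> cell i q)))"
proof -
  have [measurable]: "cell i p \<in> sets M" for p using i by (rule cell_sets)
  note [measurable] = S T
  have "(\<integral>z. F (i (fst z)) (i (snd z)) * indicator (S \<times> T) z \<partial>MM) =
      (\<integral>z. indicator (S \<times> T) z * F (i (fst z)) (i (snd z)) \<partial>MM)"
    by (simp add: mult.commute)
  also have "\<dots> = (\<Sum>p<k. \<Sum>q<k. F p q * (\<integral>z. indicator (S \<times> T) z * indicator (cell i p \<times> cell i q) z \<partial>MM))"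
    by (rule integral_step_expand[OF i, of _ 1]) auto
  also have "\<dots> = (\<Sum>p<k. \<Sum>q<k. F p q * (measure M (S \<inter> cell i p) * measure M (T \<inter> cell i q)))"
  proof (intro sum.cong refl arg_cong2[where f = "(*)"])
    fix p q
    have "(\<integral>z. (indicator (S \<times> T) z * indicator (cell i p \<times> cell i q) z :: real) \<partial>MM) =
        (\<integral>z. (indicator ((S \<inter> cell i p) \<times> (T \<inter> cell i q)) z :: real) \<partial>MM)"
      by (intro Bochner_Integration.integral_cong refl) (auto simp: indicator_def)
    also have "\<dots> = measure M (S \<inter> cell i p) * measure M (T \<inter> cell i q)"
      by (intro integral_indicator_Times) measurable
    finally show "(\<integral>z. (indicator (S \<times> T) z * indicator (cell i p \<times> cell i q) z :: real) \<partial>MM) =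
      measure M (S \<inter> cell i p) * measure M (T \<inter> cell i q)" .
  qed
  finally show ?thesis .
qed

lemma (in kernel) regular_integral:
  assumes deg: "AE x in M. (\<integral>y. W x y \<partial>M) = d" and S: "S \<in> sets M"
  shows "(\<integral>z. case_prod W z * indicator (S \<times> space M) z \<partial>MM) = d * measure M S"
proof -
  note [measurable] = S
  have "(\<integral>z. case_prod W z * indicator (S \<times> space M) z \<partial>MM) =
      (\<integral>x. (\<integral>y. case_prod W (x, y) * indicator (S \<times> space M) (x, y) \<partial>M) \<partial>M)"
    by (intro PP.integral_fst'[symmetric] integrable_W_indicator) measurable
  also have "\<dots> = (\<integral>x. (\<integral>y. W x y \<partial>M) * indicator S x \<partial>M)"
    by (intro Bochner_Integration.integral_cong refl)
      (auto simp: indicator_def cong: Bochner_Integration.integral_cong)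
  also have "\<dots> = (\<integral>x. d * indicator S x \<partial>M)"
    using deg by (intro integral_cong_AE) (auto elim!: eventually_mono)
  finally show ?thesis by simp
qed

lemma abs_diff_le_1:
  fixes a b :: real
  shows "0 \<le> a \<Longrightarrow> a \<le> 1 \<Longrightarrow> 0 \<le> b \<Longrightarrow> b \<le> 1 \<Longrightarrow> \<bar>a - b\<bar> \<le> 1"
  by linarith

text \<open>The chain of comparisons is \<open>Wf\<close> (pullback of W), \<open>Sf\<close>
  (pullback of the step function), \<open>Bs\<close> (block matrix), \<open>Hs\<close> (graph). Weak
  regularity and the non-constant blocks cost \<eta>^2/32 each, the latter because n \<ge> 64
  4^t/\<eta>^2 gives 2 k/n \<le> \<eta>^2/32. Their sum \<eta>^2/16, doubled, is the row error
  \<eta>^2/8 that rounding tolerates; rounding adds 5 \<eta>, and \<eta>^2/16 + 5 \<eta> \<le> 6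
  \<eta>.\<close>

lemma (in kernel) graph_approximation:
  fixes \<eta> d :: real and n t D :: nat
  defines "V \<equiv> {..<n}"
  assumes retract: "real_retract M" and null: "\<And>x. x \<in> space M \<Longrightarrow> emeasure M {x} = 0"
    and deg: "AE x in M. (\<integral>y. W x y \<partial>M) = d"
    and \<eta>: "0 < \<eta>" "\<eta> \<le> 1 / 8"
    and t: "1 < real t * (\<eta>\<^sup>2 / 32)\<^sup>2" and n: "64 * 4 ^ t / \<eta>\<^sup>2 \<le> real n"
    and D: "\<forall>B. (\<forall>u\<in>V. \<forall>v\<in>V. B u v = B v u \<and> 0 \<le> B u v \<and> B u v \<le> 1) \<longrightarrow>
      (\<Sum>v\<in>V. \<bar>(\<Sum>u\<in>V. B v u) - d * real (card V)\<bar>) \<le> \<eta>\<^sup>2 / 8 * (real (card V))\<^sup>2 \<longrightarrow>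
      (\<exists>H. H \<subseteq> V \<times> V \<and> sym H \<and> irrefl H \<and> (\<forall>v\<in>V. vertex_degree H v = D) \<and>
      (\<forall>S T. S \<subseteq> V \<longrightarrow> T \<subseteq> V \<longrightarrow>
        \<bar>\<Sum>u\<in>S. \<Sum>v\<in>T. of_bool ((u, v) \<in> H) - B u v\<bar> \<le> 5 * \<eta> * (real (card V))\<^sup>2))"
  shows "\<exists>E. regular_graph D {1..n} E \<and> cut_dist M W unit_interval (graph_graphon n E) \<le> ereal (6 * \<eta>)"
proof -
  have "0 < 64 * 4 ^ t / \<eta>\<^sup>2" using \<eta> by simp
  then have n0: "0 < n" using n by (metis less_le_trans of_nat_0_less_iff)
  have cardV: "card V = n" by (simp add: V_def)
  obtain k i where k: "k \<le> 4 ^ t" and i: "index k i"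
    and reg: "\<And>S T. S \<in> sets M \<Longrightarrow> T \<in> sets M \<Longrightarrow>
        \<bar>\<integral>z. (case_prod W z - step i z) * indicator (S \<times> T) z \<partial>MM\<bar> \<le> \<eta>\<^sup>2 / 32"
    using weak_regularity[OF _ t] \<eta> by auto
  have kn: "2 * (real k / real n) \<le> \<eta>\<^sup>2 / 32"
  proof -
    have "real k \<le> real (4 ^ t)" using k by (simp only: of_nat_le_iff)
    then have "64 * real k / \<eta>\<^sup>2 \<le> 64 * 4 ^ t / \<eta>\<^sup>2"
      by (intro divide_right_mono) simp_all
    then have "64 * real k / \<eta>\<^sup>2 \<le> real n" using n by linarith
    then show ?thesis using n0 \<eta> by (simp add: field_simps)
  qed
  obtain f g m where f: "measure_preserving_bij unit_interval M f" and g [measurable]: "g \<in> borel_measurable M"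
    and m: "mono_on {0..<1} m" "\<And>u. m u < k" and ae: "AE u in unit_interval. g (f u) = u \<and> i (f u) = m u"
    using step_parametrization[OF prob_space_axioms retract null, of i k] i by (auto simp: index_def)
  have mp: "measure_preserving unit_interval M f" using f by (simp add: measure_preserving_bij_def)
  interpret U: kernel unit_interval "pullback W f"
    by (rule kernel_pullback[OF mp prob_space_unit_interval])
  define Wf where "Wf = case_prod (pullback W f)"
  have Wf: "Wf z = case_prod W (f (fst z), f (snd z))" for z by (simp add: Wf_def pullback_def split_def)
  define b where "b = block_index n"
  have idx: "U.index n b"
    using block_index_less[OF n0] by (auto simp: U.index_def b_def)
  \<comment> \<open>The entries are the averages at the left ends of the blocks, so they agree
    almost everywhere with \<open>Sf\<close> on products of blocks on which \<open>m\<close> is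
    constant.\<close>
  define B where "B p q = avg i (m (real p / real n)) (m (real q / real n))" for p q
  have B: "B p q = B q p \<and> 0 \<le> B p q \<and> B p q \<le> 1" for p q
    using avg_sym[OF i] avg_bounds[OF i] by (simp add: B_def)
  define Bs where "Bs z = B (b (fst z)) (b (snd z))" for z
  define Sf where "Sf z = step i (f (fst z), f (snd z))" for z
  have [measurable]: "Wf \<in> borel_measurable U.MM" unfolding Wf_def by measurable
  have [measurable]: "Bs \<in> borel_measurable U.MM"
    unfolding Bs_def[abs_def] by (rule U.measurable_index_fun[OF idx])
  have step_meas [measurable]: "step i \<in> borel_measurable MM" by (rule measurable_step_W[OF i])
  have Sf_meas [measurable]: "Sf \<in> borel_measurable U.MM"
    unfolding Sf_def[abs_def]
    by (rule measurable_compose[OF measure_preserving_pair(1)[OF mp prob_space_axioms] step_meas])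
  have bounds: "z \<in> space U.MM \<Longrightarrow> 0 \<le> Wf z \<and> Wf z \<le> 1" "0 \<le> Bs z \<and> Bs z \<le> 1" "0 \<le> Sf z \<and> Sf z \<le> 1" for z
    using U.W_bounds[of z] B step_bounds[OF i] by (auto simp: Wf_def Bs_def Sf_def)
  have ae_fst: "AE z in U.MM. g (f (fst z)) = fst z \<and> i (f (fst z)) = m (fst z)"
    by (rule AE_pair_fst[OF prob_space_unit_interval ae])
  have ae_snd: "AE z in U.MM. g (f (snd z)) = snd z \<and> i (f (snd z)) = m (snd z)"
    by (rule AE_pair_snd[OF prob_space_unit_interval ae])
  have close1: "\<bar>\<integral>z. (Wf z - Sf z) * indicator (S \<times> T) z \<partial>U.MM\<bar> \<le> \<eta>\<^sup>2 / 32"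
    if S: "S \<in> sets unit_interval" and T: "T \<in> sets unit_interval" for S T
  proof -
    have [measurable]: "S \<in> sets borel" "T \<in> sets borel" using S T sets_unit_interval by auto
    note [measurable] = S T
    \<comment> \<open>Regularity speaks of subsets of \<open>M\<close>; sets of the interval are
      carried there by \<open>g\<close>, which inverts the parametrization almost
      everywhere.\<close>
    define S' where "S' = {x \<in> space M. g x \<in> S}"
    define T' where "T' = {x \<in> space M. g x \<in> T}"
    have [measurable]: "S' \<in> sets M" "T' \<in> sets M" unfolding S'_def T'_def by measurable
    define \<Phi> where "\<Phi> z = (case_prod W z - step i z) * indicator (S' \<times> T') z" for z
    have \<Phi>: "\<Phi> \<in> borel_measurable MM" unfolding \<Phi>_def[abs_def] by measurable
    have "(\<integral>z. (Wf z - Sf z) * indicator (S \<times> T) z \<partial>U.MM) = (\<integral>z. \<Phi> (f (fst z), f (snd z)) \<partial>U.MM)"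
    proof (rule integral_cong_AE)
      show "(\<lambda>z. (Wf z - Sf z) * indicator (S \<times> T) z) \<in> borel_measurable U.MM" by measurable
      show "(\<lambda>z. \<Phi> (f (fst z), f (snd z))) \<in> borel_measurable U.MM"
        by (rule measurable_compose[OF measure_preserving_pair(1)[OF mp prob_space_axioms] \<Phi>])
      show "AE z in U.MM. (Wf z - Sf z) * indicator (S \<times> T) z = \<Phi> (f (fst z), f (snd z))"
        using ae_fst ae_snd AE_space
      proof eventually_elim
        case (elim z)
        have "f (fst z) \<in> space M" "f (snd z) \<in> space M"
          using elim(3) mp by (auto simp: measure_preserving_def space_pair_measure dest: measurable_space)
        then have "indicator (S' \<times> T') (f (fst z), f (snd z)) = (indicator (S \<times> T) z :: real)"
          using elim by (cases z) (auto simp: S'_def T'_def indicator_def)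
        then show ?case by (simp add: \<Phi>_def Wf Sf_def)
      qed
    qed
    also have "\<dots> = (\<integral>z. \<Phi> z \<partial>MM)" by (rule integral_pullback[OF mp \<Phi>])
    finally show ?thesis using reg[of S' T'] by (simp add: \<Phi>_def)
  qed
  define Bad where "Bad = {p. p < n \<and> (\<exists>u\<in>{0..<1}. block_index n u = p \<and> m u \<noteq> m (real p / real n))}"
  define Y where "Y = (\<Union>p\<in>Bad. U.cell b p)"
  have [measurable]: "U.cell b p \<in> sets unit_interval" for p by (rule U.cell_sets[OF idx])
  have finBad: "finite Bad" by (simp add: Bad_def)
  then have [measurable]: "Y \<in> sets unit_interval" unfolding Y_def by (intro sets.finite_UN finBad U.cell_sets[OF idx])
  have "measure unit_interval Y \<le> (\<Sum>p\<in>Bad. measure unit_interval (U.cell b p))"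
    unfolding Y_def by (rule U.finite_measure_subadditive_finite[OF finBad]) (use U.cell_sets[OF idx] in blast)
  also have "\<dots> = (\<Sum>p\<in>Bad. 1 / real n)"
    unfolding b_def by (intro sum.cong refl measure_block) (simp add: Bad_def)
  also have "\<dots> \<le> real k / real n"
    using card_bad_blocks[OF n0 m] by (simp add: Bad_def divide_right_mono)
  finally have mY: "measure unit_interval Y \<le> real k / real n" .
  \<comment> \<open>\<open>Sf\<close> and \<open>Bs\<close> can differ only if a coordinate lies in
    \<open>Y\<close>, up to a null set; each coordinate contributes at most k/n.\<close>
  have close2: "\<bar>\<integral>z. (Sf z - Bs z) * indicator (S \<times> T) z \<partial>U.MM\<bar> \<le> \<eta>\<^sup>2 / 32"
    if [measurable]: "S \<in> sets unit_interval" "T \<in> sets unit_interval" for S T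
  proof -
    let ?X = "space unit_interval"
    have int: "integrable U.MM (\<lambda>z. (Sf z - Bs z) * indicator (S \<times> T) z)"
      using bounds by (intro U.integrable_times_indicator) (auto intro!: abs_diff_le_1)
    have intY: "integrable U.MM (indicator (Y \<times> ?X) :: _ \<Rightarrow> real)" "integrable U.MM (indicator (?X \<times> Y) :: _ \<Rightarrow> real)"
    proof -
      have "Y \<times> ?X \<in> sets U.MM" "?X \<times> Y \<in> sets U.MM"
        by (intro pair_measureI sets.top \<open>Y \<in> _\<close>)+
      then show "integrable U.MM (indicator (Y \<times> ?X) :: _ \<Rightarrow> real)" "integrable U.MM (indicator (?X \<times> Y) :: _ \<Rightarrow> real)"
        by (auto intro!: U.integrable_bounded[of _ 1] borel_measurable_indicator simp: indicator_def
            simp del: space_unit_interval)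
    qed
    have "\<bar>\<integral>z. (Sf z - Bs z) * indicator (S \<times> T) z \<partial>U.MM\<bar> \<le> (\<integral>z. \<bar>(Sf z - Bs z) * indicator (S \<times> T) z\<bar> \<partial>U.MM)"
      by (rule integral_abs_bound)
    also have "\<dots> \<le> (\<integral>z. indicator (Y \<times> ?X) z + indicator (?X \<times> Y) z \<partial>U.MM)"
    proof (rule integral_mono_AE)
      show "integrable U.MM (\<lambda>z. \<bar>(Sf z - Bs z) * indicator (S \<times> T) z\<bar>)" using int by (rule integrable_abs)
      show "integrable U.MM (\<lambda>z. indicator (Y \<times> ?X) z + indicator (?X \<times> Y) z :: real)"
        using intY by (rule Bochner_Integration.integrable_add)
      show "AE z in U.MM. \<bar>(Sf z - Bs z) * indicator (S \<times> T) z\<bar> \<le> indicator (Y \<times> ?X) z + indicator (?X \<times> Y) z"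
        using ae_fst ae_snd AE_space
      proof eventually_elim
        case (elim z)
        then have z: "fst z \<in> {0..<1}" "snd z \<in> {0..<1}" by (auto simp: space_pair_measure)
        show ?case
        proof (cases "fst z \<in> Y \<or> snd z \<in> Y")
          case True
          then have "1 \<le> (indicator (Y \<times> ?X) z + indicator (?X \<times> Y) z :: real)"
            using z by (cases z) (auto simp: indicator_def)
          moreover have "\<bar>(Sf z - Bs z) * indicator (S \<times> T) z\<bar> \<le> 1"
            using bounds(2,3)[of z] by (auto simp: indicator_def)
          ultimately show ?thesis by linarith
        next
          case False
          have "m u = m (real (b u) / real n)" if "u \<in> {0..<1}" "u \<notin> Y" for u
          proof (rule ccontr)
            assume "m u \<noteq> m (real (b u) / real n)"
            then have "b u \<in> Bad" using that block_index_less[OF n0] by (auto simp: Bad_def b_def)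
            then show False using that by (auto simp: Y_def)
          qed
          then have "Sf z = Bs z" using z False elim by (simp add: Sf_def Bs_def B_def step_def)
          then show ?thesis by (simp add: indicator_def)
        qed
      qed
    qed
    also have "\<dots> = measure unit_interval Y * 1 + 1 * measure unit_interval Y"
      using intY by (simp only: Bochner_Integration.integral_add U.integral_indicator_Times sets.top U.prob_space \<open>Y \<in> _\<close>)
    also have "\<dots> \<le> \<eta>\<^sup>2 / 32" using mY kn by linarith
    finally show ?thesis .
  qed
  have close: "\<bar>\<integral>z. (Wf z - Bs z) * indicator (S \<times> T) z \<partial>U.MM\<bar> \<le> \<eta>\<^sup>2 / 16"
    if ST [measurable]: "S \<in> sets unit_interval" "T \<in> sets unit_interval" for S T
  proof -
    have "(\<integral>z. (Wf z - Bs z) * indicator (S \<times> T) z \<partial>U.MM) =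
        (\<integral>z. (Wf z - Sf z) * indicator (S \<times> T) z + (Sf z - Bs z) * indicator (S \<times> T) z \<partial>U.MM)"
      by (intro Bochner_Integration.integral_cong refl) (simp add: algebra_simps)
    also have "\<dots> = (\<integral>z. (Wf z - Sf z) * indicator (S \<times> T) z \<partial>U.MM) + (\<integral>z. (Sf z - Bs z) * indicator (S \<times> T) z \<partial>U.MM)"
      using bounds by (intro Bochner_Integration.integral_add U.integrable_times_indicator ST) (auto intro!: abs_diff_le_1)
    finally show ?thesis using close1[OF ST] close2[OF ST] by linarith
  qed
  \<comment> \<open>The row errors summed over a set of blocks with union S are n^2 times a cut over
    S and the whole interval: there \<open>Wf\<close> integrates to d times the measure of S, and
    \<open>Bs\<close> to the row sums divided by n^2.\<close>
  have "(\<Sum>v\<in>V. \<bar>(\<Sum>u\<in>V. B v u) - d * real n\<bar>) \<le> 2 * (\<eta>\<^sup>2 / 16 * (real n)\<^sup>2)"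
  proof (rule sum_abs_le_twice)
    fix P assume P: "P \<subseteq> V"
    then have finP: "finite P" by (rule finite_subset) (simp add: V_def)
    let ?X = "space unit_interval"
    define S where "S = (\<Union>p\<in>P. U.cell b p)"
    have S [measurable]: "S \<in> sets unit_interval" unfolding S_def by (intro sets.finite_UN finP U.cell_sets[OF idx])
    have "measure unit_interval S = (\<Sum>p\<in>P. measure unit_interval (U.cell b p))"
      unfolding S_def
    proof (rule U.finite_measure_finite_Union[OF finP])
      show "U.cell b ` P \<subseteq> sets unit_interval" using U.cell_sets[OF idx] by blast
      show "disjoint_family_on (U.cell b) P" unfolding disjoint_family_on_def by blast
    qed
    also have "\<dots> = (\<Sum>p\<in>P. 1 / real n)"
      unfolding b_def using P by (intro sum.cong refl measure_block) (auto simp: V_def)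
    finally have mS: "measure unit_interval S = card P / real n" by simp
    have cell: "measure unit_interval (S \<inter> U.cell b p) = of_bool (p \<in> P) / real n"
        "measure unit_interval (?X \<inter> U.cell b p) = 1 / real n" if "p < n" for p
    proof -
      have c: "measure unit_interval (U.cell b p) = 1 / real n" unfolding b_def by (rule measure_block[OF that])
      have "S \<inter> U.cell b p = (if p \<in> P then U.cell b p else {})" by (auto simp: S_def)
      then show "measure unit_interval (S \<inter> U.cell b p) = of_bool (p \<in> P) / real n" using c by simp
      have "?X \<inter> U.cell b p = U.cell b p" by blast
      then show "measure unit_interval (?X \<inter> U.cell b p) = 1 / real n" using c by simp
    qed
    have "(\<integral>z. Bs z * indicator (S \<times> ?X) z \<partial>U.MM) =
        (\<Sum>p<n. \<Sum>q<n. B p q * (measure unit_interval (S \<inter> U.cell b p) * measure unit_interval (?X \<inter> U.cell b q)))"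
      unfolding Bs_def by (rule U.integral_index_fun_Times[OF idx S sets.top])
    also have "\<dots> = (\<Sum>p<n. if p \<in> P then (\<Sum>q<n. B p q) / (real n)\<^sup>2 else 0)"
    proof (intro sum.cong refl)
      fix p assume p: "p \<in> {..<n}"
      have "(\<Sum>q<n. B p q * (measure unit_interval (S \<inter> U.cell b p) * measure unit_interval (?X \<inter> U.cell b q))) =
          (\<Sum>q<n. B p q * (of_bool (p \<in> P) / real n * (1 / real n)))"
        using p by (intro sum.cong refl) (simp only: cell lessThan_iff)
      then show "(\<Sum>q<n. B p q * (measure unit_interval (S \<inter> U.cell b p) * measure unit_interval (?X \<inter> U.cell b q))) =
          (if p \<in> P then (\<Sum>q<n. B p q) / (real n)\<^sup>2 else 0)"
        by (simp only:) (simp add: sum_divide_distrib power2_eq_square)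
    qed
    also have "\<dots> = (\<Sum>p\<in>P. (\<Sum>q<n. B p q) / (real n)\<^sup>2)"
      using P by (subst sum.inter_restrict[symmetric]) (auto simp: V_def Int_absorb1)
    finally have I1: "(\<integral>z. Bs z * indicator (S \<times> ?X) z \<partial>U.MM) = (\<Sum>p\<in>P. \<Sum>q\<in>V. B p q) / (real n)\<^sup>2"
      by (simp add: sum_divide_distrib V_def)
    have degU: "AE u in unit_interval. (\<integral>v. pullback W f u v \<partial>unit_interval) = d"
    proof -
      have fm: "f \<in> measurable unit_interval M" and dm: "distr unit_interval M f = M"
        using mp by (auto simp: measure_preserving_def)
      have "AE u in unit_interval. (\<integral>y. W (f u) y \<partial>M) = d"
        by (rule AE_distrD[OF fm, unfolded dm, OF deg])
      with AE_space show ?thesis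
      proof eventually_elim
        case (elim u)
        have "W (f u) \<in> borel_measurable M"
          using measurable_space[OF fm elim(1)] W_measurable by measurable
        from integral_distr[OF fm this] show ?case using elim(2) by (simp add: dm pullback_def)
      qed
    qed
    have I2: "(\<integral>z. Wf z * indicator (S \<times> ?X) z \<partial>U.MM) = d * (card P / real n)"
      using U.regular_integral[OF degU S] by (simp add: Wf_def mS)
    have "(\<integral>z. (Wf z - Bs z) * indicator (S \<times> ?X) z \<partial>U.MM) =
        (\<integral>z. Wf z * indicator (S \<times> ?X) z - Bs z * indicator (S \<times> ?X) z \<partial>U.MM)"
      by (simp add: algebra_simps)
    also have "\<dots> = (\<integral>z. Wf z * indicator (S \<times> ?X) z \<partial>U.MM) - (\<integral>z. Bs z * indicator (S \<times> ?X) z \<partial>U.MM)"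
      using bounds by (intro Bochner_Integration.integral_diff U.integrable_times_indicator S sets.top)
        (auto simp: abs_le_iff)
    finally have "\<bar>d * (card P / real n) - (\<Sum>p\<in>P. \<Sum>q\<in>V. B p q) / (real n)\<^sup>2\<bar> \<le> \<eta>\<^sup>2 / 16"
      using close[OF S sets.top] I1 I2 by simp
    moreover have "(\<Sum>v\<in>P. (\<Sum>u\<in>V. B v u) - d * real n) =
        - ((d * (card P / real n) - (\<Sum>p\<in>P. \<Sum>q\<in>V. B p q) / (real n)\<^sup>2) * (real n)\<^sup>2)"
      using n0 by (simp add: sum_subtractf field_simps power2_eq_square)
    ultimately show "\<bar>\<Sum>v\<in>P. (\<Sum>u\<in>V. B v u) - d * real n\<bar> \<le> \<eta>\<^sup>2 / 16 * (real n)\<^sup>2"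
      by (simp only: abs_minus_cancel abs_mult abs_power2) (rule mult_right_mono, auto)
  qed (simp add: V_def)
  then have rows: "(\<Sum>v\<in>V. \<bar>(\<Sum>u\<in>V. B v u) - d * real (card V)\<bar>) \<le> \<eta>\<^sup>2 / 8 * (real (card V))\<^sup>2"
    by (simp add: cardV)
  obtain H where H: "H \<subseteq> V \<times> V" "sym H" "irrefl H" "\<forall>v\<in>V. vertex_degree H v = D"
    and disc: "\<forall>S T. S \<subseteq> V \<longrightarrow> T \<subseteq> V \<longrightarrow>
        \<bar>\<Sum>u\<in>S. \<Sum>v\<in>T. of_bool ((u, v) \<in> H) - B u v\<bar> \<le> 5 * \<eta> * (real (card V))\<^sup>2"
    using D[rule_format, OF B rows] by (elim exE conjE)
  define E where "E = shifted_edges H"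
  have regE: "regular_graph D {1..n} E"
    unfolding E_def using H by (intro regular_graph_shifted_edges) (auto simp: V_def)
  define Hs where "Hs z = (of_bool ((b (fst z), b (snd z)) \<in> H) :: real)" for z
  have hsb: "0 \<le> Hs z \<and> Hs z \<le> 1" for z by (simp add: Hs_def)
  have [measurable]: "Hs \<in> borel_measurable U.MM"
    unfolding Hs_def[abs_def] by (rule U.measurable_index_fun[OF idx, of "\<lambda>p q. of_bool ((p, q) \<in> H)"])
  have close3: "\<bar>\<integral>z. (Hs z - Bs z) * indicator (S \<times> T) z \<partial>U.MM\<bar> \<le> 5 * \<eta>"
    if S: "S \<in> sets unit_interval" and T: "T \<in> sets unit_interval" for S T
  proof -
    have small: "0 \<le> measure unit_interval (A \<inter> U.cell b p) \<and> measure unit_interval (A \<inter> U.cell b p) \<le> 1 / real n"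
      if "p \<in> V" for A p
    proof -
      have "measure unit_interval (A \<inter> U.cell b p) \<le> measure unit_interval (U.cell b p)"
        by (rule U.finite_measure_mono[OF Int_lower2 U.cell_sets[OF idx]])
      also have "\<dots> = 1 / real n" unfolding b_def using that by (intro measure_block) (simp add: V_def)
      finally show ?thesis by simp
    qed
    \<comment> \<open>S and T enter only through their measures in the blocks, which lie between 0
      and 1/n; the factor (1/n)^2 cancels the n^2 of the cut bound.\<close>
    have "(\<integral>z. (Hs z - Bs z) * indicator (S \<times> T) z \<partial>U.MM) =
        (\<Sum>p\<in>V. \<Sum>q\<in>V. (of_bool ((p, q) \<in> H) - B p q) *
          (measure unit_interval (S \<inter> U.cell b p) * measure unit_interval (T \<inter> U.cell b q)))"
      unfolding Hs_def Bs_def V_def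
      by (rule U.integral_index_fun_Times[OF idx S T, of "\<lambda>p q. of_bool ((p, q) \<in> H) - B p q"])
    also have "\<bar>\<dots>\<bar> \<le> (5 * \<eta> * (real n)\<^sup>2) * (1 / real n)\<^sup>2"
      by (rule abs_bilinear_le_cut) (use disc small in \<open>auto simp: V_def\<close>)
    also have "\<dots> = 5 * \<eta>" using n0 by (simp add: power_divide)
    finally show ?thesis .
  qed
  have "cut_norm unit_interval (\<lambda>x y. pullback W f x y - graph_graphon n E x y) \<le> 6 * \<eta>"
    unfolding cut_norm_def
  proof (rule cSUP_least)
    show "sets unit_interval \<times> sets unit_interval \<noteq> {}" by auto
    fix ST assume "ST \<in> sets unit_interval \<times> sets unit_interval"
    then obtain S T where ST: "ST = (S, T)" and S: "S \<in> sets unit_interval" and T: "T \<in> sets unit_interval" by auto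
    note [measurable] = S T
    have "(\<integral>z\<in>S \<times> T. (\<lambda>(x, y). pullback W f x y - graph_graphon n E x y) z \<partial>U.MM) =
        (\<integral>z. (Wf z - Bs z) * indicator (S \<times> T) z - (Hs z - Bs z) * indicator (S \<times> T) z \<partial>U.MM)"
      unfolding set_lebesgue_integral_def
    proof (rule Bochner_Integration.integral_cong[OF refl])
      fix z assume "z \<in> space U.MM"
      then have "graph_graphon n E (fst z) (snd z) = Hs z"
        unfolding E_def Hs_def b_def using H n0
        by (intro graph_graphon_shifted_edges) (auto simp: V_def space_pair_measure)
      then show "indicator (S \<times> T) z *\<^sub>R (case z of (x, y) \<Rightarrow> pullback W f x y - graph_graphon n E x y) =
          (Wf z - Bs z) * indicator (S \<times> T) z - (Hs z - Bs z) * indicator (S \<times> T) z"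
        by (simp add: split_def Wf_def algebra_simps)
    qed
    also have "\<dots> = (\<integral>z. (Wf z - Bs z) * indicator (S \<times> T) z \<partial>U.MM) - (\<integral>z. (Hs z - Bs z) * indicator (S \<times> T) z \<partial>U.MM)"
      using bounds hsb by (intro Bochner_Integration.integral_diff U.integrable_times_indicator S T)
        (auto intro!: abs_diff_le_1)
    also have "\<bar>\<dots>\<bar> \<le> \<eta>\<^sup>2 / 16 + 5 * \<eta>" using close[OF S T] close3[OF S T] by linarith
    also have "\<dots> \<le> 6 * \<eta>" using \<eta> by (simp add: power2_eq_square)
    finally show "(case ST of (S, T) \<Rightarrow> \<bar>\<integral>z\<in>S \<times> T. (\<lambda>(x, y). pullback W f x y - graph_graphon n E x y) z \<partial>U.MM\<bar>) \<le> 6 * \<eta>"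
      by (simp add: ST)
  qed
  then have "cut_dist M W unit_interval (graph_graphon n E) \<le> ereal (6 * \<eta>)"
    unfolding cut_dist_def using f by (intro INF_lower2[of f]) auto
  then show ?thesis using regE by blast
qed

section \<open>Spaces with atoms, and the choice of the constants\<close>

lemma (in prob_space) emeasure_singleton_atomless:
  assumes "atomless M" "real_retract M" "x \<in> space M"
  shows "emeasure M {x} = 0"
proof (rule ccontr)
  assume pos: "emeasure M {x} \<noteq> 0"
  then have "{x} \<in> sets M" by (rule emeasure_neq_0_sets)
  moreover have "emeasure M B = 0 \<or> emeasure M ({x} - B) = 0" if "B \<subseteq> {x}" for B
    using that by (auto simp: subset_singleton_iff)
  ultimately show False using assms(1) pos unfolding atomless_def by (auto simp: zero_less_iff_neq_zero)
qed

lemma real_retract_unit_interval: "real_retract unit_interval"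
  unfolding real_retract_def
proof (rule exI[of _ "\<lambda>x. x"], rule exI[of _ "\<lambda>x. if 0 \<le> x \<and> x < 1 then x else 0"], intro conjI)
  show "(\<lambda>x. x) \<in> borel_measurable unit_interval" by (rule measurable_unit_interval) simp
  show "(\<lambda>x. if 0 \<le> x \<and> x < 1 then x else (0::real)) \<in> borel \<rightarrow>\<^sub>M unit_interval"
    unfolding unit_interval_def by (rule measurable_restrict_space2) auto
qed auto

text \<open>The graph approximation asks for null points and almost constant degrees. Passing to the
  product with [0,1) secures the former through the second coordinate and preserves the latter,
  since the pullback depends on the first coordinate only.\<close>

lemma cut_approximation:
  fixes M :: "'a measure" and \<eta> d :: real and n t D :: nat
  defines "V \<equiv> {..<n}"
  assumes graphon: "graphon M W" and frac: "fractionally_isomorphic M W M (const_graphon d)"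
    and d: "0 \<le> d" "d \<le> 1" and \<eta>: "0 < \<eta>" "\<eta> \<le> 1 / 8"
    and t: "1 < real t * (\<eta>\<^sup>2 / 32)\<^sup>2" and n: "64 * 4 ^ t / \<eta>\<^sup>2 \<le> real n"
    and D: "\<forall>B. (\<forall>u\<in>V. \<forall>v\<in>V. B u v = B v u \<and> 0 \<le> B u v \<and> B u v \<le> 1) \<longrightarrow>
      (\<Sum>v\<in>V. \<bar>(\<Sum>u\<in>V. B v u) - d * real (card V)\<bar>) \<le> \<eta>\<^sup>2 / 8 * (real (card V))\<^sup>2 \<longrightarrow>
      (\<exists>H. H \<subseteq> V \<times> V \<and> sym H \<and> irrefl H \<and> (\<forall>v\<in>V. vertex_degree H v = D) \<and>
      (\<forall>S T. S \<subseteq> V \<longrightarrow> T \<subseteq> V \<longrightarrow>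
        \<bar>\<Sum>u\<in>S. \<Sum>v\<in>T. of_bool ((u, v) \<in> H) - B u v\<bar> \<le> 5 * \<eta> * (real (card V))\<^sup>2))"
  shows "\<exists>E. regular_graph D {1..n} E \<and> graph_cut_dist M W n E \<le> ereal (6 * \<eta>)"
proof -
  have "prob_space M" "standard_borel M" and W: "case_prod W \<in> borel_measurable (M \<Otimes>\<^sub>M M)"
    and Wb: "\<And>x y. x \<in> space M \<Longrightarrow> y \<in> space M \<Longrightarrow> W x y = W y x \<and> 0 \<le> W x y \<and> W x y \<le> 1"
    using graphon by (auto simp: graphon_def standard_prob_space_def)
  then interpret kernel M W unfolding kernel_def kernel_axioms_def by blast
  have retract: "real_retract M"
    by (rule standard_borel_imp_real_retract[OF \<open>standard_borel M\<close> not_empty])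
  have deg: "AE x in M. (\<integral>y. W x y \<partial>M) = d"
    by (rule fractionally_isomorphic_const_degree[OF graphon d frac])
  show ?thesis
  proof (cases "atomless M")
    case True
    then show ?thesis
      using graph_approximation[OF retract emeasure_singleton_atomless[OF True retract] deg \<eta> t n D[unfolded V_def]]
      by (simp add: graph_cut_dist_def)
  next
    case False
    let ?N = "M \<Otimes>\<^sub>M unit_interval"
    interpret L: prob_space unit_interval by (rule prob_space_unit_interval)
    interpret PL: pair_prob_space M unit_interval by unfold_locales
    have mp: "measure_preserving ?N M fst"
      unfolding measure_preserving_def
    proof
      show "distr ?N M fst = M"
      proof (rule measure_eqI)
        fix A assume A: "A \<in> sets (distr ?N M fst)"
        then have "fst -` A \<inter> space ?N = A \<times> space unit_interval"
          using sets.sets_into_space[of A M] by (auto simp: space_pair_measure)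
        moreover have "emeasure ?N (A \<times> space unit_interval) = emeasure M A"
          using A by (subst L.emeasure_pair_measure_Times) (simp_all add: L.emeasure_space_1 del: space_unit_interval)
        ultimately show "emeasure (distr ?N M fst) A = emeasure M A"
          using A by (simp add: emeasure_distr del: space_unit_interval)
      qed simp
    qed simp
    interpret K: kernel ?N "pullback W fst" by (rule kernel_pullback[OF mp]) unfold_locales
    have retN: "real_retract ?N" by (rule real_retract_pair[OF retract real_retract_unit_interval])
    have nullN: "emeasure ?N {z} = 0" for z
    proof (cases "{z} \<in> sets ?N")
      case True
      have "emeasure unit_interval {snd z} = 0"
      proof (cases "snd z \<in> {0..<1}")
        case True
        then show ?thesis by (simp add: emeasure_unit_interval)
      next
        case False
        then have "{snd z} \<notin> sets unit_interval" by (simp add: sets_unit_interval)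
        then show ?thesis by (rule emeasure_notin_sets)
      qed
      then have "AE u in unit_interval. u \<noteq> snd z"
        unfolding AE_unit_interval using AE_lborel_singleton[of "snd z"] by (auto elim: eventually_mono)
      from AE_pair_snd[OF prob_space_unit_interval this]
      have "AE w in ?N. w \<notin> {z}" by eventually_elim auto
      then show ?thesis using True by (subst (asm) AE_iff_measurable[of "{z}"]) (auto dest: sets.sets_into_space)
    qed (rule emeasure_notin_sets)
    have degN: "AE z in ?N. (\<integral>w. pullback W fst z w \<partial>?N) = d"
      using AE_pair_fst[OF prob_space_unit_interval deg] AE_space
    proof eventually_elim
      case (elim z)
      have "W (fst z) \<in> borel_measurable M"
        using elim(2) W by (auto simp: space_pair_measure intro: measurable_compose[OF measurable_Pair1'])
      from integral_distr[OF _ this, of fst ?N] show ?case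
        using elim(1) mp by (simp add: pullback_def measure_preserving_def)
    qed
    show ?thesis
      using K.graph_approximation[OF retN nullN degN \<eta> t n D[unfolded V_def]] False
      by (simp add: graph_cut_dist_def)
  qed
qed

theorem theorem1p3:
  fixes d :: real
    and \<U> :: "('a measure \<times> ('a \<Rightarrow> 'a \<Rightarrow> real)) set"
  assumes "0 \<le> d" and "d \<le> 1"
    and "\<forall>(M, W)\<in>\<U>. graphon M W"
    and "\<forall>(M, W)\<in>\<U>. fractionally_isomorphic M W M (const_graphon d)"
  shows "\<forall>\<epsilon>>0. \<exists>n0::nat. \<forall>n\<ge>n0. \<exists>(D::nat) (H :: 'a measure \<times> ('a \<Rightarrow> 'a \<Rightarrow> real) \<Rightarrow> nat set set).
           \<forall>(M, W)\<in>\<U>. regular_graph D {1..n} (H (M, W)) \<and>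
                      graph_cut_dist M W n (H (M, W)) \<le> ereal \<epsilon>"
proof (intro allI impI)
  fix \<epsilon> :: real assume "\<epsilon> > 0"
  \<comment> \<open>The final error is 6 \<eta>, and rounding requires \<eta> \<le> 1/8.\<close>
  define \<eta> where "\<eta> = min (\<epsilon> / 6) (1 / 8)"
  have \<eta>: "0 < \<eta>" "\<eta> \<le> 1 / 8" "6 * \<eta> \<le> \<epsilon>" using \<open>\<epsilon> > 0\<close> by (auto simp: \<eta>_def)
  obtain t :: nat where t: "1 < real t * (\<eta>\<^sup>2 / 32)\<^sup>2"
    using reals_Archimedean3[of "(\<eta>\<^sup>2 / 32)\<^sup>2"] \<eta> by (auto simp: zero_less_power2)
  define n0 where "n0 = nat \<lceil>max (64 * 4 ^ t / \<eta>\<^sup>2) (3200 / \<eta> ^ 4)\<rceil>"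
  show "\<exists>n0::nat. \<forall>n\<ge>n0. \<exists>(D::nat) (H :: 'a measure \<times> ('a \<Rightarrow> 'a \<Rightarrow> real) \<Rightarrow> nat set set).
           \<forall>(M, W)\<in>\<U>. regular_graph D {1..n} (H (M, W)) \<and>
                      graph_cut_dist M W n (H (M, W)) \<le> ereal \<epsilon>"
  proof (rule exI[of _ n0], intro allI impI)
    fix n assume "n0 \<le> n"
    then have "max (64 * 4 ^ t / \<eta>\<^sup>2) (3200 / \<eta> ^ 4) \<le> real n"
      unfolding n0_def by linarith
    then have n: "64 * 4 ^ t / \<eta>\<^sup>2 \<le> real n" "3200 / \<eta> ^ 4 \<le> real (card {..<n})" by auto
    \<comment> \<open>\<open>D\<close> is obtained before any member of the family is considered;
      only the matrix and the edge set depend on the graphon.\<close>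
    obtain D where D: "\<forall>B. (\<forall>u\<in>{..<n}. \<forall>v\<in>{..<n}. B u v = B v u \<and> 0 \<le> B u v \<and> B u v \<le> 1) \<longrightarrow>
      (\<Sum>v\<in>{..<n}. \<bar>(\<Sum>u\<in>{..<n}. B v u) - d * real (card {..<n})\<bar>) \<le> \<eta>\<^sup>2 / 8 * (real (card {..<n}))\<^sup>2 \<longrightarrow>
      (\<exists>H. H \<subseteq> {..<n} \<times> {..<n} \<and> sym H \<and> irrefl H \<and> (\<forall>v\<in>{..<n}. vertex_degree H v = D) \<and>
      (\<forall>S T. S \<subseteq> {..<n} \<longrightarrow> T \<subseteq> {..<n} \<longrightarrow>
        \<bar>\<Sum>u\<in>S. \<Sum>v\<in>T. of_bool ((u, v) \<in> H) - B u v\<bar> \<le> 5 * \<eta> * (real (card {..<n}))\<^sup>2))"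
      using regular_rounding[OF finite_lessThan \<eta>(1,2) n(2) assms(1,2)] by (elim exE)
    have "\<exists>E. regular_graph D {1..n} E \<and> graph_cut_dist (fst G) (snd G) n E \<le> ereal \<epsilon>" if G: "G \<in> \<U>" for G
    proof -
      have "graphon (fst G) (snd G)" "fractionally_isomorphic (fst G) (snd G) (fst G) (const_graphon d)"
        using assms(3,4) G by (auto simp: split_def)
      from cut_approximation[OF this assms(1,2) \<eta>(1,2) t n(1) D]
      obtain E where "regular_graph D {1..n} E" "graph_cut_dist (fst G) (snd G) n E \<le> ereal (6 * \<eta>)" by blast
      moreover have "ereal (6 * \<eta>) \<le> ereal \<epsilon>" using \<eta>(3) by simp
      ultimately show ?thesis using order_trans by blast
    qed
    then obtain H where "\<forall>G\<in>\<U>. regular_graph D {1..n} (H G) \<and> graph_cut_dist (fst G) (snd G) n (H G) \<le> ereal \<epsilon>"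
      by metis
    then show "\<exists>(D::nat) (H :: 'a measure \<times> ('a \<Rightarrow> 'a \<Rightarrow> real) \<Rightarrow> nat set set).
           \<forall>(M, W)\<in>\<U>. regular_graph D {1..n} (H (M, W)) \<and>
                      graph_cut_dist M W n (H (M, W)) \<le> ereal \<epsilon>"
      by (intro exI[of _ D] exI[of _ H]) auto
  qed
qed

end
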